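(* Let $k\ge2$, $m\ge2$, let $g\in C^1(\mathbb{R})$, let $h=(g,0,\dots,0):\mathbb{R}\to\mathbb{R}^m$, and let $b\in\mathbb{R}^k\setminus\{0\}$ be such that $g'(|b|)\ne0$. Then there exists a sequence of initial data $u_0^n:\mathbb{R}^m\to\mathbb{R}^k$ such that: 1. $\|u_0^n-b\|_{BV(\mathbb{R}^m)}+\|u_0^n-b\|_{\infty}\to0$ as $n\to\infty$; 2. $u_0^n=b$ on $\mathbb{R}^m\setminus B_\lambda(0)$ for some $\lambda>0$ independent of $n$; 3. if $u^n$ is the renormalized entropy solution of the Keyfitz–Kranzer system $$\partial_t u+\mathrm{div}_z(h(|u|)u)=0\quad (z\in\mathbb{R}^m,\ t>0),\qquad u(z,0)=u_0^n(z),$$ then $u^n(\cdot,t)\notin BV^s_{loc}$ for each $n\in\mathbb{N}$, $t\in(0,1)$ and $s\in(0,1)$.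
   Context: The unknown is $u:\mathbb{R}^m\times[0,\infty)\to\mathbb{R}^k$; componentwise the system reads $\partial_t u_j+\mathrm{div}_z(h(|u|)u_j)=0$, $j=1,\dots,k$. Renormalized entropy solution with initial datum $u_0$: $u=\eta\omega$, where $\eta=|u|$ is the Kruzhkov entropy solution of the scalar conservation law $\partial_t\eta+\mathrm{div}_z(h(\eta)\eta)=0$ with $\eta(\cdot,0)=|u_0|$, and $\omega=u/|u|$ solves in the weak (distributional) sense the transport equation $\partial_t(\eta\omega)+\mathrm{div}_z(h(\eta)\eta\omega)=0$ with $\omega(\cdot,0)=u_0/|u_0|$. $B_\lambda(0)$ is the ball of radius $\lambda$ centered at $0$. For $0<s\le1$, $\mathrm{Lip}^s(\mathbb{R},\mathbb{R})$ is the set of functions $L:\mathbb{R}\to\mathbb{R}$ with $|L(a)-L(c)|\le C|a-c|^s$ for all $a,c\in\mathbb{R}$, for some constant $C$; $BV^s_{loc}(\mathbb{R}^m,\mathbb{R})$ is the set of functions that can be written (almost everywhere) as $L\circ v$ with $L\in\mathrm{Lip}^s(\mathbb{R},\mathbb{R})$ and $v\in BV_{loc}(\mathbb{R}^m,\mathbb{R})$. An $\mathbb{R}^k$-valued function is in $BV^s_{loc}$ if each of its components is in $BV^s_{loc}(\mathbb{R}^m,\mathbb{R})$. *)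

theory Defs
  imports "HOL-Analysis.Analysis" "HOL-Probability.Essential_Supremum"
begin

subsection \<open>Test functions\<close>

primrec C_k :: "nat \<Rightarrow> ('a::euclidean_space \<Rightarrow> 'b::euclidean_space) \<Rightarrow> bool" where
  "C_k 0 f \<longleftrightarrow> continuous_on UNIV f"
| "C_k (Suc n) f \<longleftrightarrow>
     (\<forall>x. f differentiable (at x)) \<and> (\<forall>i\<in>Basis. C_k n (\<lambda>x. frechet_derivative f (at x) i))"

definition compact_support_in :: "'a::euclidean_space set \<Rightarrow> ('a \<Rightarrow> 'b::euclidean_space) \<Rightarrow> bool" where
  "compact_support_in \<Omega> f \<longleftrightarrow> (\<exists>K. compact K \<and> K \<subseteq> \<Omega> \<and> (\<forall>x. x \<notin> K \<longrightarrow> f x = 0))"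

definition test_function :: "('a::euclidean_space \<Rightarrow> real) \<Rightarrow> bool" where
  "test_function \<phi> \<longleftrightarrow> (\<forall>n. C_k n \<phi>) \<and> compact_support_in UNIV \<phi>"


subsection \<open>Functions of bounded variation and the classes BV^s_loc\<close>

definition divergence :: "('a::euclidean_space \<Rightarrow> 'a) \<Rightarrow> 'a \<Rightarrow> real" where
  "divergence F x = (\<Sum>i\<in>Basis. frechet_derivative F (at x) i \<bullet> i)"

text \<open>The competitors have one vector field per component of \<open>f\<close> and are bounded by 1 in the
  Frobenius norm. The set of competitors is symmetric, so cutting negative values off at 0
  with \<^term>\<open>ennreal\<close> does not change the supremum. The value is meaningful only for
  locally integrable \<open>f\<close>.\<close>

definition total_variation ::
    "'a::euclidean_space set \<Rightarrow> ('a \<Rightarrow> 'b::euclidean_space) \<Rightarrow> ennreal" where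
  "total_variation \<Omega> f =
     (SUP \<phi> \<in> {\<phi> :: 'b \<Rightarrow> 'a \<Rightarrow> 'a.
               (\<forall>j\<in>Basis. C_k 1 (\<phi> j) \<and> compact_support_in \<Omega> (\<phi> j)) \<and>
               (\<forall>x. (\<Sum>j\<in>Basis. (norm (\<phi> j x))\<^sup>2) \<le> 1)}.
        ennreal (\<integral>x. (\<Sum>j\<in>Basis. (f x \<bullet> j) * divergence (\<phi> j) x) \<partial>lebesgue))"

definition BV :: "('a::euclidean_space \<Rightarrow> 'b::euclidean_space) \<Rightarrow> bool" where
  "BV f \<longleftrightarrow> integrable lebesgue f \<and> total_variation UNIV f < \<infinity>"

definition BV_norm :: "('a::euclidean_space \<Rightarrow> 'b::euclidean_space) \<Rightarrow> ennreal" where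
  "BV_norm f = (\<integral>\<^sup>+x. ennreal (norm (f x)) \<partial>lebesgue) + total_variation UNIV f"

definition Linf_norm :: "('a::euclidean_space \<Rightarrow> 'b::euclidean_space) \<Rightarrow> ennreal" where
  "Linf_norm f = esssup lebesgue (\<lambda>x. ennreal (norm (f x)))"

definition BV_loc :: "('a::euclidean_space \<Rightarrow> 'b::euclidean_space) \<Rightarrow> bool" where
  "BV_loc f \<longleftrightarrow> (\<forall>K. compact K \<longrightarrow> set_integrable lebesgue K f) \<and>
               (\<forall>\<Omega>. open \<Omega> \<and> bounded \<Omega> \<longrightarrow> total_variation \<Omega> f < \<infinity>)"

definition Lip_s :: "real \<Rightarrow> (real \<Rightarrow> real) \<Rightarrow> bool" where
  "Lip_s s L \<longleftrightarrow> (\<exists>C. \<forall>a c. \<bar>L a - L c\<bar> \<le> C * \<bar>a - c\<bar> powr s)"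

definition BVs_loc_scalar :: "real \<Rightarrow> ('a::euclidean_space \<Rightarrow> real) \<Rightarrow> bool" where
  "BVs_loc_scalar s w \<longleftrightarrow> (\<exists>L v. Lip_s s L \<and> BV_loc v \<and> (AE z in lebesgue. w z = L (v z)))"

definition BVs_loc :: "real \<Rightarrow> ('a::euclidean_space \<Rightarrow> real ^ 'k) \<Rightarrow> bool" where
  "BVs_loc s w \<longleftrightarrow> (\<forall>j. BVs_loc_scalar s (\<lambda>z. w z $ j))"


subsection \<open>Solutions on the half space \<open>t \<ge> 0\<close>\<close>

text \<open>Test functions are smooth with compact support in \<open>(z,t)\<close>-space and need not vanish at
  \<open>t = 0\<close>, so that the initial datum is part of the integral (in)equality. With
  \<open>D = frechet_derivative \<phi> (at (z,t))\<close>, the time derivative of \<open>\<phi>\<close> is \<open>D (0,1)\<close>, and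
  \<open>D (v,0)\<close> is the inner product of \<open>v\<close> with the gradient of \<open>\<phi>\<close> in \<open>z\<close>.\<close>

abbreviation half_space :: "('a::euclidean_space \<times> real) set" where
  "half_space \<equiv> UNIV \<times> {0..}"

text \<open>Bounded Kruzhkov entropy solution \<open>\<eta>\<close> of \<open>\<partial>\<^sub>t \<eta> + div (f \<eta>) = 0\<close> with datum \<open>\<eta>0\<close>.\<close>

definition kruzhkov_entropy_solution ::
    "(real \<Rightarrow> 'a::euclidean_space) \<Rightarrow> ('a \<Rightarrow> real) \<Rightarrow> ('a \<Rightarrow> real \<Rightarrow> real) \<Rightarrow> bool" where
  "kruzhkov_entropy_solution f \<eta>0 \<eta> \<longleftrightarrow>
     (\<lambda>(z, t). \<eta> z t) \<in> borel_measurable (lebesgue_on half_space) \<and>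
     (\<exists>M. AE (z, t) in lebesgue_on half_space. \<bar>\<eta> z t\<bar> \<le> M) \<and>
     (\<forall>c \<phi>. test_function \<phi> \<and> (\<forall>p. 0 \<le> \<phi> p) \<longrightarrow>
        0 \<le> (\<integral>(z, t). \<bar>\<eta> z t - c\<bar> * frechet_derivative \<phi> (at (z, t)) (0, 1)
                  + sgn (\<eta> z t - c) * frechet_derivative \<phi> (at (z, t)) (f (\<eta> z t) - f c, 0)
               \<partial>lebesgue_on half_space)
            + (\<integral>z. \<bar>\<eta>0 z - c\<bar> * \<phi> (z, 0) \<partial>lebesgue))"

text \<open>Distributional solution \<open>\<omega>\<close> of \<open>\<partial>\<^sub>t (\<eta> \<omega>) + div (h(\<eta>) \<eta> \<omega>) = 0\<close>, where \<open>\<eta>\<close> has the initial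
  datum \<open>\<eta>0\<close> and \<open>\<omega>\<close> the initial datum \<open>\<omega>0\<close>.\<close>

definition weak_transport_solution ::
    "(real \<Rightarrow> 'a::euclidean_space) \<Rightarrow> ('a \<Rightarrow> real) \<Rightarrow> ('a \<Rightarrow> real \<Rightarrow> real) \<Rightarrow>
     ('a \<Rightarrow> 'b::euclidean_space) \<Rightarrow> ('a \<Rightarrow> real \<Rightarrow> 'b) \<Rightarrow> bool" where
  "weak_transport_solution h \<eta>0 \<eta> \<omega>0 \<omega> \<longleftrightarrow>
     (\<lambda>(z, t). \<omega> z t) \<in> borel_measurable (lebesgue_on half_space) \<and>
     (\<forall>\<phi>. test_function \<phi> \<longrightarrow>
        (\<integral>(z, t). (\<eta> z t * (frechet_derivative \<phi> (at (z, t)) (0, 1)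
                  + frechet_derivative \<phi> (at (z, t)) (h (\<eta> z t), 0))) *\<^sub>R \<omega> z t
           \<partial>lebesgue_on half_space)
        + (\<integral>z. (\<eta>0 z * \<phi> (z, 0)) *\<^sub>R \<omega>0 z \<partial>lebesgue) = 0)"

text \<open>A solution is determined only up to null sets of space-time. To give \<open>u(\<cdot>,t)\<close> a meaning
  (up to null sets of space) for every single \<open>t\<close>, the representative is taken to be
  weakly-* continuous in time.\<close>

definition weakstar_continuous_in_time ::
    "('a::euclidean_space \<Rightarrow> real \<Rightarrow> 'b::euclidean_space) \<Rightarrow> bool" where
  "weakstar_continuous_in_time u \<longleftrightarrow>
     (\<forall>t\<ge>0. (\<lambda>z. u z t) \<in> borel_measurable lebesgue) \<and>
     (\<exists>M. \<forall>t\<ge>0. AE z in lebesgue. norm (u z t) \<le> M) \<and>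
     (\<forall>\<phi>. test_function \<phi> \<longrightarrow> continuous_on {0..} (\<lambda>t. \<integral>z. \<phi> z *\<^sub>R u z t \<partial>lebesgue))"

text \<open>Here \<open>\<eta> = |u|\<close> and \<open>\<omega> = u/|u|\<close>, the latter being \<^term>\<open>sgn u\<close> (\<open>\<omega> = 0\<close> where \<open>u = 0\<close>; since
  only \<open>\<eta> \<omega>\<close> enters the equation, the value there is irrelevant).\<close>

definition renormalized_entropy_solution ::
    "(real \<Rightarrow> 'a::euclidean_space) \<Rightarrow> ('a \<Rightarrow> 'b::euclidean_space) \<Rightarrow> ('a \<Rightarrow> real \<Rightarrow> 'b) \<Rightarrow> bool" where
  "renormalized_entropy_solution h u0 u \<longleftrightarrow>
     weakstar_continuous_in_time u \<and>
     kruzhkov_entropy_solution (\<lambda>r. r *\<^sub>R h r) (\<lambda>z. norm (u0 z)) (\<lambda>z t. norm (u z t)) \<and>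
     weak_transport_solution h (\<lambda>z. norm (u0 z)) (\<lambda>z t. norm (u z t))
       (\<lambda>z. sgn (u0 z)) (\<lambda>z t. sgn (u z t))"

end

theory Submission
  imports Defs
begin

text \<open>Let \<open>a = |b|\<close>. The datum alternates, on thin strips normal to a second coordinate direction
  \<open>e2\<close>, between the moduli \<open>a\<close> and \<open>a + \<delta>\<close>, while its direction \<open>u/|u|\<close> is, on all these strips, the
  same square wave in the direction \<open>e1\<close> of the flow, with half period \<open>|g (a + \<delta>) - g a|\<close>. Inside a
  strip the modulus stays constant and the wave travels with speed \<open>g a\<close> or \<open>g (a + \<delta>)\<close>, so
  at time \<open>t < 1\<close> neighbouring strips are out of phase on a fraction \<open>t\<close> of their length and
  a component of \<open>u\<close> jumps there by about \<open>\<kappa> = a |\<omega> \<bullet> j - \<beta> \<bullet> j| / 2\<close>. If \<open>u = L \<circ> v\<close> with \<open>L\<close>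
  Hoelder of exponent \<open>s\<close>, then \<open>v\<close> jumps by at least a multiple of \<open>\<kappa> powr (1/s)\<close> across each of
  \<open>M\<close> strips, which bounds the variation of \<open>v\<close> from below by a multiple of \<open>M \<kappa> powr (1/s)\<close>. The
  data contain infinitely many layers of this kind, with amplitudes tending to \<open>0\<close> and numbers \<open>M\<close> of
  strips exceeding every power of \<open>1/\<kappa>\<close>. The variation of the data remains small because the moduli
  jump by \<open>\<delta>\<close> with \<open>M \<delta>\<close> small, and the waves live on a set so thin that their many jumps in the
  direction \<open>e1\<close> cost little.

  No uniqueness theory is needed. Where the initial modulus is a constant \<open>c\<close>, the entropy inequality
  with the constant \<open>c\<close>, tested in a backward cone, shows that the modulus stays equal to \<open>c\<close>, and
  the direction then solves a transport equation with constant velocity.\<close>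

text \<open>The flux points along \<open>e1\<close>, so domains of dependence shrink in that
  direction alone, and strips normal to \<open>e2\<close> do not interact, however thin they are.
  Their thickness \<open>d\<close> can be chosen last and cancels in the end: the out-of-phase set
  and the variation bound for a translation by \<open>d\<close> are both proportional to
  \<open>d\<close>, so only the number \<open>M\<close> of strips counts. The difficulty is to have
  \<open>M\<close> large against a power of the jump in direction while the datum stays small in BV.
  It is resolved by decoupling two amplitudes: the step \<delta> of the modulus may be tiny compared
  with the jump in direction, because it only has to make the two speeds different (this is where
  the nonzero derivative of \<open>g\<close> enters). The half period \<open>l\<close> is then
  fitted to the difference of speeds, so that dephasing takes unit time in every layer. Hence the
  order of choice: \<omega>, M, \<delta>, l, K, d. The layers fill dyadic bands accumulating at
  height 0, so every datum has infinitely many in a bounded set. Layer i is built to beat the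
  exponent i, which defeats all s at once.\<close>

subsection \<open>Smooth functions and bumps\<close>

lemma C_k_SucI:
  assumes "\<And>x. (f has_derivative f' x) (at x)" "\<And>i. i \<in> Basis \<Longrightarrow> C_k n (\<lambda>x. f' x i)"
  shows "C_k (Suc n) f"
proof -
  have "frechet_derivative f (at x) = f' x" for x
    using frechet_derivative_at[OF assms(1)] by simp
  then show ?thesis
    using assms by (auto simp: differentiable_def)
qed

lemma C_k_Suc_has_derivative:
  "C_k (Suc n) f \<Longrightarrow> (f has_derivative frechet_derivative f (at x)) (at x)"
  by (simp add: frechet_derivative_works)

lemma C_k_Suc_directional: "C_k (Suc n) f \<Longrightarrow> i \<in> Basis \<Longrightarrow> C_k n (\<lambda>x. frechet_derivative f (at x) i)"
  by simp

lemma C_k_Suc_imp: "C_k (Suc n) f \<Longrightarrow> C_k n f"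
proof (induction n arbitrary: f)
  case 0
  then have "\<And>x. f differentiable (at x)" by simp
  then show ?case
    by (simp add: continuous_on_eq_continuous_at differentiable_imp_continuous_within)
next
  case (Suc n)
  have d: "\<forall>x. f differentiable (at x)"
    and c: "\<forall>i\<in>Basis. C_k (Suc n) (\<lambda>x. frechet_derivative f (at x) i)"
    using Suc.prems unfolding C_k.simps(2)[of "Suc n"] by blast+
  from c Suc.IH have "\<forall>i\<in>Basis. C_k n (\<lambda>x. frechet_derivative f (at x) i)" by blast
  with d show ?case unfolding C_k.simps(2)[of n] by blast
qed

lemma C_k_const: "C_k n (\<lambda>x. c)"
  by (induction n arbitrary: c) auto

lemma C_k_bounded_linear_comp:
  assumes L: "bounded_linear L"
  shows "C_k n f \<Longrightarrow> C_k n (\<lambda>x. L (f x))"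
proof (induction n arbitrary: f)
  case 0
  then show ?case using bounded_linear.continuous_on[OF L] by simp
next
  case (Suc n)
  show ?case
  proof (rule C_k_SucI)
    show "((\<lambda>x. L (f x)) has_derivative (\<lambda>h. L (frechet_derivative f (at x) h))) (at x)" for x
      by (rule bounded_linear.has_derivative[OF L C_k_Suc_has_derivative[OF Suc.prems]])
  qed (use Suc in auto)
qed

lemma C_k_add: "C_k n f \<Longrightarrow> C_k n g \<Longrightarrow> C_k n (\<lambda>x. f x + g x)"
proof (induction n arbitrary: f g)
  case 0
  then show ?case by (simp add: continuous_on_add)
next
  case (Suc n)
  show ?case
  proof (rule C_k_SucI)
    show "((\<lambda>x. f x + g x) has_derivative
        (\<lambda>h. frechet_derivative f (at x) h + frechet_derivative g (at x) h)) (at x)" for x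
      using Suc.prems by (intro has_derivative_add C_k_Suc_has_derivative)
  qed (use Suc in auto)
qed

lemma C_k_scaleR:
  fixes f :: "'a::euclidean_space \<Rightarrow> real"
  shows "C_k n f \<Longrightarrow> C_k n g \<Longrightarrow> C_k n (\<lambda>x. f x *\<^sub>R g x)"
proof (induction n arbitrary: f g)
  case 0
  then show ?case by (simp add: continuous_on_scaleR)
next
  case (Suc n)
  show ?case
  proof (rule C_k_SucI)
    show "((\<lambda>x. f x *\<^sub>R g x) has_derivative
        (\<lambda>h. f x *\<^sub>R frechet_derivative g (at x) h + frechet_derivative f (at x) h *\<^sub>R g x)) (at x)" for x
      using Suc.prems by (intro has_derivative_scaleR C_k_Suc_has_derivative)
    show "C_k n (\<lambda>x. f x *\<^sub>R frechet_derivative g (at x) i + frechet_derivative f (at x) i *\<^sub>R g x)"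
      if "i \<in> Basis" for i
      by (rule C_k_add[OF Suc.IH Suc.IH])
        (use Suc.prems that in \<open>auto simp del: C_k.simps intro: C_k_Suc_imp C_k_Suc_directional\<close>)
  qed
qed

lemma C_k_mult:
  fixes f g :: "'a::euclidean_space \<Rightarrow> real"
  shows "C_k n f \<Longrightarrow> C_k n g \<Longrightarrow> C_k n (\<lambda>x. f x * g x)"
  using C_k_scaleR[of n f g] by simp

lemma C_k_sum: "(\<And>i. i \<in> A \<Longrightarrow> C_k n (f i)) \<Longrightarrow> C_k n (\<lambda>x. \<Sum>i\<in>A. f i x)"
  by (induction A rule: infinite_finite_induct) (auto intro: C_k_add simp: C_k_const)

lemma C_k_prod:
  fixes f :: "'i \<Rightarrow> 'a::euclidean_space \<Rightarrow> real"
  shows "(\<And>i. i \<in> A \<Longrightarrow> C_k n (f i)) \<Longrightarrow> C_k n (\<lambda>x. \<Prod>i\<in>A. f i x)"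
  by (induction A rule: infinite_finite_induct) (auto intro: C_k_mult simp: C_k_const)

text \<open>The chain rule yields derivatives of \<open>f\<close> in the directions
  \<open>A i\<close>, while the recursion of \<open>C_k\<close> only looks at basis directions.
  Expanding \<open>A h\<close> in the basis brings every term under the induction
  hypothesis.\<close>

lemma C_k_compose_affine:
  fixes A :: "'c::euclidean_space \<Rightarrow> 'a::euclidean_space"
  assumes A: "bounded_linear A"
  shows "C_k n f \<Longrightarrow> C_k n (\<lambda>x. f (A x + c))"
proof (induction n arbitrary: f)
  case 0
  have "continuous_on UNIV (\<lambda>x. A x + c)"
    by (intro continuous_intros bounded_linear.continuous_on[OF A])
  then show ?case using continuous_on_compose2[of UNIV f UNIV "\<lambda>x. A x + c"] 0 by simp
next
  case (Suc n)
  show ?case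
  proof (rule C_k_SucI)
    fix x
    have "((\<lambda>x. A x + c) has_derivative A) (at x)"
      using has_derivative_add[OF bounded_linear_imp_has_derivative[OF A] has_derivative_const] by simp
    from diff_chain_at[OF this C_k_Suc_has_derivative[OF Suc.prems]]
    have *: "((\<lambda>x. f (A x + c)) has_derivative (\<lambda>h. frechet_derivative f (at (A x + c)) (A h))) (at x)"
      by (simp add: o_def)
    have lin: "linear (frechet_derivative f (at (A x + c)))"
      using Suc.prems by (simp add: linear_frechet_derivative)
    have "frechet_derivative f (at (A x + c)) (A h) =
        (\<Sum>b\<in>Basis. (A h \<bullet> b) *\<^sub>R frechet_derivative f (at (A x + c)) b)" for h
    proof -
      have "frechet_derivative f (at (A x + c)) (A h) =
          frechet_derivative f (at (A x + c)) (\<Sum>b\<in>Basis. (A h \<bullet> b) *\<^sub>R b)"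
        by (simp add: euclidean_representation)
      also have "\<dots> = (\<Sum>b\<in>Basis. (A h \<bullet> b) *\<^sub>R frechet_derivative f (at (A x + c)) b)"
        by (simp add: linear_sum[OF lin] linear_scale[OF lin])
      finally show ?thesis .
    qed
    with * show "((\<lambda>x. f (A x + c)) has_derivative
        (\<lambda>h. \<Sum>b\<in>Basis. (A h \<bullet> b) *\<^sub>R frechet_derivative f (at (A x + c)) b)) (at x)"
      by simp
  next
    show "C_k n (\<lambda>x. \<Sum>b\<in>Basis. (A i \<bullet> b) *\<^sub>R frechet_derivative f (at (A x + c)) b)" for i
      by (intro C_k_sum C_k_scaleR[OF C_k_const] Suc.IH[OF C_k_Suc_directional[OF Suc.prems]])
  qed
qed

lemma C_k_linear:
  assumes "bounded_linear A"
  shows "C_k n (\<lambda>x. A x)"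
proof (cases n)
  case 0
  then show ?thesis using assms by (simp add: linear_continuous_on)
next
  case (Suc m)
  have "C_k (Suc m) A"
    by (rule C_k_SucI[where f' = "\<lambda>x. A"])
      (auto intro: bounded_linear_imp_has_derivative assms C_k_const)
  then show ?thesis by (simp only: Suc)
qed

lemma C_k_real_polynomial_function:
  fixes p :: "'a::euclidean_space \<Rightarrow> real"
  assumes "real_polynomial_function p"
  shows "C_k n p"
  using assms by induction (auto intro: C_k_linear C_k_const C_k_add C_k_mult)

lemma C_k_imp_continuous_on: "C_k n f \<Longrightarrow> continuous_on S f"
proof (induction n arbitrary: f)
  case 0
  then show ?case using continuous_on_subset by auto
next
  case (Suc n)
  then show ?case using C_k_Suc_imp by blast
qed

lemma continuous_on_frechet_derivative:
  assumes "C_k (Suc n) f"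
  shows "continuous_on S (\<lambda>x. frechet_derivative f (at x) v)"
proof -
  have "frechet_derivative f (at x) v = (\<Sum>b\<in>Basis. (v \<bullet> b) *\<^sub>R frechet_derivative f (at x) b)" for x
  proof -
    have lin: "linear (frechet_derivative f (at x))"
      using assms by (simp add: linear_frechet_derivative)
    have "frechet_derivative f (at x) v = frechet_derivative f (at x) (\<Sum>b\<in>Basis. (v \<bullet> b) *\<^sub>R b)"
      by (simp add: euclidean_representation)
    also have "\<dots> = (\<Sum>b\<in>Basis. (v \<bullet> b) *\<^sub>R frechet_derivative f (at x) b)"
      by (simp add: linear_sum[OF lin] linear_scale[OF lin])
    finally show ?thesis .
  qed
  moreover have "continuous_on S (\<lambda>x. \<Sum>b\<in>Basis. (v \<bullet> b) *\<^sub>R frechet_derivative f (at x) b)"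
    using assms by (intro continuous_intros) (auto intro: C_k_imp_continuous_on)
  ultimately show ?thesis by simp
qed

text \<open>The powers of \<open>1 / x\<close> make the family closed under differentiation: the
  derivative of \<open>flat_exp n\<close> is
  \<open>flat_exp (n + 2) x - n * flat_exp (Suc n) x\<close>. Smoothness of the classical case
  \<open>n = 0\<close> then follows by induction on the order, for all \<open>n\<close>
  simultaneously.\<close>

definition flat_exp :: "nat \<Rightarrow> real \<Rightarrow> real" where
  "flat_exp n x = (if x \<le> 0 then 0 else (1 / x) ^ n * exp (- (1 / x)))"

lemma flat_exp_tendsto_0: "(flat_exp n \<longlongrightarrow> 0) (at 0)"
proof -
  have "((\<lambda>x. x ^ n / exp x) \<longlongrightarrow> 0) (at_top :: real filter)"
    by (rule tendsto_power_div_exp_0)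
  then have "((\<lambda>x. inverse x ^ n / exp (inverse x)) \<longlongrightarrow> 0) (at_right (0::real))"
    using filterlim_compose filterlim_inverse_at_top_right by blast
  then have r: "(flat_exp n \<longlongrightarrow> 0) (at_right 0)"
  proof (rule Lim_transform_eventually)
    show "\<forall>\<^sub>F x in at_right (0::real). inverse x ^ n / exp (inverse x) = flat_exp n x"
      by (rule eventually_at_rightI[of _ 1])
         (auto simp: flat_exp_def divide_inverse exp_minus)
  qed
  have l: "(flat_exp n \<longlongrightarrow> 0) (at_left 0)"
    by (rule tendsto_eventually) (auto simp: flat_exp_def eventually_at_filter)
  show ?thesis using l r by (simp add: filterlim_split_at)
qed

lemma flat_exp_has_derivative:
  "(flat_exp n has_real_derivative (flat_exp (n + 2) x - n * flat_exp (Suc n) x)) (at x)"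
proof -
  consider "x < 0" | "x = 0" | "x > 0" by linarith
  then show ?thesis
  proof cases
    case 1
    have "((\<lambda>x. 0) has_real_derivative 0) (at x)" by simp
    then have "(flat_exp n has_real_derivative 0) (at x)"
      by (rule has_field_derivative_transform_within_open[of _ _ _ "{..<0}"])
        (use 1 in \<open>auto simp: flat_exp_def\<close>)
    then show ?thesis using 1 by (simp add: flat_exp_def)
  next
    case 2
    \<comment> \<open>At 0 the difference quotient of \<open>flat_exp n\<close> is
      \<open>flat_exp (Suc n)\<close> itself, which tends to 0.\<close>
    have "((\<lambda>y. (flat_exp n y - flat_exp n 0) / (y - 0)) \<longlongrightarrow> 0) (at 0)"
      using flat_exp_tendsto_0[of "Suc n"]
    proof (rule Lim_transform_eventually)
      show "\<forall>\<^sub>F y in at (0::real). flat_exp (Suc n) y = (flat_exp n y - flat_exp n 0) / (y - 0)"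
        by (simp add: flat_exp_def)
    qed
    then show ?thesis using 2 by (simp add: has_field_derivative_iff flat_exp_def)
  next
    case 3
    have "((\<lambda>x. (1 / x) ^ n * exp (- (1 / x))) has_real_derivative
        (flat_exp (n + 2) x - n * flat_exp (Suc n) x)) (at x)"
    proof -
      have "((\<lambda>x. (1 / x) ^ n * exp (- (1 / x))) has_real_derivative
          (real n * (1 / x) ^ (n - 1) * (- (1 / x\<^sup>2))) * exp (- (1 / x)) + (1 / x) ^ n * (exp (- (1 / x)) * (1 / x\<^sup>2))) (at x)"
        using 3 by (auto intro!: derivative_eq_intros simp: power2_eq_square)
      moreover have eq: "real n * (1 / x) ^ (n - 1) * (1 / x\<^sup>2) = real n * (1 / x) ^ Suc n"
        by (cases n) (auto simp: power2_eq_square)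
      have "real n * (1 / x) ^ (n - 1) * (- (1 / x\<^sup>2)) * exp (- (1 / x)) + (1 / x) ^ n * (exp (- (1 / x)) * (1 / x\<^sup>2))
          = flat_exp (n + 2) x - n * flat_exp (Suc n) x"
        using 3 unfolding mult_minus_right eq mult_minus_left
        by (simp add: flat_exp_def power_add power2_eq_square)
      ultimately show ?thesis by (simp only:)
    qed
    then show ?thesis
      by (rule has_field_derivative_transform_within_open[of _ _ _ "{0<..}"])
        (use 3 in \<open>auto simp: flat_exp_def\<close>)
  qed
qed

lemma C_k_flat_exp: "C_k k (flat_exp n)"
proof (induction k arbitrary: n)
  case 0
  then show ?case
    using DERIV_isCont[OF flat_exp_has_derivative] by (simp add: continuous_on_eq_continuous_at)
next
  case (Suc k)
  show ?case
  proof (rule C_k_SucI)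
    show "(flat_exp n has_derivative (\<lambda>h. (flat_exp (n + 2) x - n * flat_exp (Suc n) x) * h)) (at x)" for x
      using flat_exp_has_derivative[of n x] by (simp add: has_field_derivative_def)
    show "C_k k (\<lambda>x. (flat_exp (n + 2) x - n * flat_exp (Suc n) x) * i)" for i
      using C_k_mult[OF C_k_add[OF Suc.IH[of "n + 2"] C_k_mult[OF C_k_const[of _ "- real n"] Suc.IH[of "Suc n"]]] C_k_const[of _ i]]
      by (simp add: algebra_simps)
  qed
qed

abbreviation bump :: "real \<Rightarrow> real" where "bump \<equiv> flat_exp 0"

lemma bump_pos_iff: "0 < bump x \<longleftrightarrow> 0 < x" by (simp add: flat_exp_def)
lemma bump_nonneg: "0 \<le> bump x" by (simp add: flat_exp_def)
lemma bump_le_1: "bump x \<le> 1" by (simp add: flat_exp_def)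
lemma bump_eq_0_iff: "bump x = 0 \<longleftrightarrow> x \<le> 0" by (simp add: flat_exp_def)

lemma C_k_bump_affine:
  fixes A :: "'a::euclidean_space \<Rightarrow> real"
  assumes "bounded_linear A"
  shows "C_k k (\<lambda>x. bump (A x + c))"
  by (rule C_k_compose_affine[OF assms C_k_flat_exp])

definition box_bump :: "'a::euclidean_space \<Rightarrow> 'a \<Rightarrow> 'a \<Rightarrow> real" where
  "box_bump p q z = (\<Prod>i\<in>Basis. bump (z \<bullet> i - p \<bullet> i) * bump (q \<bullet> i - z \<bullet> i))"

lemma C_k_box_bump: "C_k k (box_bump p q)"
proof -
  have "C_k k (\<lambda>z::'a. bump (z \<bullet> i - p \<bullet> i))" "C_k k (\<lambda>z::'a. bump (q \<bullet> i - z \<bullet> i))" for i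
    using C_k_bump_affine[OF bounded_linear_inner_left[of i], of k "- (p \<bullet> i)"]
      C_k_bump_affine[OF bounded_linear_minus[OF bounded_linear_inner_left[of i]], of k "q \<bullet> i"]
    by (simp_all add: add.commute)
  then show ?thesis unfolding box_bump_def by (intro C_k_prod C_k_mult)
qed

lemma box_bump_nonneg: "0 \<le> box_bump p q z"
  by (simp add: box_bump_def prod_nonneg bump_nonneg)

lemma box_bump_le_1: "box_bump p q z \<le> 1"
  unfolding box_bump_def
  using bump_nonneg bump_le_1 by (intro prod_le_1) (auto simp: mult_le_one)

lemma box_bump_eq_0_iff: "box_bump p q z = 0 \<longleftrightarrow> z \<notin> box p q"
  unfolding box_bump_def by (simp add: bump_eq_0_iff mem_box not_less)

lemma box_bump_pos_iff: "0 < box_bump p q z \<longleftrightarrow> z \<in> box p q"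
  using box_bump_eq_0_iff[of p q z] box_bump_nonneg[of p q z] by linarith

lemma test_functionI:
  assumes "\<And>n. C_k n f" "bounded S" "\<And>x. x \<notin> S \<Longrightarrow> f x = 0"
  shows "test_function f"
  unfolding test_function_def compact_support_in_def
proof (intro conjI allI exI)
  show "compact (closure S)" using assms(2) by simp
  show "x \<notin> closure S \<longrightarrow> f x = 0" for x
    using assms(3) closure_subset by blast
qed (use assms(1) in auto)

lemma test_function_C_k: "test_function f \<Longrightarrow> C_k n f"
  by (simp add: test_function_def)

lemma test_function_has_derivative:
  "test_function f \<Longrightarrow> (f has_derivative frechet_derivative f (at x)) (at x)"
  using C_k_Suc_has_derivative test_function_C_k by blast

lemma test_function_support:
  assumes "test_function f"
  obtains r where "r > 0" "\<And>x. r \<le> norm x \<Longrightarrow> f x = 0"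
proof -
  obtain K where K: "compact K" "\<And>x. x \<notin> K \<Longrightarrow> f x = 0"
    using assms by (auto simp: test_function_def compact_support_in_def)
  obtain r where r: "r > 0" "\<And>x. x \<in> K \<Longrightarrow> norm x < r"
    using compact_imp_bounded[OF K(1)] unfolding bounded_pos_less by blast
  then show ?thesis using that[of r] K by force
qed

lemma test_function_box_bump: "test_function (box_bump p q)"
  by (rule test_functionI[of _ "box p q"]) (auto simp: C_k_box_bump bounded_box box_bump_eq_0_iff)

subsection \<open>Translations and total variation\<close>

lemma lebesgue_shift_measurable: "(\<lambda>x::'a::euclidean_space. t + x) \<in> lebesgue \<rightarrow>\<^sub>M lebesgue"
  using lebesgue_affine_measurable[of "\<lambda>_. 1" t] by (simp add: euclidean_representation)

lemma lebesgue_distr_shift: "distr lebesgue lebesgue (\<lambda>x::'a::euclidean_space. t + x) = lebesgue"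
  using lebesgue_affine_euclidean[of "\<lambda>_. 1" t] by (simp add: euclidean_representation density_1)

lemma lebesgue_integral_shift:
  fixes f :: "'a::euclidean_space \<Rightarrow> 'b::{banach,second_countable_topology}"
  assumes "f \<in> borel_measurable lebesgue"
  shows "(\<integral>x. f (t + x) \<partial>lebesgue) = (\<integral>x. f x \<partial>lebesgue)"
  using integral_distr[OF lebesgue_shift_measurable[of t] assms] by (simp add: lebesgue_distr_shift)

lemma lebesgue_integrable_shift:
  fixes f :: "'a::euclidean_space \<Rightarrow> 'b::{banach,second_countable_topology}"
  assumes "integrable lebesgue f"
  shows "integrable lebesgue (\<lambda>x. f (t + x))"
  using integrable_distr[OF lebesgue_shift_measurable[of t], of f] assms by (simp add: lebesgue_distr_shift)

lemma lebesgue_measurable_shift: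
  "f \<in> borel_measurable lebesgue \<Longrightarrow> (\<lambda>x. f (t + x)) \<in> borel_measurable lebesgue"
  using measurable_compose[OF lebesgue_shift_measurable] .

lemma AE_lebesgue_shift:
  assumes "AE x in lebesgue. P x"
  shows "AE x in lebesgue. P (t + x)"
  using AE_distrD[OF lebesgue_shift_measurable[of t], of P] assms unfolding lebesgue_distr_shift by blast

section \<open>Local integrability, and integrals of absolute values as suprema over smooth
  functions\<close>

definition loc_integrable :: "('a::euclidean_space \<Rightarrow> real) \<Rightarrow> bool" where
  "loc_integrable w \<longleftrightarrow> (\<forall>K. compact K \<longrightarrow> set_integrable lebesgue K w)"

lemma continuous_on_UNIV_lebesgue_measurable:
  "continuous_on UNIV f \<Longrightarrow> f \<in> borel_measurable lebesgue"
  by (intro measurable_completion) (simp add: borel_measurable_continuous_onI)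

lemma loc_integrable_times:
  assumes w: "loc_integrable w" and s: "continuous_on UNIV s" "compact K" "\<And>x. x \<notin> K \<Longrightarrow> s x = 0"
  shows "integrable lebesgue (\<lambda>x. w x * s x)"
proof -
  have "bounded (s ` K)"
    by (intro compact_imp_bounded compact_continuous_image continuous_on_subset[OF s(1)] s(2)) simp
  then obtain B where "\<forall>y\<in>s ` K. norm y \<le> B"
    unfolding bounded_iff by blast
  then have B: "\<bar>s x\<bar> \<le> B" if "x \<in> K" for x using that by simp
  have i: "integrable lebesgue (\<lambda>x. indicator K x * w x)"
    using w s(2) by (simp add: loc_integrable_def set_integrable_def)
  have "(\<lambda>x. (indicator K x * w x) * s x) = (\<lambda>x. w x * s x)"
    using s(3) by (auto simp: indicator_def fun_eq_iff)
  moreover have "integrable lebesgue (\<lambda>x. (indicator K x * w x) * s x)"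
  proof (rule Bochner_Integration.integrable_bound)
    show "integrable lebesgue (\<lambda>x. B * (indicator K x * w x))" using i by simp
    show "(\<lambda>x. (indicator K x * w x) * s x) \<in> borel_measurable lebesgue"
      using borel_measurable_integrable[OF i] continuous_on_UNIV_lebesgue_measurable[OF s(1)]
      by (rule borel_measurable_times)
    have "\<bar>(indicator K x * w x) * s x\<bar> \<le> \<bar>B * (indicator K x * w x)\<bar>" for x
    proof (cases "x \<in> K")
      case True
      then have "\<bar>s x\<bar> \<le> \<bar>B\<bar>" using B[OF True] by linarith
      from mult_right_mono[OF this, of "\<bar>w x\<bar>"] show ?thesis
        using True by (simp add: abs_mult mult.commute)
    qed simp
    then show "AE x in lebesgue. norm ((indicator K x * w x) * s x) \<le> norm (B * (indicator K x * w x))"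
      by simp
  qed
  ultimately show ?thesis by simp
qed

text \<open>Duality: the optimal multiplier would be \<open>\<theta> x * sgn (w x)\<close>, which is
  not smooth. It is an almost everywhere limit of test functions dominated by \<theta>, and
  dominated convergence carries the bound over. This turns estimates tested with smooth functions
  into estimates of integrals of absolute values.\<close>

lemma integral_abs_le_dual:
  fixes w \<theta> :: "'a::euclidean_space \<Rightarrow> real"
  assumes chi: "test_function \<theta>" "\<And>x. 0 \<le> \<theta> x"
    and w: "w \<in> borel_measurable lebesgue" and int: "integrable lebesgue (\<lambda>x. \<theta> x * w x)"
    and le: "\<And>\<sigma>. test_function \<sigma> \<Longrightarrow> (\<And>x. \<bar>\<sigma> x\<bar> \<le> \<theta> x) \<Longrightarrow> (\<integral>x. \<sigma> x * w x \<partial>lebesgue) \<le> A"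
  shows "(\<integral>x. \<theta> x * \<bar>w x\<bar> \<partial>lebesgue) \<le> A"
proof -
  obtain K where K: "compact K" "\<And>x. x \<notin> K \<Longrightarrow> \<theta> x = 0"
    using chi(1) by (auto simp: test_function_def compact_support_in_def)
  have "(\<lambda>x. sgn (w x)) \<in> borel_measurable lebesgue" using w by simp
  then have "(\<lambda>x. sgn (w x)) measurable_on UNIV"
    by (rule lebesgue_measurable_imp_measurable_on_real) simp
  then have "\<exists>N g. negligible N \<and> (\<forall>n. continuous_on UNIV (g n)) \<and>
      (\<forall>x. x \<notin> N \<longrightarrow> (\<lambda>n. g n x) \<longlonglongrightarrow> sgn (w x))"
    by (simp add: measurable_on_def)
  then obtain N and g :: "nat \<Rightarrow> 'a \<Rightarrow> real" where N: "negligible N" and g: "\<And>n. continuous_on UNIV (g n)"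
    and lim: "\<And>x. x \<notin> N \<Longrightarrow> (\<lambda>n. g n x) \<longlonglongrightarrow> sgn (w x)"
    by metis
  \<comment> \<open>The continuous approximations of \<open>sgn (w x)\<close> are cut off at modulus
    1 and then replaced on \<open>K\<close> by polynomials, which are smooth; outside
    \<open>K\<close> the factor \<theta> vanishes.\<close>
  define c where "c n x = max (-1) (min 1 (g n x))" for n x
  have c: "continuous_on K (c n)" for n
    unfolding c_def using continuous_on_subset[OF g] by (intro continuous_intros) auto
  define \<epsilon> where "\<epsilon> n = inverse (real (Suc n))" for n
  have eps: "0 < \<epsilon> n" "\<epsilon> \<longlonglongrightarrow> 0" for n
    using LIMSEQ_inverse_real_of_nat by (auto simp: \<epsilon>_def[abs_def])
  have "\<exists>p. real_polynomial_function p \<and> (\<forall>x\<in>K. \<bar>c n x - p x\<bar> < \<epsilon> n)" for n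
  proof -
    obtain q where "real_polynomial_function q" "\<And>x. x \<in> K \<Longrightarrow> \<bar>c n x - q x\<bar> < \<epsilon> n"
      by (rule Stone_Weierstrass_real_polynomial_function[OF K(1) c eps(1)]) blast
    then show ?thesis by blast
  qed
  then obtain p where p: "\<And>n. real_polynomial_function (p n)"
    and pc: "\<And>n x. x \<in> K \<Longrightarrow> \<bar>c n x - p n x\<bar> < \<epsilon> n"
    by metis
  \<comment> \<open>The polynomial may exceed 1 by \<open>\<epsilon> n\<close>. The factor
    \<open>inverse (1 + \<epsilon> n)\<close> restores the domination by \<theta> and disappears in
    the limit.\<close>
  define \<sigma> where "\<sigma> n x = \<theta> x * (inverse (1 + \<epsilon> n) * p n x)" for n x
  have test: "test_function (\<sigma> n)" for n
    unfolding \<sigma>_def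
  proof (rule test_functionI)
    show "C_k k (\<lambda>x. \<theta> x * (inverse (1 + \<epsilon> n) * p n x))" for k
      by (intro C_k_mult C_k_const C_k_real_polynomial_function p test_function_C_k chi(1))
    show "bounded K" using K(1) by (rule compact_imp_bounded)
  qed (simp add: K(2))
  have abs: "\<bar>\<sigma> n x\<bar> \<le> \<theta> x" for n x
  proof (cases "x \<in> K")
    case True
    have "\<bar>p n x\<bar> \<le> \<bar>c n x\<bar> + \<epsilon> n" using pc[OF True, of n] by linarith
    moreover have "\<bar>c n x\<bar> \<le> 1" by (auto simp: c_def)
    ultimately have "\<bar>p n x\<bar> \<le> 1 + \<epsilon> n" by linarith
    then have "\<bar>inverse (1 + \<epsilon> n) * p n x\<bar> \<le> 1"
      using eps(1)[of n] by (simp add: abs_mult divide_inverse[symmetric] field_simps)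
    from mult_left_mono[OF this chi(2)[of x]] show ?thesis using chi(2)[of x] unfolding \<sigma>_def
      by (simp only: abs_mult abs_of_nonneg mult_1_right)
  qed (use K(2) in \<open>simp add: \<sigma>_def\<close>)
  have *: "(\<lambda>n. \<integral>x. \<sigma> n x * w x \<partial>lebesgue) \<longlonglongrightarrow> (\<integral>x. \<theta> x * \<bar>w x\<bar> \<partial>lebesgue)"
  proof (rule integral_dominated_convergence[where w = "\<lambda>x. \<bar>\<theta> x * w x\<bar>"])
    have "\<theta> \<in> borel_measurable lebesgue"
      using continuous_on_UNIV_lebesgue_measurable C_k_imp_continuous_on test_function_C_k[OF chi(1)] by blast
    then show "(\<lambda>x. \<theta> x * \<bar>w x\<bar>) \<in> borel_measurable lebesgue" using w by simp
    have "\<sigma> n \<in> borel_measurable lebesgue" for n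
      using continuous_on_UNIV_lebesgue_measurable C_k_imp_continuous_on test_function_C_k[OF test] by blast
    then show "(\<lambda>x. \<sigma> n x * w x) \<in> borel_measurable lebesgue" for n using w by simp
    show "integrable lebesgue (\<lambda>x. \<bar>\<theta> x * w x\<bar>)" using int by simp
    have "N \<in> null_sets lebesgue" using N by (simp add: negligible_iff_null_sets)
    then have "AE x in lebesgue. x \<notin> N" by (rule AE_not_in)
    then show "AE x in lebesgue. (\<lambda>n. \<sigma> n x * w x) \<longlonglongrightarrow> \<theta> x * \<bar>w x\<bar>"
    proof (rule AE_mp, intro AE_I2 impI)
      fix x assume "x \<notin> N"
      show "(\<lambda>n. \<sigma> n x * w x) \<longlonglongrightarrow> \<theta> x * \<bar>w x\<bar>"
      proof (cases "x \<in> K")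
        case True
        have "(\<lambda>n. max (-1) (min 1 (g n x))) \<longlonglongrightarrow> max (-1) (min 1 (sgn (w x)))"
          using lim[OF \<open>x \<notin> N\<close>] by (intro tendsto_intros)
        moreover have "max (-1) (min 1 (sgn (w x))) = sgn (w x)" by (simp add: sgn_if)
        ultimately have c1: "(\<lambda>n. c n x) \<longlonglongrightarrow> sgn (w x)" by (simp add: c_def)
        have "(\<lambda>n. c n x - p n x) \<longlonglongrightarrow> 0"
          by (rule Lim_null_comparison[OF _ eps(2)])
            (use pc[OF True] in \<open>auto intro!: always_eventually less_imp_le\<close>)
        from tendsto_diff[OF c1 this] have p1: "(\<lambda>n. p n x) \<longlonglongrightarrow> sgn (w x)" by simp
        have "(\<lambda>n. inverse (1 + \<epsilon> n)) \<longlonglongrightarrow> inverse (1 + 0)"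
          by (intro tendsto_intros eps(2)) auto
        then have "(\<lambda>n. \<sigma> n x * w x) \<longlonglongrightarrow> \<theta> x * (1 * sgn (w x)) * w x"
          unfolding \<sigma>_def using p1 by (intro tendsto_mult tendsto_const) simp_all
        moreover have "\<theta> x * (1 * sgn (w x)) * w x = \<theta> x * \<bar>w x\<bar>"
          by (simp add: abs_sgn mult.assoc mult.commute)
        ultimately show ?thesis by metis
      qed (simp add: \<sigma>_def K(2))
    qed
    show "AE x in lebesgue. norm (\<sigma> n x * w x) \<le> \<bar>\<theta> x * w x\<bar>" for n
      using abs[of n] chi(2) by (auto simp: abs_mult intro!: mult_right_mono)
  qed
  show ?thesis
    by (rule LIMSEQ_le_const2[OF *]) (use le[OF test abs] in blast)
qed

lemma C_k_line_derivative:
  fixes \<sigma> :: "'a::euclidean_space \<Rightarrow> real"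
  assumes "C_k (Suc n) \<sigma>"
  shows "((\<lambda>t. \<sigma> (z - t *\<^sub>R e)) has_real_derivative - frechet_derivative \<sigma> (at (z - t *\<^sub>R e)) e) (at t)"
proof -
  have "((\<lambda>t. z - t *\<^sub>R e) has_derivative (\<lambda>h. - (h *\<^sub>R e))) (at t)"
    by (auto intro!: derivative_eq_intros)
  from diff_chain_at[OF this C_k_Suc_has_derivative[OF assms]]
  have "((\<lambda>t. \<sigma> (z - t *\<^sub>R e)) has_derivative (\<lambda>h. frechet_derivative \<sigma> (at (z - t *\<^sub>R e)) (- (h *\<^sub>R e)))) (at t)"
    by (simp add: o_def)
  moreover
  have lin: "linear (frechet_derivative \<sigma> (at (z - t *\<^sub>R e)))"
    using assms by (simp add: linear_frechet_derivative)
  have "(\<lambda>h. frechet_derivative \<sigma> (at (z - t *\<^sub>R e)) (- (h *\<^sub>R e))) = (*) (- frechet_derivative \<sigma> (at (z - t *\<^sub>R e)) e)"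
    by (auto simp: fun_eq_iff linear_neg[OF lin] linear_scale[OF lin] mult.commute)
  ultimately show ?thesis
    by (simp add: has_field_derivative_def)
qed

text \<open>Differentiation under the integral sign. Local integrability of \<open>w\<close> is
  enough: for shifts that differ from \<open>r\<close> by at most 1, the difference quotients of
  \<sigma> live on one ball and are bounded there by a common constant.\<close>

lemma has_derivative_integral_shift:
  fixes \<sigma> w :: "'a::euclidean_space \<Rightarrow> real"
  assumes w: "loc_integrable w" and s: "C_k (Suc n) \<sigma>" and supp: "\<And>x. \<rho> \<le> norm x \<Longrightarrow> \<sigma> x = 0"
  shows "((\<lambda>r. \<integral>z. w z * \<sigma> (z - r *\<^sub>R e) \<partial>lebesgue) has_real_derivative
           - (\<integral>z. w z * frechet_derivative \<sigma> (at (z - r *\<^sub>R e)) e \<partial>lebesgue)) (at r)"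
  (is "(?m has_real_derivative _) _")
proof -
  let ?D = "\<lambda>x. frechet_derivative \<sigma> (at x) e"
  \<comment> \<open>The ball of radius \<open>R1\<close> contains the supports of all shifted copies
    of \<sigma> that occur; shifting a point of it back stays in the ball of radius
    \<open>R2\<close>, where the derivative is bounded.\<close>
  define R1 where "R1 = \<rho> + (\<bar>r\<bar> + 1) * norm e"
  define R2 where "R2 = R1 + (\<bar>r\<bar> + 1) * norm e"
  have cs: "continuous_on UNIV \<sigma>" by (rule C_k_imp_continuous_on[OF s])
  have "bounded (?D ` cball 0 R2)"
    by (intro compact_imp_bounded compact_continuous_image continuous_on_frechet_derivative[OF s]) simp
  then obtain L where "\<forall>y\<in>?D ` cball 0 R2. norm y \<le> L"
    unfolding bounded_iff by blast
  then have L: "\<bar>?D x\<bar> \<le> L" if "norm x \<le> R2" for x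
    using that by simp
  have int: "integrable lebesgue (\<lambda>z. w z * \<sigma> (z - q *\<^sub>R e))" for q
  proof (rule loc_integrable_times[OF w _ compact_cball[of 0 "\<rho> + norm (q *\<^sub>R e)"]])
    show "continuous_on UNIV (\<lambda>z. \<sigma> (z - q *\<^sub>R e))"
      by (intro continuous_on_compose2[OF cs] continuous_intros) auto
    show "\<sigma> (x - q *\<^sub>R e) = 0" if "x \<notin> cball 0 (\<rho> + norm (q *\<^sub>R e))" for x
      using that norm_triangle_sub[of x "q *\<^sub>R e"] by (intro supp) auto
  qed
  have lip: "\<bar>\<sigma> (z - (r + h) *\<^sub>R e) - \<sigma> (z - r *\<^sub>R e)\<bar> \<le> L * \<bar>h\<bar> * indicator (cball 0 R1) z"
    if h: "\<bar>h\<bar> \<le> 1" for z h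
  proof (cases "z \<in> cball 0 R1")
    case True
    have "\<bar>?D (z - t *\<^sub>R e)\<bar> \<le> L" if "t \<in> {min r (r + h)..max r (r + h)}" for t
    proof (rule L)
      have "\<bar>t\<bar> \<le> \<bar>r\<bar> + 1" using that h by auto
      then have "norm (t *\<^sub>R e) \<le> (\<bar>r\<bar> + 1) * norm e" by (simp add: mult_right_mono)
      then show "norm (z - t *\<^sub>R e) \<le> R2"
        using True norm_triangle_ineq4[of z "t *\<^sub>R e"] by (simp add: R2_def)
    qed
    then have "norm (\<sigma> (z - (r + h) *\<^sub>R e) - \<sigma> (z - r *\<^sub>R e)) \<le> L * norm ((r + h) - r)"
      by (intro field_differentiable_bound[of "{min r (r + h)..max r (r + h)}" "\<lambda>t. \<sigma> (z - t *\<^sub>R e)"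
           "\<lambda>t. - ?D (z - t *\<^sub>R e)"])
        (auto intro: C_k_line_derivative[OF s] has_field_derivative_at_within)
    then show ?thesis using True by simp
  next
    case False
    have "\<sigma> (z - q *\<^sub>R e) = 0" if "\<bar>q\<bar> \<le> \<bar>r\<bar> + 1" for q
    proof (rule supp)
      have "norm (q *\<^sub>R e) \<le> (\<bar>r\<bar> + 1) * norm e" using that by (simp add: mult_right_mono)
      then show "\<rho> \<le> norm (z - q *\<^sub>R e)"
        using False norm_triangle_ineq2[of z "q *\<^sub>R e"] by (simp add: R1_def)
    qed
    from this[of r] this[of "r + h"] h False show ?thesis by simp
  qed
  have "((\<lambda>h. (?m (r + h) - ?m r) / h) \<longlongrightarrow> - (\<integral>z. w z * ?D (z - r *\<^sub>R e) \<partial>lebesgue)) (at 0)"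
    unfolding tendsto_at_iff_sequentially
  proof (intro allI impI)
    fix X :: "nat \<Rightarrow> real" assume X: "\<forall>i. X i \<in> UNIV - {0}" "X \<longlonglongrightarrow> 0"
    have "\<forall>\<^sub>F i in sequentially. \<bar>X i\<bar> \<le> 1"
      using X(2) by (auto dest!: tendstoD[of _ _ _ 1] elim: eventually_mono)
    then obtain i0 where "\<forall>n\<ge>i0. \<bar>X n\<bar> \<le> 1"
      unfolding eventually_sequentially by blast
    then have i0: "\<bar>X (i + i0)\<bar> \<le> 1" for i by simp
    define Y where "Y i = X (i + i0)" for i
    have Y: "Y i \<noteq> 0" "Y \<longlonglongrightarrow> 0" "\<bar>Y i\<bar> \<le> 1" for i
      using X i0 LIMSEQ_ignore_initial_segment[OF X(2), of i0] by (auto simp: Y_def[abs_def])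
    have eq: "(?m (r + Y i) - ?m r) / Y i =
        (\<integral>z. w z * ((\<sigma> (z - (r + Y i) *\<^sub>R e) - \<sigma> (z - r *\<^sub>R e)) / Y i) \<partial>lebesgue)" for i
    proof -
      have "(?m (r + Y i) - ?m r) / Y i =
          (\<integral>z. (w z * \<sigma> (z - (r + Y i) *\<^sub>R e) - w z * \<sigma> (z - r *\<^sub>R e)) / Y i \<partial>lebesgue)"
        by (subst Bochner_Integration.integral_divide_zero, subst Bochner_Integration.integral_diff[OF int int]) (rule refl)
      then show ?thesis by (simp only: right_diff_distrib times_divide_eq_right)
    qed
    have ind: "integrable lebesgue (\<lambda>z. indicator (cball 0 R1) z * w z)"
      using w by (simp add: loc_integrable_def set_integrable_def)
    have "(\<lambda>i. \<integral>z. w z * ((\<sigma> (z - (r + Y i) *\<^sub>R e) - \<sigma> (z - r *\<^sub>R e)) / Y i) \<partial>lebesgue)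
        \<longlonglongrightarrow> (\<integral>z. w z * (- ?D (z - r *\<^sub>R e)) \<partial>lebesgue)"
    proof (rule integral_dominated_convergence[where w = "\<lambda>z. \<bar>L * (indicator (cball 0 R1) z * w z)\<bar>"])
      show "integrable lebesgue (\<lambda>z. \<bar>L * (indicator (cball 0 R1) z * w z)\<bar>)" using ind by simp
      have pt: "(\<lambda>i. w z * ((\<sigma> (z - (r + Y i) *\<^sub>R e) - \<sigma> (z - r *\<^sub>R e)) / Y i))
          \<longlonglongrightarrow> w z * (- ?D (z - r *\<^sub>R e))" for z
      proof (rule tendsto_mult[OF tendsto_const])
        have "((\<lambda>h. (\<sigma> (z - (r + h) *\<^sub>R e) - \<sigma> (z - r *\<^sub>R e)) / h) \<longlongrightarrow> - ?D (z - r *\<^sub>R e)) (at 0)"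
          using C_k_line_derivative[OF s, of z e r] by (simp add: DERIV_def)
        then show "(\<lambda>i. (\<sigma> (z - (r + Y i) *\<^sub>R e) - \<sigma> (z - r *\<^sub>R e)) / Y i) \<longlonglongrightarrow> - ?D (z - r *\<^sub>R e)"
          using Y(1,2) by (auto simp: tendsto_at_iff_sequentially o_def)
      qed
      then show "AE z in lebesgue. (\<lambda>i. w z * ((\<sigma> (z - (r + Y i) *\<^sub>R e) - \<sigma> (z - r *\<^sub>R e)) / Y i))
          \<longlonglongrightarrow> w z * (- ?D (z - r *\<^sub>R e))" by simp
      show m: "(\<lambda>z. w z * ((\<sigma> (z - (r + Y i) *\<^sub>R e) - \<sigma> (z - r *\<^sub>R e)) / Y i)) \<in> borel_measurable lebesgue" for i
        using borel_measurable_divide[OF borel_measurable_diff[OF borel_measurable_integrable[OF int] borel_measurable_integrable[OF int]] borel_measurable_const, of "r + Y i" r "Y i"]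
        by (simp only: right_diff_distrib times_divide_eq_right)
      show "(\<lambda>z. w z * (- ?D (z - r *\<^sub>R e))) \<in> borel_measurable lebesgue"
        by (rule borel_measurable_LIMSEQ_real[OF pt m])
      have "\<bar>w z * ((\<sigma> (z - (r + Y i) *\<^sub>R e) - \<sigma> (z - r *\<^sub>R e)) / Y i)\<bar> \<le>
            \<bar>L * (indicator (cball 0 R1) z * w z)\<bar>" for z i
      proof -
        have "\<bar>\<sigma> (z - (r + Y i) *\<^sub>R e) - \<sigma> (z - r *\<^sub>R e)\<bar> / \<bar>Y i\<bar> \<le> L * indicator (cball 0 R1) z"
          using lip[OF Y(3)[of i], of z] Y(1)[of i] by (subst pos_divide_le_eq) (simp_all add: mult_ac)
        then have "\<bar>w z\<bar> * (\<bar>\<sigma> (z - (r + Y i) *\<^sub>R e) - \<sigma> (z - r *\<^sub>R e)\<bar> / \<bar>Y i\<bar>) \<le> \<bar>w z\<bar> * \<bar>L * indicator (cball 0 R1) z\<bar>"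
          by (intro mult_left_mono) auto
        then show ?thesis by (simp only: abs_mult abs_divide mult_ac)
      qed
      then show "AE z in lebesgue. norm (w z * ((\<sigma> (z - (r + Y i) *\<^sub>R e) - \<sigma> (z - r *\<^sub>R e)) / Y i)) \<le>
            \<bar>L * (indicator (cball 0 R1) z * w z)\<bar>" for i by simp
    qed
    then have "(\<lambda>i. (?m (r + Y i) - ?m r) / Y i) \<longlonglongrightarrow> - (\<integral>z. w z * ?D (z - r *\<^sub>R e) \<partial>lebesgue)"
      by (simp add: eq)
    then show "((\<lambda>h. (?m (r + h) - ?m r) / h) \<circ> X) \<longlonglongrightarrow> - (\<integral>z. w z * ?D (z - r *\<^sub>R e) \<partial>lebesgue)"
      unfolding Y_def o_def by (rule LIMSEQ_offset)
  qed
  then show ?thesis by (simp add: DERIV_def)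
qed

text \<open>Variation in direction \<open>e\<close>, measured by the integral modulus of translation
  instead of by derivatives. In this form it can be read off from volumes for indicators of boxes,
  and it passes to finite unions and to countable sums of layers.\<close>

definition shift_variation_le :: "'a::euclidean_space \<Rightarrow> ('a \<Rightarrow> 'b::euclidean_space) \<Rightarrow> real \<Rightarrow> bool" where
  "shift_variation_le e f C \<longleftrightarrow>
     (\<forall>h>0. (\<integral>\<^sup>+x. ennreal (norm (f (x + h *\<^sub>R e) - f x)) \<partial>lebesgue) \<le> ennreal (C * h))"

lemma integrable_imp_loc_integrable:
  assumes "integrable lebesgue f"
  shows "loc_integrable f"
  unfolding loc_integrable_def set_integrable_def
proof (intro allI impI)
  fix K :: "'a set" assume "compact K"
  then have "K \<in> sets lebesgue" by (simp add: borel_compact)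
  then show "integrable lebesgue (\<lambda>x. indicator K x *\<^sub>R f x)"
    using assms by (rule integrable_mult_indicator)
qed

text \<open>The integral in question is, up to sign, the derivative at \<open>r = 0\<close> of the
  integral of \<open>f\<close> against \<sigma> shifted by \<open>r *\<^sub>R e\<close>. Moving the
  shift from \<sigma> to \<open>f\<close> bounds every difference quotient by \<open>C\<close>,
  because \<sigma> has modulus at most 1.\<close>

lemma shift_variation_derivative_bound:
  fixes f \<sigma> :: "'a::euclidean_space \<Rightarrow> real"
  assumes f: "integrable lebesgue f" and sv: "shift_variation_le e f C" and "0 \<le> C"
    and s: "C_k (Suc n) \<sigma>" and supp: "\<And>x. \<rho> \<le> norm x \<Longrightarrow> \<sigma> x = 0" and le: "\<And>x. \<bar>\<sigma> x\<bar> \<le> 1"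
  shows "\<bar>\<integral>z. f z * frechet_derivative \<sigma> (at z) e \<partial>lebesgue\<bar> \<le> C"
proof -
  let ?m = "\<lambda>r. \<integral>z. f z * \<sigma> (z - r *\<^sub>R e) \<partial>lebesgue"
  have loc: "loc_integrable f"
    by (rule integrable_imp_loc_integrable[OF f])
  have cs: "continuous_on UNIV \<sigma>" by (rule C_k_imp_continuous_on[OF s])
  have ms: "\<sigma> \<in> borel_measurable lebesgue" by (rule continuous_on_UNIV_lebesgue_measurable[OF cs])
  have mf: "f \<in> borel_measurable lebesgue" using f by simp
  have fs: "integrable lebesgue (\<lambda>z. f (r *\<^sub>R e + z) * \<sigma> z)" for r
  proof (rule Bochner_Integration.integrable_bound[OF lebesgue_integrable_shift[OF f]])
    show "(\<lambda>z. f (r *\<^sub>R e + z) * \<sigma> z) \<in> borel_measurable lebesgue"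
      using lebesgue_measurable_shift[OF mf] ms by (rule borel_measurable_times)
    show "AE z in lebesgue. norm (f (r *\<^sub>R e + z) * \<sigma> z) \<le> norm (f (r *\<^sub>R e + z))"
      using le by (auto simp: abs_mult mult_left_le)
  qed
  have m: "?m r = (\<integral>z. f (r *\<^sub>R e + z) * \<sigma> z \<partial>lebesgue)" for r
  proof -
    have "(\<lambda>z. f z * \<sigma> (z - r *\<^sub>R e)) \<in> borel_measurable lebesgue"
      using mf lebesgue_measurable_shift[OF ms, of "- (r *\<^sub>R e)"] by (simp add: borel_measurable_times)
    from lebesgue_integral_shift[OF this, of "r *\<^sub>R e"] show ?thesis by simp
  qed
  have bd: "\<bar>?m h - ?m 0\<bar> \<le> C * h" if h: "h > 0" for h
  proof -
    have "\<bar>?m h - ?m 0\<bar> = \<bar>\<integral>z. (f (h *\<^sub>R e + z) - f z) * \<sigma> z \<partial>lebesgue\<bar>"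
      using Bochner_Integration.integral_diff[OF fs[of h] fs[of 0]] by (simp add: m left_diff_distrib)
    also have "ennreal \<dots> \<le> (\<integral>\<^sup>+z. ennreal (norm ((f (h *\<^sub>R e + z) - f z) * \<sigma> z)) \<partial>lebesgue)"
      using integral_norm_bound_ennreal[of lebesgue "\<lambda>z. (f (h *\<^sub>R e + z) - f z) * \<sigma> z"]
        Bochner_Integration.integrable_diff[OF fs[of h] fs[of 0]] by (simp add: left_diff_distrib)
    also have "\<dots> \<le> (\<integral>\<^sup>+z. ennreal (norm (f (z + h *\<^sub>R e) - f z)) \<partial>lebesgue)"
      using le by (intro nn_integral_mono ennreal_leI) (simp add: abs_mult mult_left_le add.commute)
    also have "\<dots> \<le> ennreal (C * h)" using sv h by (simp add: shift_variation_le_def)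
    finally show ?thesis using h \<open>0 \<le> C\<close> by (simp add: ennreal_le_iff)
  qed
  have "(?m has_real_derivative - (\<integral>z. f z * frechet_derivative \<sigma> (at z) e \<partial>lebesgue)) (at 0)"
    using has_derivative_integral_shift[OF loc s supp, where r = 0] by simp
  then have "((\<lambda>h. (?m (0 + h) - ?m 0) / h) \<longlongrightarrow> - (\<integral>z. f z * frechet_derivative \<sigma> (at z) e \<partial>lebesgue)) (at_right 0)"
    unfolding DERIV_def by (rule filterlim_mono[OF _ order_refl at_le]) simp
  then have "((\<lambda>h. \<bar>(?m (0 + h) - ?m 0) / h\<bar>) \<longlongrightarrow> \<bar>- (\<integral>z. f z * frechet_derivative \<sigma> (at z) e \<partial>lebesgue)\<bar>) (at_right 0)"
    by (rule tendsto_rabs)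
  moreover have "\<forall>\<^sub>F h in at_right (0::real). \<bar>(?m (0 + h) - ?m 0) / h\<bar> \<le> C"
    by (rule eventually_at_rightI[of 0 1]) (use bd in \<open>auto simp: abs_divide pos_divide_le_eq\<close>)
  ultimately have "\<bar>- (\<integral>z. f z * frechet_derivative \<sigma> (at z) e \<partial>lebesgue)\<bar> \<le> C"
    by (intro tendsto_upperbound) auto
  then show ?thesis by simp
qed

lemma C_k_inner_derivative:
  assumes "C_k (Suc n) \<phi>"
  shows "C_k (Suc n) (\<lambda>x. \<phi> x \<bullet> e)"
    "frechet_derivative (\<lambda>x. \<phi> x \<bullet> e) (at x) v = frechet_derivative \<phi> (at x) v \<bullet> e"
proof -
  show "C_k (Suc n) (\<lambda>x. \<phi> x \<bullet> e)"
    by (rule C_k_bounded_linear_comp[OF bounded_linear_inner_left assms])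
  have "((\<lambda>x. \<phi> x \<bullet> e) has_derivative (\<lambda>h. frechet_derivative \<phi> (at x) h \<bullet> e)) (at x)"
    by (rule bounded_linear.has_derivative[OF bounded_linear_inner_left C_k_Suc_has_derivative[OF assms]])
  from frechet_derivative_at[OF this]
  show "frechet_derivative (\<lambda>x. \<phi> x \<bullet> e) (at x) v = frechet_derivative \<phi> (at x) v \<bullet> e" by metis
qed

lemma frechet_derivative_eq_0_outside:
  assumes "C_k (Suc n) \<sigma>" "\<And>x. \<rho> \<le> norm x \<Longrightarrow> \<sigma> x = 0" "\<rho> < norm x"
  shows "frechet_derivative \<sigma> (at x) v = 0"
proof -
  have "((\<lambda>x. 0) has_derivative (\<lambda>h. 0)) (at x)" by simp
  then have "(\<sigma> has_derivative (\<lambda>h. 0)) (at x)"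
    by (rule has_derivative_transform_within_open[of _ _ _ _ "- cball 0 \<rho>"]) (use assms in auto)
  from frechet_derivative_at[OF this] show ?thesis by metis
qed

text \<open>The divergence is split into single partial derivatives. Each scalar component of a
  competitor is at most 1 in modulus and contributes at most \<open>C\<close>, and there is one such
  contribution for each pair of basis vectors of domain and range.\<close>

lemma total_variation_le:
  fixes f :: "'a::euclidean_space \<Rightarrow> 'b::euclidean_space" and C :: real
  assumes f: "integrable lebesgue f" and "0 \<le> C"
    and sv: "\<And>e. e \<in> Basis \<Longrightarrow> shift_variation_le e f C"
  shows "total_variation UNIV f \<le> ennreal (DIM('b) * DIM('a) * C)"
  unfolding total_variation_def
proof (rule SUP_least)
  fix \<phi> :: "'b \<Rightarrow> 'a \<Rightarrow> 'a"
  assume "\<phi> \<in> {\<phi>. (\<forall>j\<in>Basis. C_k 1 (\<phi> j) \<and> compact_support_in UNIV (\<phi> j)) \<and>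
      (\<forall>x. (\<Sum>j\<in>Basis. (norm (\<phi> j x))\<^sup>2) \<le> 1)}"
  then have phi: "\<forall>j\<in>Basis. C_k (Suc 0) (\<phi> j) \<and> compact_support_in UNIV (\<phi> j)"
    and le: "\<forall>x. (\<Sum>j\<in>Basis. (norm (\<phi> j x))\<^sup>2) \<le> 1"
    unfolding mem_Collect_eq One_nat_def by blast+
  let ?\<psi> = "\<lambda>j e x. \<phi> j x \<bullet> e"
  let ?I = "\<lambda>j e x. (f x \<bullet> j) * frechet_derivative (?\<psi> j e) (at x) e"
  have C: "C_k (Suc 0) (?\<psi> j e)" if "j \<in> Basis" for j e
    using C_k_inner_derivative(1) phi that by blast
  have D: "divergence (\<phi> j) x = (\<Sum>e\<in>Basis. frechet_derivative (?\<psi> j e) (at x) e)" if "j \<in> Basis" for j x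
    using C_k_inner_derivative(2)[of 0 "\<phi> j"] phi that by (simp add: divergence_def del: C_k.simps)
  have "\<exists>\<rho>. \<forall>x. \<rho> \<le> norm x \<longrightarrow> \<phi> j x = 0" if j: "j \<in> Basis" for j
  proof -
    have "compact_support_in UNIV (\<phi> j)" using phi j by blast
    then obtain K where K: "compact K" "\<forall>x. x \<notin> K \<longrightarrow> \<phi> j x = 0"
      unfolding compact_support_in_def by blast
    obtain r where "\<And>x. x \<in> K \<Longrightarrow> norm x < r"
      using compact_imp_bounded[OF K(1)] unfolding bounded_pos_less by blast
    then show ?thesis using K(2) by (intro exI[of _ r]) force
  qed
  then obtain \<rho> where \<rho>: "\<And>j x. j \<in> Basis \<Longrightarrow> \<rho> j \<le> norm x \<Longrightarrow> \<phi> j x = 0" by metis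
  have int: "integrable lebesgue (?I j e)" and bd: "\<bar>\<integral>x. ?I j e x \<partial>lebesgue\<bar> \<le> C"
    if j: "j \<in> Basis" and e: "e \<in> Basis" for j e
  proof -
    have fj: "integrable lebesgue (\<lambda>x. f x \<bullet> j)" using f by (rule integrable_inner_left)
    have loc: "loc_integrable (\<lambda>x. f x \<bullet> j)"
      by (rule integrable_imp_loc_integrable[OF fj])
    have s0: "?\<psi> j e x = 0" if "\<rho> j \<le> norm x" for x using \<rho>[OF j that] by simp
    show "integrable lebesgue (?I j e)"
      by (rule loc_integrable_times[OF loc continuous_on_frechet_derivative[OF C[OF j]] compact_cball[of 0 "\<rho> j"]])
         (use frechet_derivative_eq_0_outside[OF C[OF j] s0] in auto)
    show "\<bar>\<integral>x. ?I j e x \<partial>lebesgue\<bar> \<le> C"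
    proof -
      have "(\<integral>\<^sup>+x. ennreal (norm (f (x + h *\<^sub>R e) \<bullet> j - f x \<bullet> j)) \<partial>lebesgue)
          \<le> (\<integral>\<^sup>+x. ennreal (norm (f (x + h *\<^sub>R e) - f x)) \<partial>lebesgue)" for h
        using Basis_le_norm[OF j] by (intro nn_integral_mono ennreal_leI) (simp flip: inner_diff_left)
      then have "shift_variation_le e (\<lambda>x. f x \<bullet> j) C"
        using sv[OF e] unfolding shift_variation_le_def by (meson order_trans)
      moreover have "\<bar>\<phi> j x \<bullet> e\<bar> \<le> 1" for x
      proof -
        have "(norm (\<phi> j x))\<^sup>2 \<le> (\<Sum>j\<in>Basis. (norm (\<phi> j x))\<^sup>2)"
          using j by (intro member_le_sum) auto
        also have "\<dots> \<le> 1" using le by blast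
        finally have "norm (\<phi> j x) \<le> 1" by (simp add: abs_square_le_1)
        then show ?thesis using Basis_le_norm[OF e, of "\<phi> j x"] by linarith
      qed
      ultimately show ?thesis
        using shift_variation_derivative_bound[OF fj _ \<open>0 \<le> C\<close> C[OF j, of e], of e "\<rho> j"] s0 by blast
    qed
  qed
  have "(\<integral>x. (\<Sum>j\<in>Basis. (f x \<bullet> j) * divergence (\<phi> j) x) \<partial>lebesgue)
      = (\<integral>x. (\<Sum>j\<in>Basis. \<Sum>e\<in>Basis. ?I j e x) \<partial>lebesgue)"
    by (simp add: D sum_distrib_left)
  also have "\<dots> = (\<Sum>j\<in>Basis. \<Sum>e\<in>Basis. \<integral>x. ?I j e x \<partial>lebesgue)"
    using int by (simp add: Bochner_Integration.integral_sum)
  also have "\<dots> \<le> (\<Sum>j\<in>(Basis::'b set). \<Sum>e\<in>(Basis::'a set). C)"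
    using bd by (intro sum_mono) (auto simp: abs_le_iff)
  also have "\<dots> = DIM('b) * DIM('a) * C" by simp
  finally show "ennreal (\<integral>x. (\<Sum>j\<in>Basis. (f x \<bullet> j) * divergence (\<phi> j) x) \<partial>lebesgue) \<le> ennreal (DIM('b) * DIM('a) * C)"
    by (rule ennreal_leI)
qed

text \<open>The converse estimate: variation controls translations. For a fixed test function
  \<sigma> below \<theta>, the mean value theorem in the length of the shift produces
  \<open>d\<close> times an integral of \<open>v\<close> against the divergence of an admissible
  field; duality then replaces the signed integral by the absolute one.\<close>

lemma BV_loc_shift_le:
  fixes v \<theta> :: "'a::euclidean_space \<Rightarrow> real"
  assumes v: "BV_loc v" and chi: "test_function \<theta>" "\<And>x. 0 \<le> \<theta> x" "\<And>x. \<theta> x \<le> 1" "\<And>x. \<rho> \<le> norm x \<Longrightarrow> \<theta> x = 0"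
    and e: "e \<in> Basis" and d: "0 < d" "d \<le> 1"
  shows "(\<integral>x. \<theta> x * \<bar>v (x + d *\<^sub>R e) - v x\<bar> \<partial>lebesgue) \<le> d * enn2real (total_variation (ball 0 (\<rho> + 2)) v)"
proof -
  let ?A = "enn2real (total_variation (ball 0 (\<rho> + 2)) v)"
  have loc: "loc_integrable v" using v by (simp add: BV_loc_def loc_integrable_def)
  have fin: "total_variation (ball 0 (\<rho> + 2)) v < \<infinity>" using v by (simp add: BV_loc_def)
  have loc': "loc_integrable (\<lambda>x. v (x + d *\<^sub>R e))"
    unfolding loc_integrable_def
  proof (intro allI impI)
    fix K :: "'a set" assume K: "compact K"
    have "compact ((+) (d *\<^sub>R e) ` K)" using K by (rule compact_translation)
    then have "integrable lebesgue (\<lambda>x. indicator ((+) (d *\<^sub>R e) ` K) x *\<^sub>R v x)"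
      using loc by (simp add: loc_integrable_def set_integrable_def)
    from lebesgue_integrable_shift[OF this, of "d *\<^sub>R e"]
    show "set_integrable lebesgue K (\<lambda>x. v (x + d *\<^sub>R e))"
      by (simp add: set_integrable_def add.commute indicator_def image_iff)
  qed
  have meas: "w \<in> borel_measurable lebesgue" if "loc_integrable w" for w :: "'a \<Rightarrow> real"
  proof (rule borel_measurable_LIMSEQ_real)
    show "(\<lambda>n. indicator (cball 0 (real n)) x * w x) \<longlonglongrightarrow> w x" for x
    proof (rule tendsto_eventually)
      obtain N where "norm x \<le> real N" using real_arch_simple by blast
      then have "\<forall>n\<ge>N. indicator (cball 0 (real n)) x * w x = w x" by (auto simp: indicator_def)
      then show "\<forall>\<^sub>F n in sequentially. indicator (cball 0 (real n)) x * w x = w x"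
        unfolding eventually_sequentially by blast
    qed
    have "integrable lebesgue (\<lambda>x. indicator (cball 0 (real n)) x * w x)" for n
      using that by (simp add: loc_integrable_def set_integrable_def)
    then show "(\<lambda>x. indicator (cball 0 (real n)) x * w x) \<in> borel_measurable lebesgue" for n by blast
  qed
  have int: "integrable lebesgue (\<lambda>x. w x * s x)"
    if w: "loc_integrable w" and ts: "test_function s" for w s :: "'a \<Rightarrow> real"
  proof -
    obtain K where K: "compact K" "\<And>x. x \<notin> K \<Longrightarrow> s x = 0"
      using ts by (auto simp: test_function_def compact_support_in_def)
    show ?thesis
      by (rule loc_integrable_times[OF w C_k_imp_continuous_on[OF test_function_C_k[OF ts]] K])
  qed
  have le: "(\<integral>x. \<sigma> x * (v (x + d *\<^sub>R e) - v x) \<partial>lebesgue) \<le> d * ?A"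
    if s: "test_function \<sigma>" and sle: "\<And>x. \<bar>\<sigma> x\<bar> \<le> \<theta> x" for \<sigma>
  proof -
    let ?m = "\<lambda>r. \<integral>z. v z * \<sigma> (z - r *\<^sub>R e) \<partial>lebesgue"
    let ?m' = "\<lambda>r. - (\<integral>z. v z * frechet_derivative \<sigma> (at (z - r *\<^sub>R e)) e \<partial>lebesgue)"
    have C: "C_k (Suc n) \<sigma>" for n by (rule test_function_C_k[OF s])
    have supp: "\<sigma> x = 0" if "\<rho> \<le> norm x" for x using chi(4)[OF that] sle[of x] by simp
    have D: "(?m has_real_derivative ?m' r) (at r)" for r
      by (rule has_derivative_integral_shift[OF loc C supp])
    have bd: "?m' r \<le> ?A" if r: "0 \<le> r" "r \<le> 1" for r
    proof -
      \<comment> \<open>The competitor is a shifted copy of \<sigma> pointing along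
        \<open>e\<close>. As the shift is at most 1, it lives in the closed ball of radius
        \<open>\<rho> + 1\<close>, a compact subset of the open ball of radius
        \<open>\<rho> + 2\<close>.\<close>
      define \<phi> where "\<phi> = (\<lambda>(j::real) x. - \<sigma> (x - r *\<^sub>R e) *\<^sub>R e)"
      have sh: "C_k n (\<lambda>x. \<sigma> (x - r *\<^sub>R e))" for n
        using C_k_compose_affine[OF bounded_linear_ident test_function_C_k[OF s], of n "- (r *\<^sub>R e)"] by simp
      have ne: "norm e = 1" using e by simp
      have C1: "C_k 1 (\<phi> j)" for j
        using C_k_bounded_linear_comp[OF bounded_linear_scaleR_left[of "- e"] sh[of 1]] by (simp add: \<phi>_def del: C_k.simps)
      have cs: "compact_support_in (ball 0 (\<rho> + 2)) (\<phi> j)" for j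
        unfolding compact_support_in_def
      proof (intro exI conjI allI impI)
        show "compact (cball 0 (\<rho> + 1) :: 'a set)" by simp
        show "cball 0 (\<rho> + 1) \<subseteq> (ball 0 (\<rho> + 2) :: 'a set)" by auto
        show "\<phi> j x = 0" if "x \<notin> cball 0 (\<rho> + 1)" for x
          using that norm_triangle_ineq2[of x "r *\<^sub>R e"] r ne supp[of "x - r *\<^sub>R e"] by (simp add: \<phi>_def)
      qed
      have "divergence (\<phi> 1) x = - frechet_derivative \<sigma> (at (x - r *\<^sub>R e)) e" for x
      proof -
        have "((\<lambda>x. x - r *\<^sub>R e) has_derivative (\<lambda>h. h)) (at x)"
          by (auto intro!: derivative_eq_intros)
        from diff_chain_at[OF this test_function_has_derivative[OF s]]
        have "(\<phi> 1 has_derivative (\<lambda>h. - frechet_derivative \<sigma> (at (x - r *\<^sub>R e)) h *\<^sub>R e)) (at x)"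
          unfolding \<phi>_def by (intro has_derivative_scaleR_left has_derivative_minus) (simp add: o_def)
        note fd = frechet_derivative_at[OF this, symmetric]
        have "divergence (\<phi> 1) x = (\<Sum>i\<in>Basis. (- frechet_derivative \<sigma> (at (x - r *\<^sub>R e)) i *\<^sub>R e) \<bullet> i)"
          unfolding divergence_def fd ..
        also have "\<dots> = (\<Sum>i\<in>Basis. if i = e then - frechet_derivative \<sigma> (at (x - r *\<^sub>R e)) e else 0)"
          using e by (intro sum.cong) (auto simp: inner_Basis)
        finally show ?thesis using e by simp
      qed
      then have "?m' r = (\<integral>x. (\<Sum>j\<in>Basis. (v x \<bullet> j) * divergence (\<phi> j) x) \<partial>lebesgue)"
        by simp
      also have "ennreal \<dots> \<le> total_variation (ball 0 (\<rho> + 2)) v"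
        unfolding total_variation_def
      proof (rule SUP_upper, intro CollectI conjI ballI allI C1 cs)
        fix x
        have "\<bar>\<sigma> (x - r *\<^sub>R e)\<bar> \<le> 1" using sle chi(3) order_trans by blast
        then show "(\<Sum>j\<in>Basis. (norm (\<phi> j x))\<^sup>2) \<le> 1"
          using ne by (simp add: \<phi>_def abs_square_le_1)
      qed
      finally have "ennreal (?m' r) \<le> ennreal ?A" using fin by (simp add: less_top)
      then show ?thesis by (simp add: ennreal_le_iff)
    qed
    obtain r where r: "0 < r" "r < d" "?m d - ?m 0 = (d - 0) * ?m' r"
      using MVT2[OF d(1), of ?m ?m'] D by blast
    have "(\<lambda>x. \<sigma> (x - d *\<^sub>R e)) \<in> borel_measurable lebesgue"
      using continuous_on_UNIV_lebesgue_measurable[OF C_k_imp_continuous_on[OF C]]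
        lebesgue_measurable_shift[of \<sigma> "- (d *\<^sub>R e)"] by simp
    from borel_measurable_times[OF meas[OF loc] this]
    have "?m d = (\<integral>z. v (z + d *\<^sub>R e) * \<sigma> z \<partial>lebesgue)"
      using lebesgue_integral_shift[of "\<lambda>z. v z * \<sigma> (z - d *\<^sub>R e)" "d *\<^sub>R e"] by (simp add: add.commute)
    then have "(\<integral>x. \<sigma> x * (v (x + d *\<^sub>R e) - v x) \<partial>lebesgue) = ?m d - ?m 0"
      using Bochner_Integration.integral_diff[OF int[OF loc' s] int[OF loc s]]
      by (simp add: algebra_simps)
    also have "\<dots> \<le> d * ?A"
      unfolding r(3) diff_zero using r d by (intro mult_left_mono bd) auto
    finally show ?thesis .
  qed
  show ?thesis
  proof (rule integral_abs_le_dual[OF chi(1,2) _ _ le])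
    show "(\<lambda>x. v (x + d *\<^sub>R e) - v x) \<in> borel_measurable lebesgue"
      using meas[OF loc'] meas[OF loc] by (rule borel_measurable_diff)
    show "integrable lebesgue (\<lambda>x. \<theta> x * (v (x + d *\<^sub>R e) - v x))"
      using Bochner_Integration.integrable_diff[OF int[OF loc' chi(1)] int[OF loc chi(1)]]
      by (simp add: algebra_simps)
  qed auto
qed

subsection \<open>Integration on the half space\<close>

text \<open>\<open>lebesgue\<close> on the product is the completion of the product measure, not the
  product of the completions. The exceptional set is therefore enlarged to a Borel null set, whose
  slices are handled by Fubini for \<open>lborel\<close>.\<close>

lemma AE_lebesgue_pair:
  fixes P :: "'a::euclidean_space \<times> 'b::euclidean_space \<Rightarrow> bool"
  assumes "AE p in lebesgue. P p"
  shows "AE t in lebesgue. AE z in lebesgue. P (z, t)"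
proof -
  have "AE p in lborel. P p" using assms by (simp add: AE_completion_iff)
  then obtain N where N: "{p. \<not> P p} \<subseteq> N" "N \<in> null_sets lborel"
    by (auto simp: eventually_ae_filter)
  have "AE p in (lborel \<Otimes>\<^sub>M lborel). (\<lambda>p. p \<notin> N) p"
    unfolding lborel_prod by (rule AE_not_in[OF N(2)])
  moreover have "{p \<in> space (lborel \<Otimes>\<^sub>M lborel). p \<notin> N} \<in> sets (lborel \<Otimes>\<^sub>M lborel)"
    unfolding lborel_prod using N(2) by auto
  ultimately have "AE z in lborel. AE t in lborel. (z, t) \<notin> N" 
    by (intro lborel_pair.AE_pair) auto
  then have "AE t in lborel. AE z in lborel. (z, t) \<notin> N"
    using \<open>{p \<in> space (lborel \<Otimes>\<^sub>M lborel). p \<notin> N} \<in> sets (lborel \<Otimes>\<^sub>M lborel)\<close>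
    by (subst (asm) lborel_pair.AE_commute) (auto simp: split_def)
  then have "AE t in lborel. AE z in lborel. P (z, t)"
    by (rule eventually_mono, elim eventually_mono) (use N(1) in blast)
  then have "AE t in lborel. AE z in lebesgue. P (z, t)" by (simp add: AE_completion_iff)
  then show ?thesis by (rule AE_completion)
qed

text \<open>\<open>F\<close> is replaced by a Borel function equal to it almost everywhere, to which
  Fubini for \<open>lborel\<close> applies; for almost every \<open>t\<close> the slices agree. The
  condition \<open>m\<close> on all slices fits weakly-* continuous functions of time, which are
  measurable in space at each time.\<close>

lemma lebesgue_Fubini:
  fixes F :: "'a::euclidean_space \<times> 'b::euclidean_space \<Rightarrow> real"
  assumes F: "integrable lebesgue F" and m: "\<And>t. (\<lambda>z. F (z, t)) \<in> borel_measurable lebesgue"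
  shows "integrable lebesgue (\<lambda>t. \<integral>z. F (z, t) \<partial>lebesgue)"
    and "(\<integral>p. F p \<partial>lebesgue) = (\<integral>t. (\<integral>z. F (z, t) \<partial>lebesgue) \<partial>lebesgue)"
proof -
  have "F \<in> borel_measurable lebesgue" using F by blast
  then obtain G where G: "G \<in> borel_measurable lborel" and FG: "AE p in lborel. F p = G p"
    using completion_ex_borel_measurable_real by blast
  have FG': "AE p in lebesgue. F p = G p" using FG by (simp add: AE_completion_iff)
  have Gm: "G \<in> borel_measurable lebesgue" using G by (rule measurable_completion)
  have "integrable lebesgue G"
    by (rule integrable_cong_AE_imp[OF F Gm]) (use FG' in \<open>auto elim: eventually_mono\<close>)
  then have Gi: "integrable (lborel \<Otimes>\<^sub>M lborel) G"
    using G by (simp add: lborel_prod integrable_completion)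
  have sl: "AE t in lebesgue. (\<integral>z. G (z, t) \<partial>lborel) = (\<integral>z. F (z, t) \<partial>lebesgue)"
    using AE_lebesgue_pair[OF FG']
  proof (rule eventually_mono)
    fix t assume t: "AE z in lebesgue. F (z, t) = G (z, t)"
    have Gt: "(\<lambda>z. G (z, t)) \<in> borel_measurable lborel"
      using G by measurable
    have "(\<integral>z. G (z, t) \<partial>lborel) = (\<integral>z. G (z, t) \<partial>lebesgue)"
      by (rule integral_completion[OF Gt, symmetric])
    also have "\<dots> = (\<integral>z. F (z, t) \<partial>lebesgue)"
      by (rule integral_cong_AE[OF measurable_completion[OF Gt] m]) (use t in \<open>auto elim: eventually_mono\<close>)
    finally show "(\<integral>z. G (z, t) \<partial>lborel) = (\<integral>z. F (z, t) \<partial>lebesgue)" .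
  qed
  have Hi: "integrable lborel (\<lambda>t. \<integral>z. G (z, t) \<partial>lborel)"
    by (rule lborel_pair.integrable_snd[of "\<lambda>x y. G (x, y)"]) (use Gi in simp)
  then have Hi': "integrable lebesgue (\<lambda>t. \<integral>z. G (z, t) \<partial>lborel)"
    by (simp add: integrable_completion)
  have Fm: "(\<lambda>t. \<integral>z. F (z, t) \<partial>lebesgue) \<in> borel_measurable lebesgue"
    by (rule borel_measurable_AE[OF borel_measurable_integrable[OF Hi'] sl])
  show "integrable lebesgue (\<lambda>t. \<integral>z. F (z, t) \<partial>lebesgue)"
    by (rule integrable_cong_AE_imp[OF Hi' Fm sl])
  have "(\<integral>p. F p \<partial>lebesgue) = (\<integral>p. G p \<partial>lebesgue)"
    using F Gm FG' by (intro integral_cong_AE) auto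
  also have "\<dots> = (\<integral>p. G p \<partial>(lborel \<Otimes>\<^sub>M lborel))"
    by (simp add: lborel_prod integral_completion[OF G])
  also have "\<dots> = (\<integral>t. (\<integral>z. G (z, t) \<partial>lborel) \<partial>lborel)"
    using lborel_pair.integral_snd[of "\<lambda>x y. G (x, y)"] Gi by simp
  also have "\<dots> = (\<integral>t. (\<integral>z. G (z, t) \<partial>lborel) \<partial>lebesgue)"
    using Hi by (intro integral_completion[symmetric]) auto
  also have "\<dots> = (\<integral>t. (\<integral>z. F (z, t) \<partial>lebesgue) \<partial>lebesgue)"
    using Hi' Fm sl by (intro integral_cong_AE) auto
  finally show "(\<integral>p. F p \<partial>lebesgue) = (\<integral>t. (\<integral>z. F (z, t) \<partial>lebesgue) \<partial>lebesgue)" .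
qed

lemma half_space_sets: "(half_space :: ('a::euclidean_space \<times> real) set) \<in> sets lebesgue"
proof -
  have "closed (half_space :: ('a \<times> real) set)" by (intro closed_Times closed_UNIV closed_atLeast)
  then show ?thesis by (simp add: borel_closed)
qed

lemma loc_integrable_bounded:
  fixes w :: "'a::euclidean_space \<Rightarrow> real"
  assumes m: "w \<in> borel_measurable lebesgue" and b: "AE x in lebesgue. \<bar>w x\<bar> \<le> M"
  shows "loc_integrable w"
  unfolding loc_integrable_def set_integrable_def
proof (intro allI impI)
  fix K :: "'a set" assume K: "compact K"
  then have Ks: "K \<in> sets lebesgue" by (simp add: borel_compact)
  have "emeasure lebesgue K < \<infinity>" using emeasure_bounded_finite[OF compact_imp_bounded[OF K]] K
    by (simp add: borel_compact)
  then have "integrable lebesgue (indicator K :: 'a \<Rightarrow> real)" using Ks by simp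
  then have i: "integrable lebesgue (\<lambda>x. M * indicator K x)" by simp
  show "integrable lebesgue (\<lambda>x. indicator K x *\<^sub>R w x)"
  proof (rule Bochner_Integration.integrable_bound[OF i])
    show "(\<lambda>x. indicator K x *\<^sub>R w x) \<in> borel_measurable lebesgue" using m Ks by measurable
    show "AE x in lebesgue. norm (indicator K x *\<^sub>R w x) \<le> norm (M * indicator K x)"
      using b by (rule eventually_mono) (auto simp: indicator_def)
  qed
qed

lemma integral_half_space:
  fixes f :: "'a::euclidean_space \<times> real \<Rightarrow> real"
  shows "(\<integral>p. f p \<partial>lebesgue_on half_space) = (\<integral>p. indicator half_space p * f p \<partial>lebesgue)"
    and "integrable (lebesgue_on half_space) f \<longleftrightarrow> integrable lebesgue (\<lambda>p. indicator half_space p * f p)"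
  using half_space_sets[where 'a = 'a]
  by (simp_all add: integral_restrict_space integrable_restrict_space)

lemma borel_measurable_half_space:
  fixes f :: "'a::euclidean_space \<times> real \<Rightarrow> real"
  assumes "f \<in> borel_measurable (lebesgue_on half_space)"
  shows "(\<lambda>p. indicator half_space p * f p) \<in> borel_measurable lebesgue"
  using assms half_space_sets[where 'a = 'a] by (simp add: borel_measurable_restrict_space_iff)

lemma AE_half_space:
  "(AE p in lebesgue_on half_space. P p) \<longleftrightarrow> (AE p in (lebesgue :: ('a::euclidean_space \<times> real) measure). p \<in> half_space \<longrightarrow> P p)"
  using half_space_sets[where 'a = 'a] by (simp add: AE_restrict_space_iff)

lemma integrable_half_space_times:
  fixes f s :: "'a::euclidean_space \<times> real \<Rightarrow> real"
  assumes m: "f \<in> borel_measurable (lebesgue_on half_space)"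
    and b: "AE p in lebesgue_on half_space. \<bar>f p\<bar> \<le> M"
    and s: "continuous_on UNIV s" "\<And>x. r < norm x \<Longrightarrow> s x = 0"
  shows "integrable (lebesgue_on half_space) (\<lambda>p. f p * s p)"
proof -
  have "AE p in lebesgue. \<bar>indicator half_space p * f p\<bar> \<le> \<bar>M\<bar>"
    using b unfolding AE_half_space by (rule eventually_mono) (auto simp: indicator_def)
  from loc_integrable_bounded[OF borel_measurable_half_space[OF m] this]
  have "integrable lebesgue (\<lambda>p. (indicator half_space p * f p) * s p)"
    by (rule loc_integrable_times[OF _ s(1) compact_cball[of 0 r]]) (use s(2) in auto)
  then show ?thesis by (simp add: integral_half_space mult.assoc)
qed

lemma C_k_line_derivative':
  fixes \<sigma> :: "'a::euclidean_space \<Rightarrow> real"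
  assumes "C_k (Suc n) \<sigma>"
  shows "((\<lambda>t. \<sigma> (x + t *\<^sub>R v)) has_real_derivative frechet_derivative \<sigma> (at (x + t *\<^sub>R v)) v) (at t)"
proof -
  have lin: "linear (frechet_derivative \<sigma> (at (x + t *\<^sub>R v)))"
    using assms by (simp add: linear_frechet_derivative)
  show ?thesis
    using C_k_line_derivative[OF assms, of x "-v" t] by (simp add: linear_neg[OF lin])
qed

lemma test_function_frechet_derivative:
  fixes \<phi> :: "'a::euclidean_space \<Rightarrow> real"
  assumes t: "test_function \<phi>"
  obtains r where "r > 0" "\<And>x. r < norm x \<Longrightarrow> \<phi> x = 0" "\<And>x v. r < norm x \<Longrightarrow> frechet_derivative \<phi> (at x) v = 0"
    "\<And>v. continuous_on UNIV (\<lambda>x. frechet_derivative \<phi> (at x) v)"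
proof -
  obtain r where r: "r > 0" "\<And>x. r \<le> norm x \<Longrightarrow> \<phi> x = 0"
    using test_function_support[OF t] by blast
  show ?thesis
    using r frechet_derivative_eq_0_outside[OF test_function_C_k[OF t] r(2)]
      continuous_on_frechet_derivative[OF test_function_C_k[OF t]]
    by (intro that[of r]) auto
qed

text \<open>The half space is invariant under shifts in \<open>z\<close>, so the integral of a
  shifted \<phi> is constant, and its derivative with respect to the shift is 0.\<close>

lemma half_space_space_derivative:
  fixes \<phi> :: "'a::euclidean_space \<times> real \<Rightarrow> real"
  assumes t: "test_function \<phi>"
  shows "(\<integral>p. frechet_derivative \<phi> (at p) (e, 0) \<partial>lebesgue_on half_space) = 0"
proof -
  let ?w = "indicator half_space :: 'a \<times> real \<Rightarrow> real"
  have w: "loc_integrable ?w"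
    by (rule loc_integrable_bounded[of _ 1]) (use half_space_sets[where 'a = 'a] in auto)
  obtain \<rho> where \<rho>: "\<And>x. \<rho> \<le> norm x \<Longrightarrow> \<phi> x = 0" using test_function_support[OF t] by blast
  let ?m = "\<lambda>r. \<integral>p. ?w p * \<phi> (p - r *\<^sub>R (e, 0)) \<partial>lebesgue"
  have m: "?m r = ?m 0" for r
  proof -
    have "\<phi> \<in> borel_measurable lebesgue"
      by (rule continuous_on_UNIV_lebesgue_measurable[OF C_k_imp_continuous_on[OF test_function_C_k[OF t]]])
    then have "(\<lambda>p. ?w p * \<phi> p) \<in> borel_measurable lebesgue"
      using half_space_sets[where 'a = 'a] by measurable
    from lebesgue_integral_shift[OF this, of "- r *\<^sub>R (e, 0)"]
    have "(\<integral>p. ?w (- r *\<^sub>R (e, 0) + p) * \<phi> (- r *\<^sub>R (e, 0) + p) \<partial>lebesgue) = ?m 0" by (simp only: scaleR_zero_left diff_zero)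
    moreover have "?w (- r *\<^sub>R (e, 0) + p) = ?w p" for p by (cases p) (simp add: indicator_def)
    moreover have "- r *\<^sub>R (e, 0) + p = p - r *\<^sub>R (e, 0)" for p :: "'a \<times> real" by (cases p) simp
    ultimately show ?thesis by (simp only:)
  qed
  have c: "(f has_real_derivative 0) (at 0)" if "\<And>r. f r = f 0" for f :: "real \<Rightarrow> real"
    by (rule has_field_derivative_transform_within[OF DERIV_const[of "f 0"] zero_less_one]) (auto intro: that[symmetric])
  have "(?m has_real_derivative 0) (at 0)" by (rule c[of ?m, OF m])
  moreover have "(?m has_real_derivative - (\<integral>p. ?w p * frechet_derivative \<phi> (at (p - 0 *\<^sub>R (e, 0))) (e, 0) \<partial>lebesgue)) (at 0)"
    by (rule has_derivative_integral_shift[OF w test_function_C_k[OF t] \<rho>])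
  ultimately have "- (\<integral>p. ?w p * frechet_derivative \<phi> (at (p - 0 *\<^sub>R (e, 0))) (e, 0) \<partial>lebesgue) = 0"
    using DERIV_unique by blast
  then show ?thesis
    unfolding integral_half_space by (simp only: scaleR_zero_left diff_zero neg_equal_0_iff_equal)
qed

text \<open>The fundamental theorem of calculus on every vertical half line. Together with the
  preceding lemma it says that constants satisfy the weak formulation including the datum, so that
  they can be subtracted from entropy inequalities.\<close>

lemma half_space_time_derivative:
  fixes \<phi> :: "'a::euclidean_space \<times> real \<Rightarrow> real"
  assumes t: "test_function \<phi>"
  shows "(\<integral>p. frechet_derivative \<phi> (at p) (0, 1) \<partial>lebesgue_on half_space) = - (\<integral>z. \<phi> (z, 0) \<partial>lebesgue)"
proof -
  let ?D = "\<lambda>p. frechet_derivative \<phi> (at p) (0, 1)"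
  let ?F = "\<lambda>p. indicator half_space p * ?D p"
  obtain r where r: "r > 0" "\<And>x. r < norm x \<Longrightarrow> \<phi> x = 0" "\<And>x. r < norm x \<Longrightarrow> ?D x = 0"
    and cD: "continuous_on UNIV ?D"
    using test_function_frechet_derivative[OF t] by metis
  have "integrable (lebesgue_on half_space) (\<lambda>p. 1 * ?D p)"
    by (rule integrable_half_space_times[of _ 1, OF _ _ cD r(3)]) auto
  then have i: "integrable lebesgue ?F" by (simp add: integral_half_space)
  have Fm: "?F \<in> borel_measurable lborel"
  proof -
    have "(half_space :: ('a \<times> real) set) \<in> sets lborel"
      using borel_closed[OF closed_Times[OF closed_UNIV closed_atLeast[of "0::real"]]] by simp
    moreover have "?D \<in> borel_measurable lborel" using cD by (simp add: borel_measurable_continuous_onI)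
    ultimately show ?thesis by (intro borel_measurable_times borel_measurable_indicator) auto
  qed
  have i': "integrable (lborel \<Otimes>\<^sub>M lborel) ?F" using i Fm by (simp add: lborel_prod integrable_completion)
  have inner: "(\<integral>s. ?F (z, s) \<partial>lborel) = - \<phi> (z, 0)" for z
  proof -
    have "?F (z, s) = ?D (z, s) * indicator {0..r + 1} s" for s
    proof (cases "s \<le> r + 1")
      case False
      have "s \<le> norm (z, s)" using norm_snd_le[of s z] by simp
      then have "?D (z, s) = 0" using r False by auto
      then show ?thesis by simp
    qed (auto simp: indicator_def)
    then have "(\<integral>s. ?F (z, s) \<partial>lborel) = (\<integral>s. ?D (z, s) * indicator {0..r + 1} s \<partial>lborel)" by (simp only:)
    also have "\<dots> = \<phi> (z, r + 1) - \<phi> (z, 0)"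
    proof (rule integral_FTC_Icc_real)
      show "((\<lambda>s. \<phi> (z, s)) has_real_derivative ?D (z, s)) (at s)" for s
        using C_k_line_derivative'[OF test_function_C_k[OF t], of "(z, 0)" "(0, 1)" s] by simp
      have "continuous_on UNIV (\<lambda>s. ?D (z, s))"
        by (intro continuous_on_compose2[OF cD] continuous_intros) auto
      then show "isCont (\<lambda>s. ?D (z, s)) s" for s by (simp add: continuous_on_eq_continuous_at)
    qed (use r in simp)
    also have "\<phi> (z, r + 1) = 0"
      using norm_snd_le[of "r + 1" z] r(1) by (intro r(2)) simp
    finally show ?thesis by simp
  qed
  have "(\<integral>p. ?D p \<partial>lebesgue_on half_space) = (\<integral>p. ?F p \<partial>lebesgue)" by (simp add: integral_half_space)
  also have "\<dots> = (\<integral>p. ?F p \<partial>(lborel \<Otimes>\<^sub>M lborel))" by (simp add: lborel_prod integral_completion[OF Fm])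
  also have "\<dots> = (\<integral>z. (\<integral>s. ?F (z, s) \<partial>lborel) \<partial>lborel)"
    by (rule lborel_pair.integral_fst'[OF i', symmetric])
  also have "\<dots> = - (\<integral>z. \<phi> (z, 0) \<partial>lborel)" unfolding inner by simp
  also have "(\<integral>z. \<phi> (z, 0) \<partial>lborel) = (\<integral>z. \<phi> (z, 0) \<partial>lebesgue)"
  proof (rule integral_completion[symmetric])
    have "continuous_on UNIV (\<lambda>z. \<phi> (z, 0))"
      by (intro continuous_on_compose2[OF C_k_imp_continuous_on[OF test_function_C_k[OF t]]] continuous_intros) auto
    then show "(\<lambda>z. \<phi> (z, 0)) \<in> borel_measurable lborel" by (simp add: borel_measurable_continuous_onI)
  qed
  finally show ?thesis .
qed

lemma AE_half_space_time_nonzero: "AE p in (lebesgue_on half_space :: ('a::euclidean_space \<times> real) measure). 0 < snd p"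
proof -
  have "AE p in ((lborel :: 'a measure) \<Otimes>\<^sub>M (lborel :: real measure)). snd p \<noteq> 0"
  proof (rule lborel_pair.AE_pair_measure)
    show "{x \<in> space ((lborel :: 'a measure) \<Otimes>\<^sub>M (lborel :: real measure)). snd x \<noteq> 0} \<in> sets (lborel \<Otimes>\<^sub>M lborel)"
      by measurable
    show "AE x in (lborel :: 'a measure). AE y in (lborel :: real measure). snd (x, y) \<noteq> 0"
      by (simp add: AE_lborel_singleton)
  qed
  then have "AE p in (lborel :: ('a \<times> real) measure). snd p \<noteq> 0" by (simp only: lborel_prod)
  then have "AE p in (lebesgue :: ('a \<times> real) measure). snd p \<noteq> 0" by (simp add: AE_completion_iff)
  then show ?thesis unfolding AE_half_space by (rule eventually_mono) auto
qed

lemma has_real_derivative_bump: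
  assumes "(g has_real_derivative g') (at x)"
  shows "((\<lambda>x. bump (g x)) has_real_derivative flat_exp 2 (g x) * g') (at x)"
  using DERIV_chain2[OF flat_exp_has_derivative[of 0 "g x"] assms] by (simp add: numeral_2_eq_2)

lemma flat_exp_nonneg: "0 \<le> flat_exp n x" by (simp add: flat_exp_def)

text \<open>The expression is the time derivative of \<open>bump (T - t) * bump (T + t)\<close>. For
  \<open>t < T\<close> the logarithmic derivative of this product is the difference of the inverse
  squares of \<open>T + t\<close> and \<open>T - t\<close>, negative as soon as
  \<open>0 < t\<close>.\<close>

lemma time_bump_decreasing:
  assumes "0 \<le> t" "0 < T"
  shows "- (flat_exp 2 (T - t) * bump (T + t)) + bump (T - t) * flat_exp 2 (T + t) \<le> 0" (is "?d \<le> 0")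
    and "0 < t \<Longrightarrow> t < T \<Longrightarrow> - (flat_exp 2 (T - t) * bump (T + t)) + bump (T - t) * flat_exp 2 (T + t) < 0"
proof -
  have eq: "?d = bump (T - t) * bump (T + t) * ((1 / (T + t))\<^sup>2 - (1 / (T - t))\<^sup>2)" if "t < T"
    using assms that by (simp add: flat_exp_def algebra_simps)
  show "?d < 0" if "0 < t" "t < T"
  proof -
    have "1 / (T + t) < 1 / (T - t)" using that by (intro divide_strict_left_mono) auto
    then have "(1 / (T + t))\<^sup>2 < (1 / (T - t))\<^sup>2" using that by (intro power_strict_mono) auto
    moreover have "0 < bump (T - t) * bump (T + t)" using that by (simp add: bump_pos_iff)
    ultimately show ?thesis unfolding eq[OF that(2)] by (intro mult_pos_neg) auto
  qed
  then show "?d \<le> 0"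
    using assms by (cases "t = 0"; cases "t < T") (auto simp: flat_exp_def less_imp_le)
qed

subsection \<open>Entropy solutions in backward cones\<close>

locale cone =
  fixes e p q :: "'a::euclidean_space" and V T :: real
  assumes e: "e \<in> Basis" and V: "0 \<le> V" and T: "0 < T"
begin

text \<open>The cut-off in the directions orthogonal to \<open>e\<close>. The flux points along
  \<open>e\<close>, so nothing enters through these faces, and they do not move with time.\<close>

definition side :: "'a \<Rightarrow> real" where
  "side z = (\<Prod>i\<in>Basis - {e}. bump (z \<bullet> i - p \<bullet> i) * bump (q \<bullet> i - z \<bullet> i))"

text \<open>Two factors vanish outside the cone \<open>p \<bullet> e + V t < x \<bullet> e < q \<bullet> e - V t\<close>. The factor
  \<open>bump (T + t)\<close> makes the support compact without affecting monotonicity in \<open>t\<close> of the product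
  with \<open>bump (T - t)\<close> on \<open>t \<ge> 0\<close>.\<close>

definition cone_bump :: "'a \<times> real \<Rightarrow> real" where
  "cone_bump x = side (fst x) * (bump (fst x \<bullet> e - V * snd x - p \<bullet> e) * bump (q \<bullet> e - fst x \<bullet> e - V * snd x)) *
     (bump (T - snd x) * bump (T + snd x))"

lemma side_nonneg: "0 \<le> side z"
  unfolding side_def by (intro prod_nonneg mult_nonneg_nonneg ballI bump_nonneg)

lemma side_pos: "(\<And>i. i \<in> Basis - {e} \<Longrightarrow> p \<bullet> i < z \<bullet> i \<and> z \<bullet> i < q \<bullet> i) \<Longrightarrow> 0 < side z"
  unfolding side_def by (intro prod_pos mult_pos_pos) (auto simp: bump_pos_iff)

lemma side_nonzeroD: "side z \<noteq> 0 \<Longrightarrow> i \<in> Basis - {e} \<Longrightarrow> p \<bullet> i < z \<bullet> i \<and> z \<bullet> i < q \<bullet> i"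
  unfolding side_def by (auto simp: bump_eq_0_iff not_le)

lemma side_shift: "side (z + s *\<^sub>R e) = side z"
proof -
  have "(z + s *\<^sub>R e) \<bullet> i = z \<bullet> i" if "i \<in> Basis - {e}" for i
    using that e by (auto simp: inner_add_left inner_Basis)
  then show ?thesis unfolding side_def by (intro prod.cong) auto
qed

lemma cone_bump_nonneg: "0 \<le> cone_bump x"
  unfolding cone_bump_def by (intro mult_nonneg_nonneg side_nonneg bump_nonneg)

lemma C_k_cone_bump: "C_k n cone_bump"
proof -
  have *: "C_k n (\<lambda>x::'a \<times> real. bump (a * (fst x \<bullet> i) + b * snd x + c))" for i a b c
  proof (rule C_k_bump_affine)
    show "bounded_linear (\<lambda>x::'a \<times> real. a * (fst x \<bullet> i) + b * snd x)"
      by (intro bounded_linear_add bounded_linear_compose[OF bounded_linear_mult_right]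
          bounded_linear_compose[OF bounded_linear_inner_left] bounded_linear_fst bounded_linear_snd)
  qed
  have "C_k n (\<lambda>x::'a \<times> real. side (fst x))" unfolding side_def
    using *[of 1 _ 0 "- (p \<bullet> _)"] *[of "-1" _ 0 "q \<bullet> _"]
    by (intro C_k_prod C_k_mult) simp_all
  then show ?thesis
    unfolding cone_bump_def
    using *[of 1 e "- V" "- (p \<bullet> e)"] *[of "-1" e "- V" "q \<bullet> e"] *[of 0 e "-1" T] *[of 0 e 1 T]
    by (intro C_k_mult) (simp_all add: algebra_simps)
qed

lemma test_function_cone_bump: "test_function cone_bump"
proof (rule test_functionI[OF C_k_cone_bump])
  show "bounded (cbox (p - (V * T) *\<^sub>R e) (q + (V * T) *\<^sub>R e) \<times> {-T..T})"
    by (intro bounded_Times bounded_cbox) auto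
  fix x assume x: "x \<notin> cbox (p - (V * T) *\<^sub>R e) (q + (V * T) *\<^sub>R e) \<times> {-T..T}"
  show "cone_bump x = 0"
  proof (rule ccontr)
    assume "cone_bump x \<noteq> 0"
    then have s: "side (fst x) \<noteq> 0" and a: "p \<bullet> e + V * snd x < fst x \<bullet> e" "fst x \<bullet> e < q \<bullet> e - V * snd x"
      and t: "- T < snd x" "snd x < T"
      unfolding cone_bump_def by (auto simp: bump_eq_0_iff not_le)
    have Vt: "V * (- T) \<le> V * snd x" using t V by (intro mult_left_mono) auto
    have "(p - (V * T) *\<^sub>R e) \<bullet> i \<le> fst x \<bullet> i \<and> fst x \<bullet> i \<le> (q + (V * T) *\<^sub>R e) \<bullet> i" if i: "i \<in> Basis" for i
    proof (cases "i = e")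
      case True
      then show ?thesis using a Vt e by (simp add: inner_diff_left inner_add_left)
    next
      case False
      then show ?thesis using side_nonzeroD[OF s, of i] i e by (simp add: inner_diff_left inner_add_left inner_Basis)
    qed
    then have "fst x \<in> cbox (p - (V * T) *\<^sub>R e) (q + (V * T) *\<^sub>R e)" by (simp add: mem_box)
    with x t show False by (cases x) auto
  qed
qed

text \<open>Apart from the time factor, the derivative is \<open>- V\<close> times the sum of the
  two lateral terms whose difference appears in \<open>cone_bump_space_derivative\<close>. This
  match is what absorbs the flux.\<close>

lemma cone_bump_time_derivative:
  "frechet_derivative cone_bump (at (z, t)) (0, 1) =
     side z * (bump (z \<bullet> e - V * t - p \<bullet> e) * bump (q \<bullet> e - z \<bullet> e - V * t)) *
        (- (flat_exp 2 (T - t) * bump (T + t)) + bump (T - t) * flat_exp 2 (T + t))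
     - V * (side z * (flat_exp 2 (z \<bullet> e - V * t - p \<bullet> e) * bump (q \<bullet> e - z \<bullet> e - V * t) +
              bump (z \<bullet> e - V * t - p \<bullet> e) * flat_exp 2 (q \<bullet> e - z \<bullet> e - V * t)) *
         (bump (T - t) * bump (T + t)))" (is "_ = ?r")
proof -
  have "((\<lambda>t. cone_bump (z, t)) has_real_derivative frechet_derivative cone_bump (at (z, t)) (0, 1)) (at t)"
    using C_k_line_derivative'[OF C_k_cone_bump, of "(z, 0)" "(0, 1)" t] by simp
  moreover have "((\<lambda>t. cone_bump (z, t)) has_real_derivative ?r) (at t)"
    unfolding cone_bump_def fst_conv snd_conv
    by (rule derivative_eq_intros has_real_derivative_bump refl)+ (simp add: algebra_simps)
  ultimately show ?thesis by (rule DERIV_unique)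
qed

lemma cone_bump_space_derivative:
  "frechet_derivative cone_bump (at (z, t)) (e, 0) =
     side z * (flat_exp 2 (z \<bullet> e - V * t - p \<bullet> e) * bump (q \<bullet> e - z \<bullet> e - V * t) -
              bump (z \<bullet> e - V * t - p \<bullet> e) * flat_exp 2 (q \<bullet> e - z \<bullet> e - V * t)) *
         (bump (T - t) * bump (T + t))" (is "_ = ?r")
proof -
  have "((\<lambda>s. cone_bump (z + s *\<^sub>R e, t)) has_real_derivative frechet_derivative cone_bump (at (z, t)) (e, 0)) (at 0)"
    using C_k_line_derivative'[OF C_k_cone_bump, of "(z, t)" "(e, 0)" 0] by simp
  moreover have "((\<lambda>s. cone_bump (z + s *\<^sub>R e, t)) has_real_derivative ?r) (at 0)"
    unfolding cone_bump_def fst_conv snd_conv side_shift inner_add_left inner_scaleR_left inner_same_Basis[OF e] mult_1_right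
    by (rule derivative_eq_intros has_real_derivative_bump refl)+ (simp add: algebra_simps)
  ultimately show ?thesis by (rule DERIV_unique)
qed

text \<open>\<open>E\<close> is an entropy with flux \<open>Q\<close> along \<open>e\<close> and
  speed at most \<open>V\<close>. Tested with \<open>cone_bump\<close>, the flux term is absorbed by
  the loss at speed \<open>V\<close> in the time derivative, and the remainder has the sign of the
  derivative of the time factor. So the integrand is nonpositive, while its integral is nonnegative
  because the datum term is 0. It must vanish almost everywhere, and since the remaining weight is
  strictly negative inside the cone, so must \<open>E\<close>.\<close>

lemma vanishing:
  fixes E Q :: "'a \<times> real \<Rightarrow> real"
  assumes meas: "E \<in> borel_measurable (lebesgue_on half_space)" "Q \<in> borel_measurable (lebesgue_on half_space)"
    and bd: "AE x in lebesgue_on half_space. 0 \<le> E x \<and> E x \<le> B \<and> \<bar>Q x\<bar> \<le> V * E x"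
    and ineq: "\<And>\<phi>. test_function \<phi> \<Longrightarrow> (\<forall>x. 0 \<le> \<phi> x) \<Longrightarrow>
      0 \<le> (\<integral>x. E x * frechet_derivative \<phi> (at x) (0, 1) + Q x * frechet_derivative \<phi> (at x) (e, 0) \<partial>lebesgue_on half_space)
        + (\<integral>z. E0 z * \<phi> (z, 0) \<partial>lebesgue)"
    and E0: "\<And>z. z \<in> box p q \<Longrightarrow> E0 z = 0"
  shows "AE x in lebesgue_on half_space. 0 < snd x \<and> snd x < T \<and>
      fst x \<in> box (p + (V * snd x) *\<^sub>R e) (q - (V * snd x) *\<^sub>R e) \<longrightarrow> E x = 0"
proof -
  let ?t = "\<lambda>x. frechet_derivative cone_bump (at x) (0, 1)"
  let ?s = "\<lambda>x. frechet_derivative cone_bump (at x) (e, 0)"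
  let ?G = "\<lambda>x. E x * ?t x + Q x * ?s x"
  let ?W = "\<lambda>x. side (fst x) * (bump (fst x \<bullet> e - V * snd x - p \<bullet> e) * bump (q \<bullet> e - fst x \<bullet> e - V * snd x))"
  \<comment> \<open>What is left of \<open>?G\<close> when the lateral terms, whose total is
    nonpositive, are dropped.\<close>
  let ?H = "\<lambda>x. E x * (?W x * (- (flat_exp 2 (T - snd x) * bump (T + snd x)) + bump (T - snd x) * flat_exp 2 (T + snd x)))"
  obtain r where r: "\<And>x v. r < norm x \<Longrightarrow> frechet_derivative cone_bump (at x) v = 0"
    and c: "\<And>v. continuous_on UNIV (\<lambda>x. frechet_derivative cone_bump (at x) v)"
    using test_function_frechet_derivative[OF test_function_cone_bump] by metis
  have iE: "integrable (lebesgue_on half_space) (\<lambda>x. E x * ?t x)"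
    by (rule integrable_half_space_times[OF meas(1) _ c r]) (use bd in \<open>auto elim: eventually_mono\<close>)
  have "AE x in lebesgue_on half_space. \<bar>Q x\<bar> \<le> V * B"
    using bd by (rule eventually_mono) (use V mult_left_mono in fastforce)
  then have iQ: "integrable (lebesgue_on half_space) (\<lambda>x. Q x * ?s x)"
    by (rule integrable_half_space_times[OF meas(2) _ c r])
  have i: "integrable (lebesgue_on half_space) ?G" using iE iQ by (rule Bochner_Integration.integrable_add)
  have "E0 z * cone_bump (z, 0) = 0" for z
  proof (cases "z \<in> box p q")
    case False
    have "cone_bump (z, 0) = 0"
    proof (rule ccontr)
      assume "cone_bump (z, 0) \<noteq> 0"
      then have s: "side z \<noteq> 0" and a: "p \<bullet> e < z \<bullet> e" "z \<bullet> e < q \<bullet> e"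
        unfolding cone_bump_def by (auto simp: bump_eq_0_iff not_le)
      have "p \<bullet> i < z \<bullet> i \<and> z \<bullet> i < q \<bullet> i" if "i \<in> Basis" for i
        using side_nonzeroD[OF s, of i] a that by (cases "i = e") auto
      with False show False by (simp add: mem_box)
    qed
    then show ?thesis by simp
  qed (simp add: E0)
  then have pos: "0 \<le> (\<integral>x. ?G x \<partial>lebesgue_on half_space)"
    using ineq[OF test_function_cone_bump] cone_bump_nonneg by (simp only: simp_thms Bochner_Integration.integral_zero add_0_right)
  have W: "0 \<le> ?W x" for x by (intro mult_nonneg_nonneg side_nonneg bump_nonneg)
  have pt: "?G x \<le> ?H x \<and> ?H x \<le> 0" if x: "0 \<le> E x \<and> E x \<le> B \<and> \<bar>Q x\<bar> \<le> V * E x" "0 < snd x" for x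
  proof
    obtain z t where zt: "x = (z, t)" by (cases x)
    define A where "A = flat_exp 2 (z \<bullet> e - V * t - p \<bullet> e) * bump (q \<bullet> e - z \<bullet> e - V * t)"
    define A' where "A' = bump (z \<bullet> e - V * t - p \<bullet> e) * flat_exp 2 (q \<bullet> e - z \<bullet> e - V * t)"
    define \<alpha> where "\<alpha> = bump (T - t) * bump (T + t)"
    have nn: "0 \<le> A" "0 \<le> A'" "0 \<le> \<alpha>" by (auto simp: A_def A'_def \<alpha>_def flat_exp_nonneg)
    have "Q x * ?s x \<le> \<bar>Q x\<bar> * \<bar>?s x\<bar>" by (metis abs_ge_self abs_mult)
    also have "\<dots> \<le> (V * E x) * (side z * (A + A') * \<alpha>)"
    proof (rule mult_mono)
      show "\<bar>?s x\<bar> \<le> side z * (A + A') * \<alpha>"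
        unfolding zt cone_bump_space_derivative A_def[symmetric] A'_def[symmetric] \<alpha>_def[symmetric]
        using nn side_nonneg[of z] by (simp add: abs_mult mult_left_mono mult_right_mono)
    qed (use x V in auto)
    finally have "?G x \<le> E x * ?t x + (V * E x) * (side z * (A + A') * \<alpha>)" by simp
    also have "\<dots> = ?H x"
      unfolding zt cone_bump_time_derivative A_def[symmetric] A'_def[symmetric] \<alpha>_def[symmetric] fst_conv snd_conv
      by (simp add: right_diff_distrib mult_ac)
    finally show "?G x \<le> ?H x" .
    show "?H x \<le> 0"
      using time_bump_decreasing(1)[of "snd x" T] x T W[of x] by (intro mult_nonneg_nonpos) auto
  qed
  have ae: "AE x in lebesgue_on half_space. ?G x \<le> ?H x \<and> ?H x \<le> 0"
    using bd AE_half_space_time_nonzero by eventually_elim (rule pt)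
  have "AE x in lebesgue_on half_space. - ?G x = 0"
  proof (subst integral_nonneg_eq_0_iff_AE[symmetric])
    show "integrable (lebesgue_on half_space) (\<lambda>x. - ?G x)" by (rule Bochner_Integration.integrable_minus[OF i])
    show nn: "AE x in lebesgue_on half_space. 0 \<le> - ?G x" using ae by (rule eventually_mono) auto
    have "0 \<le> (\<integral>x. - ?G x \<partial>lebesgue_on half_space)" by (rule integral_nonneg_AE[OF nn])
    with pos show "(\<integral>x. - ?G x \<partial>lebesgue_on half_space) = 0"
      unfolding Bochner_Integration.integral_minus by linarith
  qed
  then show ?thesis using ae
  proof eventually_elim
    case (elim x)
    show ?case
    proof
      assume x: "0 < snd x \<and> snd x < T \<and> fst x \<in> box (p + (V * snd x) *\<^sub>R e) (q - (V * snd x) *\<^sub>R e)"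
      have b: "(p + (V * snd x) *\<^sub>R e) \<bullet> i < fst x \<bullet> i \<and> fst x \<bullet> i < (q - (V * snd x) *\<^sub>R e) \<bullet> i" if "i \<in> Basis" for i
        using x that unfolding mem_box by blast
      have "0 < side (fst x)"
      proof (rule side_pos)
        fix i assume i: "i \<in> Basis - {e}"
        then show "p \<bullet> i < fst x \<bullet> i \<and> fst x \<bullet> i < q \<bullet> i"
          using b[of i] e by (cases "e = i") (simp_all add: inner_add_left inner_diff_left inner_Basis)
      qed
      moreover have "0 < bump (fst x \<bullet> e - V * snd x - p \<bullet> e)" "0 < bump (q \<bullet> e - fst x \<bullet> e - V * snd x)"
        using b[OF e] e by (auto simp: bump_pos_iff inner_add_left inner_diff_left)
      ultimately have "0 < ?W x" by simp
      moreover have "?H x = 0" using elim by linarith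
      moreover have "- (flat_exp 2 (T - snd x) * bump (T + snd x)) + bump (T - snd x) * flat_exp 2 (T + snd x) < 0"
        using time_bump_decreasing(2)[of "snd x" T] x T by simp
      ultimately show "E x = 0" by (metis less_irrefl mult_eq_0_iff)
    qed
  qed
qed

end

lemma kruzhkov_entropy_solutionD:
  assumes "kruzhkov_entropy_solution (\<lambda>r. F r *\<^sub>R e) \<eta>0 \<eta>"
  shows "(\<lambda>x. \<eta> (fst x) (snd x)) \<in> borel_measurable (lebesgue_on half_space)"
    and "\<exists>M. AE x in lebesgue_on half_space. \<bar>\<eta> (fst x) (snd x)\<bar> \<le> M"
    and "test_function \<phi> \<Longrightarrow> (\<forall>x. 0 \<le> \<phi> x) \<Longrightarrow>
      0 \<le> (\<integral>x. \<bar>\<eta> (fst x) (snd x) - c\<bar> * frechet_derivative \<phi> (at x) (0, 1) +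
             (sgn (\<eta> (fst x) (snd x) - c) * (F (\<eta> (fst x) (snd x)) - F c)) * frechet_derivative \<phi> (at x) (e, 0)
             \<partial>lebesgue_on half_space) + (\<integral>z. \<bar>\<eta>0 z - c\<bar> * \<phi> (z, 0) \<partial>lebesgue)"
proof -
  show "(\<lambda>x. \<eta> (fst x) (snd x)) \<in> borel_measurable (lebesgue_on half_space)"
    "\<exists>M. AE x in lebesgue_on half_space. \<bar>\<eta> (fst x) (snd x)\<bar> \<le> M"
    using assms unfolding kruzhkov_entropy_solution_def case_prod_beta' by blast+
  assume t: "test_function \<phi>" and nn: "\<forall>x. 0 \<le> \<phi> x"
  have eq: "frechet_derivative \<phi> (at x) (F a *\<^sub>R e - F c *\<^sub>R e, 0) = (F a - F c) * frechet_derivative \<phi> (at x) (e, 0)" for x a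
  proof -
    have lin: "linear (frechet_derivative \<phi> (at x))"
      using test_function_has_derivative[OF t] has_derivative_linear by blast
    have "(F a *\<^sub>R e - F c *\<^sub>R e, 0) = (F a - F c) *\<^sub>R (e, 0)" by (simp add: scaleR_diff_left)
    then show ?thesis using linear_scale[OF lin, of "F a - F c" "(e, 0)"] by simp
  qed
  have "0 \<le> (\<integral>x. \<bar>\<eta> (fst x) (snd x) - c\<bar> * frechet_derivative \<phi> (at x) (0, 1) +
             sgn (\<eta> (fst x) (snd x) - c) * frechet_derivative \<phi> (at x) (F (\<eta> (fst x) (snd x)) *\<^sub>R e - F c *\<^sub>R e, 0)
             \<partial>lebesgue_on half_space) + (\<integral>z. \<bar>\<eta>0 z - c\<bar> * \<phi> (z, 0) \<partial>lebesgue)"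
    using assms t nn unfolding kruzhkov_entropy_solution_def case_prod_beta' prod.collapse by blast
  then show "0 \<le> (\<integral>x. \<bar>\<eta> (fst x) (snd x) - c\<bar> * frechet_derivative \<phi> (at x) (0, 1) +
             (sgn (\<eta> (fst x) (snd x) - c) * (F (\<eta> (fst x) (snd x)) - F c)) * frechet_derivative \<phi> (at x) (e, 0)
             \<partial>lebesgue_on half_space) + (\<integral>z. \<bar>\<eta>0 z - c\<bar> * \<phi> (z, 0) \<partial>lebesgue)"
    by (simp only: eq mult.assoc)
qed

lemma integrable_trace:
  fixes w :: "'a::euclidean_space \<Rightarrow> real" and \<phi> :: "'a \<times> real \<Rightarrow> real"
  assumes w: "w \<in> borel_measurable lebesgue" "\<And>z. \<bar>w z\<bar> \<le> M" and t: "test_function \<phi>"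
  shows "integrable lebesgue (\<lambda>z. w z * \<phi> (z, 0))"
proof -
  obtain r where r: "\<And>x. r \<le> norm x \<Longrightarrow> \<phi> x = 0" using test_function_support[OF t] by blast
  show ?thesis
  proof (rule loc_integrable_times[OF loc_integrable_bounded[OF w(1)] _ compact_cball[of 0 r]])
    show "AE x in lebesgue. \<bar>w x\<bar> \<le> M" using w(2) by simp
    show "continuous_on UNIV (\<lambda>z. \<phi> (z, 0))"
      by (intro continuous_on_compose2[OF C_k_imp_continuous_on[OF test_function_C_k[OF t]]] continuous_intros) auto
    show "\<phi> (x, 0) = 0" if "x \<notin> cball 0 r" for x using that by (intro r) (simp add: norm_Pair)
  qed
qed

text \<open>The entropies \<open>|\<eta> - A|\<close> and \<open>|\<eta> + 1|\<close>, the latter linear on \<open>\<eta> \<ge> 0\<close>, add up to the entropy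
  \<open>2 max 0 (\<eta> - A)\<close> modulo constants.\<close>

lemma maximum_principle:
  fixes \<eta> :: "'a::euclidean_space \<Rightarrow> real \<Rightarrow> real"
  assumes k: "kruzhkov_entropy_solution (\<lambda>r. F r *\<^sub>R e) \<eta>0 \<eta>" and e: "e \<in> Basis"
    and nn: "\<And>z t. 0 \<le> \<eta> z t"
    and m0: "\<eta>0 \<in> borel_measurable lebesgue" and \<eta>0: "\<And>z. 0 \<le> \<eta>0 z" "\<And>z. \<eta>0 z \<le> A"
    and F: "continuous_on UNIV F"
    and lip: "\<And>K. \<exists>V\<ge>0. \<forall>x\<in>{-K..K}. \<forall>y\<in>{-K..K}. \<bar>F x - F y\<bar> \<le> V * \<bar>x - y\<bar>"
  shows "AE x in lebesgue_on half_space. \<eta> (fst x) (snd x) \<le> A"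
proof -
  let ?\<eta> = "\<lambda>x. \<eta> (fst x) (snd x)"
  define E where "E x = max 0 (?\<eta> x - A)" for x
  define Q where "Q x = (if A < ?\<eta> x then F (?\<eta> x) - F A else 0)" for x
  note D = kruzhkov_entropy_solutionD[OF k]
  have A: "0 \<le> A" using \<eta>0[of undefined] by linarith
  obtain M where M: "AE x in lebesgue_on half_space. \<bar>?\<eta> x\<bar> \<le> M" using D(2) by blast
  define K where "K = max \<bar>M\<bar> A"
  obtain V where V: "0 \<le> V" "\<And>x y. x \<in> {-K..K} \<Longrightarrow> y \<in> {-K..K} \<Longrightarrow> \<bar>F x - F y\<bar> \<le> V * \<bar>x - y\<bar>"
    using lip[of K] by blast
  have Fm: "F \<in> borel_measurable borel" using F by (rule borel_measurable_continuous_onI)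
  have Fem: "(\<lambda>x. F (?\<eta> x)) \<in> borel_measurable (lebesgue_on half_space)"
    using measurable_compose[OF D(1) Fm] .
  have Em: "E \<in> borel_measurable (lebesgue_on half_space)"
    unfolding E_def[abs_def] using D(1) by measurable
  have Qm: "Q \<in> borel_measurable (lebesgue_on half_space)"
    unfolding Q_def[abs_def] using D(1) Fem by measurable
  have bd: "AE x in lebesgue_on half_space. 0 \<le> E x \<and> E x \<le> K \<and> \<bar>Q x\<bar> \<le> V * E x"
    using M
  proof (rule eventually_mono)
    fix x assume x: "\<bar>?\<eta> x\<bar> \<le> M"
    have "\<bar>F (?\<eta> x) - F A\<bar> \<le> V * \<bar>?\<eta> x - A\<bar>"
      using x A by (intro V(2)) (auto simp: K_def)
    then show "0 \<le> E x \<and> E x \<le> K \<and> \<bar>Q x\<bar> \<le> V * E x"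
      using x A V(1) by (auto simp: E_def Q_def K_def)
  qed
  have ineq: "0 \<le> (\<integral>x. E x * frechet_derivative \<phi> (at x) (0, 1) + Q x * frechet_derivative \<phi> (at x) (e, 0) \<partial>lebesgue_on half_space)
        + (\<integral>z. 0 * \<phi> (z, 0) \<partial>lebesgue)" if t: "test_function \<phi>" and pos: "\<forall>x. 0 \<le> \<phi> x" for \<phi> :: "'a \<times> real \<Rightarrow> real"
  proof -
    let ?a = "\<lambda>x. frechet_derivative \<phi> (at x) (0, 1)"
    let ?s = "\<lambda>x. frechet_derivative \<phi> (at x) (e, 0)"
    let ?I = "\<lambda>c x. \<bar>?\<eta> x - c\<bar> * ?a x + (sgn (?\<eta> x - c) * (F (?\<eta> x) - F c)) * ?s x"
    let ?G = "\<lambda>x. E x * ?a x + Q x * ?s x"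
    obtain r where r: "\<And>x v. r < norm x \<Longrightarrow> frechet_derivative \<phi> (at x) v = 0"
      and c: "\<And>v. continuous_on UNIV (\<lambda>x. frechet_derivative \<phi> (at x) v)"
      using test_function_frechet_derivative[OF t] by metis
    have int: "integrable (lebesgue_on half_space) (\<lambda>x. w x * frechet_derivative \<phi> (at x) v)"
      if "w \<in> borel_measurable (lebesgue_on half_space)" "AE x in lebesgue_on half_space. \<bar>w x\<bar> \<le> M'" for w M' v
      by (rule integrable_half_space_times[OF that c r])
    have ia: "integrable (lebesgue_on half_space) ?a" and iss: "integrable (lebesgue_on half_space) ?s"
      using int[of "\<lambda>_. 1" 1] by simp_all
    have iG: "integrable (lebesgue_on half_space) ?G"
    proof (rule Bochner_Integration.integrable_add[OF int[OF Em, of K] int[OF Qm, of "V * K"]])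
      show "AE x in lebesgue_on half_space. \<bar>E x\<bar> \<le> K" using bd by (rule eventually_mono) auto
      show "AE x in lebesgue_on half_space. \<bar>Q x\<bar> \<le> V * K"
        using bd by (rule eventually_mono) (use V(1) mult_left_mono in fastforce)
    qed
    have iB: "integrable (lebesgue_on half_space) (?I (- 1))"
    proof (rule Bochner_Integration.integrable_add[OF int[of _ "\<bar>M\<bar> + 1"] int[of _ "V * (\<bar>M\<bar> + K) + \<bar>F A\<bar> + \<bar>F (-1)\<bar>"]])
      show "(\<lambda>x. \<bar>?\<eta> x - - 1\<bar>) \<in> borel_measurable (lebesgue_on half_space)" using D(1) by measurable
      show "(\<lambda>x. sgn (?\<eta> x - - 1) * (F (?\<eta> x) - F (- 1))) \<in> borel_measurable (lebesgue_on half_space)"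
        using D(1) Fem by measurable
      show "AE x in lebesgue_on half_space. \<bar>\<bar>?\<eta> x - - 1\<bar>\<bar> \<le> \<bar>M\<bar> + 1"
        using M by (rule eventually_mono) auto
      show "AE x in lebesgue_on half_space. \<bar>sgn (?\<eta> x - - 1) * (F (?\<eta> x) - F (- 1))\<bar> \<le> V * (\<bar>M\<bar> + K) + \<bar>F A\<bar> + \<bar>F (-1)\<bar>"
        using M
      proof (rule eventually_mono)
        fix x assume x: "\<bar>?\<eta> x\<bar> \<le> M"
        have "\<bar>F (?\<eta> x) - F A\<bar> \<le> V * \<bar>?\<eta> x - A\<bar>" using x A by (intro V(2)) (auto simp: K_def)
        also have "\<dots> \<le> V * (\<bar>M\<bar> + K)" using x A V(1) by (intro mult_left_mono) (auto simp: K_def)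
        finally show "\<bar>sgn (?\<eta> x - - 1) * (F (?\<eta> x) - F (- 1))\<bar> \<le> V * (\<bar>M\<bar> + K) + \<bar>F A\<bar> + \<bar>F (-1)\<bar>"
          using nn[of "fst x" "snd x"] by (simp add: sgn_if)
      qed
    qed
    have linear: "integrable M' (\<lambda>x. 2 * f1 x + (c2 * f2 x + c3 * f3 x)) \<and>
        (\<integral>x. 2 * f1 x + (c2 * f2 x + c3 * f3 x) \<partial>M') =
          2 * (\<integral>x. f1 x \<partial>M') + (c2 * (\<integral>x. f2 x \<partial>M') + c3 * (\<integral>x. f3 x \<partial>M'))"
      if "integrable M' f1" "integrable M' f2" "integrable M' f3"
      for M' :: "('a \<times> real) measure" and f1 f2 f3 :: "'a \<times> real \<Rightarrow> real" and c2 c3 :: real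
      using that by simp
    have iR: "integrable (lebesgue_on half_space) (\<lambda>x. 2 * ?G x + ((A + 1) * ?a x + (F A - F (- 1)) * ?s x))"
      and lin: "(\<integral>x. 2 * ?G x + ((A + 1) * ?a x + (F A - F (- 1)) * ?s x) \<partial>lebesgue_on half_space) =
        2 * (\<integral>x. ?G x \<partial>lebesgue_on half_space) + ((A + 1) * (\<integral>x. ?a x \<partial>lebesgue_on half_space) + (F A - F (- 1)) * (\<integral>x. ?s x \<partial>lebesgue_on half_space))"
      using linear[OF iG ia iss] by blast+
    have I: "?I A x = (2 * ?G x + ((A + 1) * ?a x + (F A - F (- 1)) * ?s x)) - ?I (- 1) x" for x
      using nn[of "fst x" "snd x"] A by (auto simp: E_def Q_def sgn_if max_def algebra_simps)
    have "(\<integral>x. ?I A x \<partial>lebesgue_on half_space) =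
        (\<integral>x. 2 * ?G x + ((A + 1) * ?a x + (F A - F (- 1)) * ?s x) \<partial>lebesgue_on half_space) - (\<integral>x. ?I (- 1) x \<partial>lebesgue_on half_space)"
      unfolding I by (rule Bochner_Integration.integral_diff[OF iR iB])
    also note lin
    finally have eq1: "(\<integral>x. ?I A x \<partial>lebesgue_on half_space) + (\<integral>x. ?I (- 1) x \<partial>lebesgue_on half_space) =
        2 * (\<integral>x. ?G x \<partial>lebesgue_on half_space) - (A + 1) * (\<integral>z. \<phi> (z, 0) \<partial>lebesgue)"
      by (simp add: half_space_space_derivative[OF t] half_space_time_derivative[OF t])
    \<comment> \<open>As \<open>\<eta>0\<close> lies between 0 and \<open>A\<close>, the two datum
      terms add up to the constant \<open>A + 1\<close>, which cancels the trace produced by the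
      linear part in \<open>eq1\<close>. The entropy \<open>E\<close> is left with datum 0.\<close>
    have "(\<integral>z. \<bar>\<eta>0 z - A\<bar> * \<phi> (z, 0) \<partial>lebesgue) + (\<integral>z. \<bar>\<eta>0 z - - 1\<bar> * \<phi> (z, 0) \<partial>lebesgue) =
        (\<integral>z. \<bar>\<eta>0 z - A\<bar> * \<phi> (z, 0) + \<bar>\<eta>0 z - - 1\<bar> * \<phi> (z, 0) \<partial>lebesgue)"
    proof (rule Bochner_Integration.integral_add[symmetric]; rule integrable_trace[OF _ _ t, of _ "A + 1"])
      show "(\<lambda>z. \<bar>\<eta>0 z - A\<bar>) \<in> borel_measurable lebesgue" "(\<lambda>z. \<bar>\<eta>0 z - - 1\<bar>) \<in> borel_measurable lebesgue"
        using m0 by measurable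
      show "\<bar>\<bar>\<eta>0 z - A\<bar>\<bar> \<le> A + 1" "\<bar>\<bar>\<eta>0 z - - 1\<bar>\<bar> \<le> A + 1" for z using \<eta>0[of z] by auto
    qed
    also have "\<dots> = (\<integral>z. (A + 1) * \<phi> (z, 0) \<partial>lebesgue)"
    proof (intro Bochner_Integration.integral_cong refl)
      fix z
      have eq: "\<bar>\<eta>0 z - A\<bar> = A - \<eta>0 z" "\<bar>\<eta>0 z - - 1\<bar> = \<eta>0 z + 1" using \<eta>0[of z] by auto
      show "\<bar>\<eta>0 z - A\<bar> * \<phi> (z, 0) + \<bar>\<eta>0 z - - 1\<bar> * \<phi> (z, 0) = (A + 1) * \<phi> (z, 0)"
        unfolding eq by (simp add: algebra_simps)
    qed
    finally have eq2: "(\<integral>z. \<bar>\<eta>0 z - A\<bar> * \<phi> (z, 0) \<partial>lebesgue) + (\<integral>z. \<bar>\<eta>0 z - - 1\<bar> * \<phi> (z, 0) \<partial>lebesgue) =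
        (A + 1) * (\<integral>z. \<phi> (z, 0) \<partial>lebesgue)" by simp
    have "0 \<le> 2 * (\<integral>x. ?G x \<partial>lebesgue_on half_space)"
      using D(3)[OF t pos, of A] D(3)[OF t pos, of "- 1"] eq1 eq2 by linarith
    then show ?thesis by simp
  qed
  \<comment> \<open>The datum of \<open>E\<close> vanishes everywhere, so cones over arbitrarily
    large boxes are allowed; they exhaust the half space.\<close>
  have "\<forall>n::nat. AE x in lebesgue_on half_space. 0 < snd x \<and> snd x < real (Suc n) \<and>
      fst x \<in> box (- (real n *\<^sub>R One) + (V * snd x) *\<^sub>R e) (real n *\<^sub>R One - (V * snd x) *\<^sub>R e) \<longrightarrow> E x = 0"
  proof
    fix n :: nat
    interpret cone e "- (real n *\<^sub>R One)" "real n *\<^sub>R One" V "real (Suc n)"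
      using e V(1) by unfold_locales auto
    show "AE x in lebesgue_on half_space. 0 < snd x \<and> snd x < real (Suc n) \<and>
      fst x \<in> box (- (real n *\<^sub>R One) + (V * snd x) *\<^sub>R e) (real n *\<^sub>R One - (V * snd x) *\<^sub>R e) \<longrightarrow> E x = 0"
      by (rule vanishing[OF Em Qm bd ineq]) auto
  qed
  then have "AE x in lebesgue_on half_space. \<forall>n::nat. 0 < snd x \<and> snd x < real (Suc n) \<and>
      fst x \<in> box (- (real n *\<^sub>R One) + (V * snd x) *\<^sub>R e) (real n *\<^sub>R One - (V * snd x) *\<^sub>R e) \<longrightarrow> E x = 0"
    unfolding AE_all_countable .
  then show ?thesis using AE_half_space_time_nonzero
  proof eventually_elim
    case (elim x)
    obtain n where n: "norm (fst x) + V * snd x + snd x < real n" using reals_Archimedean2 by blast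
    have "0 \<le> V * snd x" using V(1) elim(2) by simp
    have "(- (real n *\<^sub>R One) + (V * snd x) *\<^sub>R e) \<bullet> i < fst x \<bullet> i \<and> fst x \<bullet> i < (real n *\<^sub>R One - (V * snd x) *\<^sub>R e) \<bullet> i"
      if i: "i \<in> Basis" for i
      using Basis_le_norm[OF i, of "fst x"] n e i \<open>0 \<le> V * snd x\<close> elim(2)
      by (auto simp: inner_add_left inner_diff_left inner_Basis)
    then have "fst x \<in> box (- (real n *\<^sub>R One) + (V * snd x) *\<^sub>R e) (real n *\<^sub>R One - (V * snd x) *\<^sub>R e)"
      by (simp add: mem_box)
    moreover have "snd x < real (Suc n)" using n norm_ge_zero[of "fst x"] \<open>0 \<le> V * snd x\<close> by linarith
    ultimately have "E x = 0" using elim by blast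
    then show ?case by (simp add: E_def max_def split: if_splits)
  qed
qed

text \<open>The upper bound \<open>le\<close>, which the maximum principle provides, confines the
  values to \<open>{0..A}\<close>. The speed \<open>V\<close> of the cone can thus be a Lipschitz
  constant of the flux fixed before the solution is known.\<close>

lemma entropy_solution_locally_constant:
  fixes \<eta> :: "'a::euclidean_space \<Rightarrow> real \<Rightarrow> real"
  assumes k: "kruzhkov_entropy_solution (\<lambda>r. F r *\<^sub>R e) \<eta>0 \<eta>" and e: "e \<in> Basis"
    and nn: "\<And>z t. 0 \<le> \<eta> z t" and le: "AE x in lebesgue_on half_space. \<eta> (fst x) (snd x) \<le> A"
    and F: "continuous_on UNIV F" and c: "c \<in> {0..A}"
    and Vl: "0 \<le> V" "\<And>x y. x \<in> {0..A} \<Longrightarrow> y \<in> {0..A} \<Longrightarrow> \<bar>F x - F y\<bar> \<le> V * \<bar>x - y\<bar>"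
    and const: "\<And>z. z \<in> box p q \<Longrightarrow> \<eta>0 z = c" and T: "0 < T"
  shows "AE x in lebesgue_on half_space. 0 < snd x \<and> snd x < T \<and>
      fst x \<in> box (p + (V * snd x) *\<^sub>R e) (q - (V * snd x) *\<^sub>R e) \<longrightarrow> \<eta> (fst x) (snd x) = c"
proof -
  let ?\<eta> = "\<lambda>x. \<eta> (fst x) (snd x)"
  note D = kruzhkov_entropy_solutionD[OF k]
  interpret cone e p q V T using e Vl(1) T by unfold_locales auto
  have Fm: "F \<in> borel_measurable borel" using F by (rule borel_measurable_continuous_onI)
  have Fem: "(\<lambda>x. F (?\<eta> x)) \<in> borel_measurable (lebesgue_on half_space)"
    using measurable_compose[OF D(1) Fm] .
  have "AE x in lebesgue_on half_space. 0 < snd x \<and> snd x < T \<and>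
      fst x \<in> box (p + (V * snd x) *\<^sub>R e) (q - (V * snd x) *\<^sub>R e) \<longrightarrow> \<bar>?\<eta> x - c\<bar> = 0"
  proof (rule vanishing[OF _ _ _ D(3)])
    show "(\<lambda>x. \<bar>?\<eta> x - c\<bar>) \<in> borel_measurable (lebesgue_on half_space)" using D(1) by measurable
    show "(\<lambda>x. sgn (?\<eta> x - c) * (F (?\<eta> x) - F c)) \<in> borel_measurable (lebesgue_on half_space)"
      using D(1) Fem by measurable
    show "AE x in lebesgue_on half_space. 0 \<le> \<bar>?\<eta> x - c\<bar> \<and> \<bar>?\<eta> x - c\<bar> \<le> A \<and>
        \<bar>sgn (?\<eta> x - c) * (F (?\<eta> x) - F c)\<bar> \<le> V * \<bar>?\<eta> x - c\<bar>"
      using le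
    proof (rule eventually_mono)
      fix x assume x: "?\<eta> x \<le> A"
      then have "\<bar>F (?\<eta> x) - F c\<bar> \<le> V * \<bar>?\<eta> x - c\<bar>" using nn c by (intro Vl(2)) auto
      then show "0 \<le> \<bar>?\<eta> x - c\<bar> \<and> \<bar>?\<eta> x - c\<bar> \<le> A \<and> \<bar>sgn (?\<eta> x - c) * (F (?\<eta> x) - F c)\<bar> \<le> V * \<bar>?\<eta> x - c\<bar>"
        using x nn[of "fst x" "snd x"] c by (auto simp: abs_mult sgn_if)
    qed
  qed (auto simp: const)
  then show ?thesis by (rule eventually_mono) auto
qed

subsection \<open>Transport along characteristics\<close>

lemma norm_scaleR_sgn: "norm x *\<^sub>R sgn x = (x :: 'b::real_normed_vector)"
  unfolding sgn_div_norm by (cases "x = 0") simp_all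

text \<open>Multiplying the modulus back onto the direction turns the equation for
  \<open>sgn u\<close> into one for \<open>u\<close> itself with speed \<open>g (norm u)\<close>,
  also where \<open>u\<close> vanishes. Measurability of \<open>u\<close> in space-time is recovered
  from that of its modulus and direction.\<close>

lemma weak_transport_solution_component:
  fixes u0 :: "'a::euclidean_space \<Rightarrow> 'b::euclidean_space" and u :: "'a \<Rightarrow> real \<Rightarrow> 'b"
  assumes w: "weak_transport_solution (\<lambda>r. g r *\<^sub>R e) (\<lambda>z. norm (u0 z)) (\<lambda>z t. norm (u z t))
      (\<lambda>z. sgn (u0 z)) (\<lambda>z t. sgn (u z t))"
    and nm: "(\<lambda>x. norm (u (fst x) (snd x))) \<in> borel_measurable (lebesgue_on half_space)"
    and M: "AE x in lebesgue_on half_space. norm (u (fst x) (snd x)) \<le> M"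
    and g: "continuous_on UNIV g"
    and u0: "u0 \<in> borel_measurable lebesgue" "\<And>z. norm (u0 z) \<le> M0"
  shows "(\<lambda>x. u (fst x) (snd x)) \<in> borel_measurable (lebesgue_on half_space)"
    and "test_function \<phi> \<Longrightarrow>
      (\<integral>x. (u (fst x) (snd x) \<bullet> j) * (frechet_derivative \<phi> (at x) (0, 1) +
          g (norm (u (fst x) (snd x))) * frechet_derivative \<phi> (at x) (e, 0)) \<partial>lebesgue_on half_space)
      + (\<integral>z. (u0 z \<bullet> j) * \<phi> (z, 0) \<partial>lebesgue) = 0"
proof -
  let ?U = "\<lambda>x. u (fst x) (snd x)"
  have sm: "(\<lambda>x. sgn (?U x)) \<in> borel_measurable (lebesgue_on half_space)"
    using conjunct1[OF w[unfolded weak_transport_solution_def]] by (simp only: case_prod_beta')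
  have "(\<lambda>x. norm (?U x) *\<^sub>R sgn (?U x)) \<in> borel_measurable (lebesgue_on half_space)"
    by (rule borel_measurable_scaleR[OF nm sm])
  then show Um: "?U \<in> borel_measurable (lebesgue_on half_space)" by (simp only: norm_scaleR_sgn)
  assume t: "test_function \<phi>"
  let ?a = "\<lambda>x. frechet_derivative \<phi> (at x) (0, 1)"
  let ?s = "\<lambda>x. frechet_derivative \<phi> (at x) (e, 0)"
  let ?V = "\<lambda>x. (?a x + g (norm (?U x)) * ?s x) *\<^sub>R ?U x"
  obtain r where r: "\<And>x v. r < norm x \<Longrightarrow> frechet_derivative \<phi> (at x) v = 0"
    and c: "\<And>v. continuous_on UNIV (\<lambda>x. frechet_derivative \<phi> (at x) v)"
    using test_function_frechet_derivative[OF t] by metis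
  have dm: "(\<lambda>x. frechet_derivative \<phi> (at x) v) \<in> borel_measurable (lebesgue_on half_space)" for v
    using continuous_on_UNIV_lebesgue_measurable[OF c] by (rule measurable_restrict_space1)
  have gm: "(\<lambda>x. g (norm (?U x))) \<in> borel_measurable (lebesgue_on half_space)"
    using measurable_compose[OF nm borel_measurable_continuous_onI[OF g]] .
  have "bounded (g ` {0..\<bar>M\<bar>})"
    by (intro compact_imp_bounded compact_continuous_image continuous_on_subset[OF g]) auto
  then obtain B where "\<forall>y\<in>g ` {0..\<bar>M\<bar>}. norm y \<le> B" unfolding bounded_iff by blast
  then have B: "\<bar>g y\<bar> \<le> B" if "0 \<le> y" "y \<le> \<bar>M\<bar>" for y using that by simp
  have "0 \<le> B" using B[of 0] by simp
  have "integrable (lebesgue_on half_space) (\<lambda>x. norm (?U x) * ?a x)"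
    by (rule integrable_half_space_times[OF nm _ c r]) (use M in simp)
  moreover have "integrable (lebesgue_on half_space) (\<lambda>x. (norm (?U x) * g (norm (?U x))) * ?s x)"
  proof (rule integrable_half_space_times[OF _ _ c r])
    show "(\<lambda>x. norm (?U x) * g (norm (?U x))) \<in> borel_measurable (lebesgue_on half_space)"
      using nm gm by (rule borel_measurable_times)
    show "AE x in lebesgue_on half_space. \<bar>norm (?U x) * g (norm (?U x))\<bar> \<le> \<bar>M\<bar> * B"
      using M by (rule eventually_mono) (auto simp: abs_mult intro!: mult_mono B)
  qed
  ultimately have k: "integrable (lebesgue_on half_space) (\<lambda>x. norm (?U x) * ?a x + (norm (?U x) * g (norm (?U x))) * ?s x)"
    by (rule Bochner_Integration.integrable_add)
  have Vi: "integrable (lebesgue_on half_space) ?V"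
  proof (rule Bochner_Integration.integrable_bound[OF k])
    show "?V \<in> borel_measurable (lebesgue_on half_space)"
      by (rule borel_measurable_scaleR[OF borel_measurable_add[OF dm borel_measurable_times[OF gm dm]] Um])
    have "norm (?V x) = norm (norm (?U x) * ?a x + (norm (?U x) * g (norm (?U x))) * ?s x)" for x
    proof -
      have "norm (?U x) * ?a x + (norm (?U x) * g (norm (?U x))) * ?s x = (?a x + g (norm (?U x)) * ?s x) * norm (?U x)"
        by (simp add: algebra_simps)
      then show ?thesis by (simp add: abs_mult)
    qed
    then show "AE x in lebesgue_on half_space. norm (?V x) \<le> norm (norm (?U x) * ?a x + (norm (?U x) * g (norm (?U x))) * ?s x)"
      by simp
  qed
  obtain \<rho> where \<rho>: "\<And>x. \<rho> \<le> norm x \<Longrightarrow> \<phi> x = 0" using test_function_support[OF t] by blast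
  have ti: "integrable lebesgue (\<lambda>z. norm (u0 z) * \<phi> (z, 0))"
    by (rule integrable_trace[OF _ _ t, of _ M0]) (use u0 in auto)
  have tm: "(\<lambda>z. \<phi> (z, 0)) \<in> borel_measurable lebesgue"
    by (intro continuous_on_UNIV_lebesgue_measurable continuous_on_compose2[OF C_k_imp_continuous_on[OF test_function_C_k[OF t]]] continuous_intros) auto
  have Ti: "integrable lebesgue (\<lambda>z. \<phi> (z, 0) *\<^sub>R u0 z)"
    by (rule Bochner_Integration.integrable_bound[OF ti]) (use tm u0(1) in \<open>auto simp: abs_mult mult.commute\<close>)
  have V: "(norm (?U x) * (?a x + frechet_derivative \<phi> (at x) (g (norm (?U x)) *\<^sub>R e, 0))) *\<^sub>R sgn (?U x) = ?V x" for x
  proof -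
    have lin: "linear (frechet_derivative \<phi> (at x))"
      using test_function_has_derivative[OF t] has_derivative_linear by blast
    have "frechet_derivative \<phi> (at x) (g (norm (?U x)) *\<^sub>R e, 0) = g (norm (?U x)) * ?s x"
      using linear_scale[OF lin, of "g (norm (?U x))" "(e, 0)"] by simp
    then have "(norm (?U x) * (?a x + frechet_derivative \<phi> (at x) (g (norm (?U x)) *\<^sub>R e, 0))) *\<^sub>R sgn (?U x) =
        (?a x + g (norm (?U x)) * ?s x) *\<^sub>R (norm (?U x) *\<^sub>R sgn (?U x))" by (simp add: mult.commute)
    then show ?thesis by (simp only: norm_scaleR_sgn)
  qed
  have T: "(norm (u0 z) * \<phi> (z, 0)) *\<^sub>R sgn (u0 z) = \<phi> (z, 0) *\<^sub>R u0 z" for z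
  proof -
    have "(norm (u0 z) * \<phi> (z, 0)) *\<^sub>R sgn (u0 z) = \<phi> (z, 0) *\<^sub>R (norm (u0 z) *\<^sub>R sgn (u0 z))" by (simp add: mult.commute)
    then show ?thesis by (simp only: norm_scaleR_sgn)
  qed
  have "(\<integral>x. ?V x \<partial>lebesgue_on half_space) + (\<integral>z. \<phi> (z, 0) *\<^sub>R u0 z \<partial>lebesgue) = 0"
    using conjunct2[OF w[unfolded weak_transport_solution_def], rule_format, OF t]
    by (simp only: case_prod_beta' prod.collapse V T)
  then have "(\<integral>x. ?V x \<partial>lebesgue_on half_space) \<bullet> j + (\<integral>z. \<phi> (z, 0) *\<^sub>R u0 z \<partial>lebesgue) \<bullet> j = 0"
    by (simp flip: inner_add_left)
  then have "(\<integral>x. ?V x \<bullet> j \<partial>lebesgue_on half_space) + (\<integral>z. (\<phi> (z, 0) *\<^sub>R u0 z) \<bullet> j \<partial>lebesgue) = 0"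
    by (subst integral_inner_left[OF Vi], subst integral_inner_left[OF Ti])
  then show "(\<integral>x. (?U x \<bullet> j) * (?a x + g (norm (?U x)) * ?s x) \<partial>lebesgue_on half_space)
      + (\<integral>z. (u0 z \<bullet> j) * \<phi> (z, 0) \<partial>lebesgue) = 0"
    by (simp only: inner_scaleR_left mult.commute)
qed

lemma test_function_bounded_directional:
  fixes \<sigma> :: "'a::euclidean_space \<Rightarrow> real"
  assumes t: "test_function \<sigma>"
  obtains L where "0 \<le> L" "\<And>z s t. \<bar>\<sigma> (z - s *\<^sub>R f) - \<sigma> (z - t *\<^sub>R f)\<bar> \<le> L * \<bar>s - t\<bar>"
proof -
  obtain r where r: "\<And>x v. r < norm x \<Longrightarrow> frechet_derivative \<sigma> (at x) v = 0"
    and c: "\<And>v. continuous_on UNIV (\<lambda>x. frechet_derivative \<sigma> (at x) v)"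
    using test_function_frechet_derivative[OF t] by metis
  have "bounded ((\<lambda>x. frechet_derivative \<sigma> (at x) f) ` cball 0 r)"
    by (intro compact_imp_bounded compact_continuous_image continuous_on_subset[OF c]) auto
  then obtain L where L: "\<forall>y\<in>(\<lambda>x. frechet_derivative \<sigma> (at x) f) ` cball 0 r. norm y \<le> L" unfolding bounded_iff by blast
  have L': "\<bar>frechet_derivative \<sigma> (at x) f\<bar> \<le> \<bar>L\<bar>" for x
  proof (cases "norm x \<le> r")
    case True
    then have "\<bar>frechet_derivative \<sigma> (at x) f\<bar> \<le> L" using L by simp
    then show ?thesis by linarith
  qed (simp add: r)
  show ?thesis
  proof (rule that[of "\<bar>L\<bar>"])
    fix z s t
    have "norm (\<sigma> (z - s *\<^sub>R f) - \<sigma> (z - t *\<^sub>R f)) \<le> \<bar>L\<bar> * norm (s - t)"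
    proof (rule field_differentiable_bound)
      show "((\<lambda>t. \<sigma> (z - t *\<^sub>R f)) has_field_derivative - frechet_derivative \<sigma> (at (z - q *\<^sub>R f)) f) (at q within UNIV)" for q
        by (rule C_k_line_derivative[OF test_function_C_k[OF t]])
      show "norm (- frechet_derivative \<sigma> (at (z - q *\<^sub>R f)) f) \<le> \<bar>L\<bar>" for q
        using L'[of "z - q *\<^sub>R f"] by (simp only: norm_minus_cancel real_norm_def)
    qed simp_all
    then show "\<bar>\<sigma> (z - s *\<^sub>R f) - \<sigma> (z - t *\<^sub>R f)\<bar> \<le> \<bar>L\<bar> * \<bar>s - t\<bar>" by simp
  qed simp
qed

lemma test_function_shift:
  fixes \<sigma> :: "'a::euclidean_space \<Rightarrow> real"
  assumes t: "test_function \<sigma>"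
  shows "test_function (\<lambda>z. \<sigma> (z - a))"
proof -
  obtain r where r: "\<And>x. r \<le> norm x \<Longrightarrow> \<sigma> x = 0" using test_function_support[OF t] by blast
  show ?thesis
  proof (rule test_functionI)
    show "C_k n (\<lambda>z. \<sigma> (z - a))" for n
      using C_k_compose_affine[OF bounded_linear_ident test_function_C_k[OF t], of n "- a"] by simp
    show "bounded (cball 0 (r + norm a) :: 'a set)" by simp
    show "\<sigma> (x - a) = 0" if "x \<notin> cball 0 (r + norm a)" for x
      using that norm_triangle_ineq2[of x a] by (intro r) simp
  qed
qed

lemma integrable_times_test_function:
  fixes w \<sigma> :: "'a::euclidean_space \<Rightarrow> real"
  assumes "w \<in> borel_measurable lebesgue" "AE z in lebesgue. \<bar>w z\<bar> \<le> M" and t: "test_function \<sigma>"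
  shows "integrable lebesgue (\<lambda>z. w z * \<sigma> z)"
proof -
  obtain r where r: "\<And>x. r \<le> norm x \<Longrightarrow> \<sigma> x = 0" using test_function_support[OF t] by blast
  show ?thesis
    by (rule loc_integrable_times[OF loc_integrable_bounded[OF assms(1,2)] C_k_imp_continuous_on[OF test_function_C_k[OF t]] compact_cball[of 0 r]])
       (use r in auto)
qed

text \<open>Weak-* continuity speaks of a fixed test function, whereas here it moves along a
  characteristic. Since \<open>u\<close> is bounded uniformly in time and \<sigma> is Lipschitz, the
  motion costs at most a multiple of \<open>\<bar>t - t0\<bar>\<close>.\<close>

lemma continuous_on_moving_average:
  fixes u :: "'a::euclidean_space \<Rightarrow> real \<Rightarrow> 'b::euclidean_space"
  assumes u: "weakstar_continuous_in_time u" and s: "test_function \<sigma>"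
  shows "continuous_on {0..} (\<lambda>t. \<integral>z. (u z t \<bullet> j) * \<sigma> (z - t *\<^sub>R f) \<partial>lebesgue)"
  unfolding continuous_on_def
proof
  let ?m = "\<lambda>t. \<integral>z. (u z t \<bullet> j) * \<sigma> (z - t *\<^sub>R f) \<partial>lebesgue"
  fix t0 :: real assume t0: "t0 \<in> {0..}"
  have um: "(\<lambda>z. u z t) \<in> borel_measurable lebesgue" if "0 \<le> t" for t
    using u that by (simp add: weakstar_continuous_in_time_def)
  obtain M' where M': "\<And>t. 0 \<le> t \<Longrightarrow> AE z in lebesgue. norm (u z t) \<le> M'"
    using u by (auto simp: weakstar_continuous_in_time_def)
  define M where "M = \<bar>M'\<bar> * norm j"
  have M: "AE z in lebesgue. \<bar>u z t \<bullet> j\<bar> \<le> M" if "0 \<le> t" for t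
    using M'[OF that]
  proof (rule eventually_mono)
    fix z assume "norm (u z t) \<le> M'"
    then have "norm (u z t) * norm j \<le> \<bar>M'\<bar> * norm j" by (intro mult_right_mono) auto
    then show "\<bar>u z t \<bullet> j\<bar> \<le> M" using Cauchy_Schwarz_ineq2[of "u z t" j] by (simp add: M_def)
  qed
  have M0: "0 \<le> M" by (simp add: M_def)
  have ujm: "(\<lambda>z. u z t \<bullet> j) \<in> borel_measurable lebesgue" if "0 \<le> t" for t
    using um[OF that] by measurable
  have int: "integrable lebesgue (\<lambda>z. (u z t \<bullet> j) * \<sigma> (z - a))" if "0 \<le> t" for t a
    by (rule integrable_times_test_function[OF ujm[OF that] M[OF that] test_function_shift[OF s]])
  obtain L where L: "0 \<le> L" "\<And>z s t. \<bar>\<sigma> (z - s *\<^sub>R f) - \<sigma> (z - t *\<^sub>R f)\<bar> \<le> L * \<bar>s - t\<bar>"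
    using test_function_bounded_directional[OF s] by metis
  obtain r where r: "\<And>x. r \<le> norm x \<Longrightarrow> \<sigma> x = 0" using test_function_support[OF s] by blast
  define R where "R = r + (t0 + 1) * norm f"
  have lip: "\<bar>\<sigma> (z - t *\<^sub>R f) - \<sigma> (z - t0 *\<^sub>R f)\<bar> \<le> L * \<bar>t - t0\<bar> * indicator (cball 0 R) z"
    if t: "0 \<le> t" "\<bar>t - t0\<bar> < 1" for t z
  proof (cases "z \<in> cball 0 R")
    case False
    have "\<sigma> (z - q *\<^sub>R f) = 0" if "0 \<le> q" "q \<le> t0 + 1" for q
    proof (rule r)
      have "norm (q *\<^sub>R f) \<le> (t0 + 1) * norm f" using that by (simp add: mult_right_mono)
      then show "r \<le> norm (z - q *\<^sub>R f)"
        using False norm_triangle_ineq2[of z "q *\<^sub>R f"] by (simp add: R_def)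
    qed
    from this[of t] this[of t0] t t0 False show ?thesis by simp
  qed (use L(2)[of z t t0] in simp)
  have Ni: "integrable lebesgue (indicator (cball 0 R) :: 'a \<Rightarrow> real)"
  proof -
    have "loc_integrable (\<lambda>_::'a. 1)" by (rule loc_integrable_bounded[of _ 1]) auto
    then show ?thesis by (simp add: loc_integrable_def set_integrable_def)
  qed
  \<comment> \<open>The average with the test function frozen at time \<open>t0\<close>, to which
    weak-* continuity applies directly.\<close>
  define n where "n t = (\<integral>z. (u z t \<bullet> j) * \<sigma> (z - t0 *\<^sub>R f) \<partial>lebesgue)" for t
  define C where "C = M * L * (\<integral>z. indicator (cball 0 R) z \<partial>(lebesgue :: 'a measure))"
  have diff: "\<bar>?m t - n t\<bar> \<le> C * \<bar>t - t0\<bar>" if t: "0 \<le> t" "\<bar>t - t0\<bar> < 1" for t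
  proof -
    have i: "integrable lebesgue (\<lambda>z. (u z t \<bullet> j) * \<sigma> (z - t *\<^sub>R f) - (u z t \<bullet> j) * \<sigma> (z - t0 *\<^sub>R f))"
      by (rule Bochner_Integration.integrable_diff[OF int[OF t(1)] int[OF t(1)]])
    have "\<bar>?m t - n t\<bar> = \<bar>\<integral>z. (u z t \<bullet> j) * \<sigma> (z - t *\<^sub>R f) - (u z t \<bullet> j) * \<sigma> (z - t0 *\<^sub>R f) \<partial>lebesgue\<bar>"
      unfolding n_def by (subst Bochner_Integration.integral_diff[OF int[OF t(1)] int[OF t(1)]]) simp
    also have "\<dots> \<le> (\<integral>z. \<bar>(u z t \<bullet> j) * \<sigma> (z - t *\<^sub>R f) - (u z t \<bullet> j) * \<sigma> (z - t0 *\<^sub>R f)\<bar> \<partial>lebesgue)"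
      by (rule integral_abs_bound)
    also have "\<dots> \<le> (\<integral>z. M * L * \<bar>t - t0\<bar> * indicator (cball 0 R) z \<partial>(lebesgue :: 'a measure))"
    proof (rule integral_mono_AE)
      show "integrable lebesgue (\<lambda>z. \<bar>(u z t \<bullet> j) * \<sigma> (z - t *\<^sub>R f) - (u z t \<bullet> j) * \<sigma> (z - t0 *\<^sub>R f)\<bar>)"
        using i by (rule integrable_abs)
      show "integrable lebesgue (\<lambda>z::'a. M * L * \<bar>t - t0\<bar> * indicator (cball 0 R) z)"
        using Ni by (rule integrable_mult_right)
      show "AE z in lebesgue. \<bar>(u z t \<bullet> j) * \<sigma> (z - t *\<^sub>R f) - (u z t \<bullet> j) * \<sigma> (z - t0 *\<^sub>R f)\<bar>
          \<le> M * L * \<bar>t - t0\<bar> * indicator (cball 0 R) z"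
        using M[OF t(1)]
      proof (rule eventually_mono)
        fix z assume z: "\<bar>u z t \<bullet> j\<bar> \<le> M"
        have "\<bar>u z t \<bullet> j\<bar> * \<bar>\<sigma> (z - t *\<^sub>R f) - \<sigma> (z - t0 *\<^sub>R f)\<bar> \<le> M * (L * \<bar>t - t0\<bar> * indicator (cball 0 R) z)"
          by (rule mult_mono[OF z lip[OF t] M0 abs_ge_zero])
        then show "\<bar>(u z t \<bullet> j) * \<sigma> (z - t *\<^sub>R f) - (u z t \<bullet> j) * \<sigma> (z - t0 *\<^sub>R f)\<bar>
          \<le> M * L * \<bar>t - t0\<bar> * indicator (cball 0 R) z"
          by (simp only: right_diff_distrib[symmetric] abs_mult mult.assoc)
      qed
    qed
    also have "\<dots> = C * \<bar>t - t0\<bar>" unfolding C_def integral_mult_right_zero by (simp only: mult_ac)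
    finally show ?thesis .
  qed
  have n: "(n \<longlongrightarrow> n t0) (at t0 within {0..})"
  proof -
    have "continuous_on {0..} (\<lambda>t. \<integral>z. \<sigma> (z - t0 *\<^sub>R f) *\<^sub>R u z t \<partial>lebesgue)"
      using u test_function_shift[OF s] unfolding weakstar_continuous_in_time_def by blast
    then have "continuous_on {0..} (\<lambda>t. (\<integral>z. \<sigma> (z - t0 *\<^sub>R f) *\<^sub>R u z t \<partial>lebesgue) \<bullet> j)"
      by (intro continuous_intros)
    moreover have "(\<integral>z. \<sigma> (z - t0 *\<^sub>R f) *\<^sub>R u z t \<partial>lebesgue) \<bullet> j = n t" if t: "t \<in> {0..}" for t
    proof -
      let ?s = "\<lambda>z. \<sigma> (z - t0 *\<^sub>R f)"
      have sm: "?s \<in> borel_measurable lebesgue"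
        by (rule continuous_on_UNIV_lebesgue_measurable[OF C_k_imp_continuous_on[OF test_function_C_k[OF test_function_shift[OF s]]]])
      have "integrable lebesgue (\<lambda>z. M' * ?s z)"
        by (rule integrable_times_test_function[of _ "\<bar>M'\<bar>", OF _ _ test_function_shift[OF s]]) auto
      then have "integrable lebesgue (\<lambda>z. ?s z *\<^sub>R u z t)"
      proof (rule Bochner_Integration.integrable_bound)
        show "(\<lambda>z. ?s z *\<^sub>R u z t) \<in> borel_measurable lebesgue" using sm um[of t] t by simp
        show "AE z in lebesgue. norm (?s z *\<^sub>R u z t) \<le> norm (M' * ?s z)"
          using M'[of t] t by (auto simp: abs_mult mult.commute elim!: eventually_mono intro!: mult_right_mono)
      qed
      from integral_inner_left[OF this, of j]
      show ?thesis unfolding n_def by (simp only: inner_scaleR_left mult.commute)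
    qed
    ultimately have "continuous_on {0..} n" by (rule continuous_on_eq)
    then show ?thesis using t0 by (auto simp: continuous_on_def)
  qed
  have "((\<lambda>t. ?m t - n t) \<longlongrightarrow> 0) (at t0 within {0..})"
  proof (rule Lim_null_comparison)
    show "\<forall>\<^sub>F t in at t0 within {0..}. norm (?m t - n t) \<le> C * \<bar>t - t0\<bar>"
      unfolding eventually_at by (rule exI[of _ 1]) (use diff in \<open>auto simp: dist_real_def\<close>)
    have "((\<lambda>t. C * \<bar>t - t0\<bar>) \<longlongrightarrow> C * \<bar>t0 - t0\<bar>) (at t0 within {0..})" by (intro tendsto_intros)
    then show "((\<lambda>t. C * \<bar>t - t0\<bar>) \<longlongrightarrow> 0) (at t0 within {0..})" by simp
  qed
  from tendsto_add[OF this n] show "(?m \<longlongrightarrow> ?m t0) (at t0 within {0..})" by (simp add: n_def)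
qed

lemma half_line_integral_derivative:
  assumes d: "\<And>t. (\<alpha> has_real_derivative \<alpha>' t) (at t)" and c: "continuous_on UNIV \<alpha>'"
    and z: "\<And>t. 1 \<le> t \<Longrightarrow> \<alpha> t = 0"
  shows "\<And>t. 1 < t \<Longrightarrow> \<alpha>' t = 0"
    and "integrable lebesgue (\<lambda>t. indicator {0..} t * \<alpha>' t)"
    and "(\<integral>t. indicator {0..} t * \<alpha>' t \<partial>lebesgue) = - \<alpha> 0"
proof -
  show z': "\<alpha>' t = 0" if "1 < t" for t
  proof -
    have "((\<lambda>t. 0) has_real_derivative 0) (at t)" by simp
    then have "(\<alpha> has_real_derivative 0) (at t)"
      by (rule has_field_derivative_transform_within_open[of _ _ _ "{1<..}"]) (use that in \<open>simp_all add: z\<close>)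
    with d[of t] show ?thesis by (rule DERIV_unique)
  qed
  have eq: "(\<lambda>t. indicator {0..} t * \<alpha>' t) = (\<lambda>t. \<alpha>' t * indicator {0..2} t)"
  proof
    fix t show "indicator {0..} t * \<alpha>' t = \<alpha>' t * indicator {0..2} t"
      using z'[of t] by (cases "1 < t") (auto simp: indicator_def)
  qed
  have hb: "has_bochner_integral lborel (\<lambda>t. \<alpha>' t * indicator {0..2} t) (\<alpha> 2 - \<alpha> 0)"
    by (rule has_bochner_integral_FTC_Icc_real) (use c in \<open>simp_all add: d continuous_on_eq_continuous_at\<close>)
  have m: "(\<lambda>t. \<alpha>' t * indicator {0..2} t) \<in> borel_measurable lborel"
    by (rule borel_measurable_has_bochner_integral[OF hb])
  show "integrable lebesgue (\<lambda>t. indicator {0..} t * \<alpha>' t)"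
    unfolding eq using hb m by (simp add: integrable_completion has_bochner_integral_iff)
  show "(\<integral>t. indicator {0..} t * \<alpha>' t \<partial>lebesgue) = - \<alpha> 0"
    unfolding eq using hb z[of 2] m by (simp add: integral_completion has_bochner_integral_iff)
qed

text \<open>Testing in time needs a compactly supported \<alpha> with prescribed derivative \<tau>
  on \<open>t > 0\<close>, although the integral of \<tau> may be nonzero. Subtracting the mirror
  image of \<tau>, which lives on negative times, makes the total integral 0 without changing
  anything on the half space.\<close>

lemma odd_antiderivative:
  fixes \<tau> :: "real \<Rightarrow> real"
  assumes t: "test_function \<tau>" and supp: "\<And>t. t \<notin> {0<..<1} \<Longrightarrow> \<tau> t = 0"
  obtains \<alpha> where "test_function \<alpha>" "\<And>t. 1 \<le> t \<Longrightarrow> \<alpha> t = 0"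
    "\<And>t. (\<alpha> has_real_derivative \<tau> t - \<tau> (- t)) (at t)"
proof -
  let ?f = "\<lambda>t. \<tau> t - \<tau> (- t)"
  have Cf: "C_k n ?f" for n
  proof -
    have "C_k n (\<lambda>t. \<tau> (- t + 0))"
      by (rule C_k_compose_affine[OF bounded_linear_minus[OF bounded_linear_ident] test_function_C_k[OF t]])
    from C_k_mult[OF C_k_const[of n "-1"] this] have "C_k n (\<lambda>t. - 1 * \<tau> (- t + 0))" .
    from C_k_add[OF test_function_C_k[OF t] this] show ?thesis by simp
  qed
  have cf: "continuous_on S ?f" for S by (rule C_k_imp_continuous_on[OF Cf[of 0]])
  define \<alpha> where "\<alpha> t = integral {-2..t} ?f" for t
  have f0: "?f t = 0" if "t \<le> -1 \<or> 1 \<le> t" for t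
  proof -
    have "\<tau> t = 0" "\<tau> (- t) = 0" using that by (auto intro!: supp)
    then show ?thesis by simp
  qed
  have d: "(\<alpha> has_real_derivative ?f t) (at t)" for t
  proof (cases "-2 < t")
    case True
    have "(\<alpha> has_real_derivative ?f t) (at t within {-2..t + 1})"
      unfolding \<alpha>_def[abs_def] by (rule integral_has_real_derivative[OF cf]) (use True in simp)
    then show ?thesis using True by (simp only: at_within_Icc_at less_add_one)
  next
    case False
    have a0: "\<alpha> s = 0" if s: "s < -1" for s
    proof -
      have "integral {-2..s} ?f = integral {-2..s} (\<lambda>_. 0)"
      proof (rule Henstock_Kurzweil_Integration.integral_cong)
        show "?f x = 0" if "x \<in> {-2..s}" for x by (rule f0) (use that s in simp)
      qed
      then show ?thesis unfolding \<alpha>_def by simp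
    qed
    have "(\<alpha> has_real_derivative 0) (at t)"
    proof (rule has_field_derivative_transform_within_open)
      show "((\<lambda>_. 0) has_real_derivative 0) (at t)" by simp
      show "open {..<-1::real}" by simp
      show "t \<in> {..<-1}" using False by simp
      show "0 = \<alpha> s" if "s \<in> {..<-1}" for s using a0[of s] that by simp
    qed
    moreover have "?f t = 0" by (rule f0) (use False in auto)
    ultimately show ?thesis by (simp only:)
  qed
  have C: "C_k n \<alpha>" for n
  proof (cases n)
    case 0
    then show ?thesis using DERIV_isCont[OF d] by (simp add: continuous_on_eq_continuous_at)
  next
    case (Suc m)
    have "C_k (Suc m) \<alpha>"
    proof (rule C_k_SucI)
      show "(\<alpha> has_derivative (\<lambda>h. ?f x * h)) (at x)" for x
        using d[of x] by (simp add: has_field_derivative_def)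
      show "C_k m (\<lambda>x. ?f x * i)" for i by (rule C_k_mult[OF Cf C_k_const])
    qed
    then show ?thesis by (simp only: Suc)
  qed
  have z1: "\<alpha> t = 0" if "t \<le> -1" for t
  proof -
    have "integral {-2..t} ?f = integral {-2..t} (\<lambda>_. 0)"
    proof (rule Henstock_Kurzweil_Integration.integral_cong)
      show "?f x = 0" if "x \<in> {-2..t}" for x by (rule f0) (use that \<open>t \<le> -1\<close> in simp)
    qed
    then show ?thesis unfolding \<alpha>_def by simp
  qed
  text \<open>The integrand is odd, so its antiderivative is even.\<close>
  have even: "\<alpha> t = \<alpha> (- t)" for t
  proof -
    have "\<forall>s. ((\<lambda>t. \<alpha> t - \<alpha> (- t)) has_real_derivative 0) (at s)"
      using DERIV_diff[OF d DERIV_chain2[OF d DERIV_minus[OF DERIV_ident]]] by simp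
    from DERIV_isconst_all[OF this, of t 0] show ?thesis by simp
  qed
  have z2: "\<alpha> t = 0" if "1 \<le> t" for t using z1[of "- t"] even[of t] that by simp
  show ?thesis
  proof (rule that)
    show "test_function \<alpha>"
    proof (rule test_functionI[OF C])
      show "bounded {-1..1::real}" by simp
      show "\<alpha> x = 0" if "x \<notin> {-1..1}" for x using z1[of x] z2[of x] that by force
    qed
  qed (use z2 d in auto)
qed

text \<open>The weight \<open>box_bump p q\<close> is positive exactly on the box, and test
  functions dominated by it vanish outside. Duality with the bound 0 therefore gives that the
  weighted integral of \<open>\<bar>w x\<bar>\<close> is 0.\<close>

lemma AE_eq_0_on_box:
  fixes w :: "'a::euclidean_space \<Rightarrow> real"
  assumes m: "w \<in> borel_measurable lebesgue" and i: "integrable lebesgue (\<lambda>x. box_bump p q x * w x)"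
    and z: "\<And>\<sigma>. test_function \<sigma> \<Longrightarrow> (\<And>x. x \<notin> box p q \<Longrightarrow> \<sigma> x = 0) \<Longrightarrow> (\<integral>x. \<sigma> x * w x \<partial>lebesgue) = 0"
  shows "AE x in lebesgue. x \<in> box p q \<longrightarrow> w x = 0"
proof -
  let ?g = "\<lambda>x. box_bump p q x * \<bar>w x\<bar>"
  have eq: "?g x = \<bar>box_bump p q x * w x\<bar>" for x using box_bump_nonneg[of p q x] by (simp add: abs_mult)
  have gi: "integrable lebesgue ?g" unfolding eq by (rule integrable_abs[OF i])
  have "(\<integral>x. ?g x \<partial>lebesgue) \<le> 0"
  proof (rule integral_abs_le_dual[OF test_function_box_bump box_bump_nonneg m i])
    fix \<sigma> :: "'a \<Rightarrow> real" assume ts: "test_function \<sigma>" and le: "\<And>x. \<bar>\<sigma> x\<bar> \<le> box_bump p q x"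
    have "\<sigma> x = 0" if "x \<notin> box p q" for x using le[of x] box_bump_eq_0_iff[of p q x] that by simp
    from z[OF ts this] show "(\<integral>x. \<sigma> x * w x \<partial>lebesgue) \<le> 0" by simp
  qed
  moreover have nn: "AE x in lebesgue. 0 \<le> ?g x" unfolding eq by simp
  then have "0 \<le> (\<integral>x. ?g x \<partial>lebesgue)" by (rule integral_nonneg_AE)
  ultimately have "(\<integral>x. ?g x \<partial>lebesgue) = 0" by linarith
  then have "AE x in lebesgue. ?g x = 0" using integral_nonneg_eq_0_iff_AE[OF gi nn] by blast
  then show ?thesis by (rule eventually_mono) (auto simp: box_bump_eq_0_iff)
qed

text \<open>Where the modulus is \<open>c\<close>, the equation is linear transport with velocity
  \<open>g c *\<^sub>R e\<close>. Tested with
  \<open>\<sigma> (z - t *\<^sub>R f) * \<alpha> t\<close>, whose spatial factor is constant along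
  characteristics, it says that the moving average of \<open>u\<close> is constant in time. First
  this holds for almost every time, then by weak-* continuity at the given time \<open>t1\<close>,
  and varying \<sigma> gives the pointwise statement.\<close>

lemma transport_along_characteristics:
  fixes u :: "'a::euclidean_space \<Rightarrow> real \<Rightarrow> 'b::euclidean_space" and u0 :: "'a \<Rightarrow> 'b"
  assumes u: "weakstar_continuous_in_time u"
    and Um: "(\<lambda>x. u (fst x) (snd x)) \<in> borel_measurable (lebesgue_on half_space)"
    and M: "AE x in lebesgue_on half_space. norm (u (fst x) (snd x)) \<le> M"
    and g: "continuous_on UNIV g"
    and u0: "u0 \<in> borel_measurable lebesgue" "\<And>z. norm (u0 z) \<le> M0"
    and weak: "\<And>\<phi>. test_function \<phi> \<Longrightarrow>
      (\<integral>x. (u (fst x) (snd x) \<bullet> j) * (frechet_derivative \<phi> (at x) (0, 1) +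
          g (norm (u (fst x) (snd x))) * frechet_derivative \<phi> (at x) (e, 0)) \<partial>lebesgue_on half_space)
      + (\<integral>z. (u0 z \<bullet> j) * \<phi> (z, 0) \<partial>lebesgue) = 0"
    and const: "AE x in lebesgue_on half_space. 0 < snd x \<and> snd x < 2 \<and>
      fst x \<in> box (p + (V * snd x) *\<^sub>R e) (q - (V * snd x) *\<^sub>R e) \<longrightarrow> norm (u (fst x) (snd x)) = c"
    and inside: "\<And>t x. 0 \<le> t \<Longrightarrow> t \<le> 1 \<Longrightarrow> x \<in> cbox p' q' \<Longrightarrow>
      x + (t * g c) *\<^sub>R e \<in> box (p + (V * t) *\<^sub>R e) (q - (V * t) *\<^sub>R e)"
    and t1: "0 < t1" "t1 < 1"
  shows "AE z in lebesgue. z \<in> box p' q' \<longrightarrow> u (z + (t1 * g c) *\<^sub>R e) t1 \<bullet> j = u0 z \<bullet> j"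
proof -
  define f where "f = g c *\<^sub>R e"
  let ?U = "\<lambda>x. u (fst x) (snd x)"
  have Ujm: "(\<lambda>x. ?U x \<bullet> j) \<in> borel_measurable (lebesgue_on half_space)"
    using borel_measurable_inner[OF Um borel_measurable_const] .
  have Mj: "AE x in lebesgue_on half_space. \<bar>?U x \<bullet> j\<bar> \<le> \<bar>M\<bar> * norm j"
    using M
  proof (rule eventually_mono)
    fix x assume "norm (?U x) \<le> M"
    then have "norm (?U x) * norm j \<le> \<bar>M\<bar> * norm j" by (intro mult_right_mono) auto
    then show "\<bar>?U x \<bullet> j\<bar> \<le> \<bar>M\<bar> * norm j" using Cauchy_Schwarz_ineq2[of "?U x" j] by linarith
  qed
  have um: "(\<lambda>z. u z t) \<in> borel_measurable lebesgue" if "0 \<le> t" for t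
    using u that by (simp add: weakstar_continuous_in_time_def)
  have main: "(\<integral>z. (u z t1 \<bullet> j) * \<sigma> (z - t1 *\<^sub>R f) \<partial>lebesgue) = (\<integral>z. (u0 z \<bullet> j) * \<sigma> z \<partial>lebesgue)"
    if s: "test_function \<sigma>" and supp: "\<And>x. x \<notin> box p' q' \<Longrightarrow> \<sigma> x = 0" for \<sigma> :: "'a \<Rightarrow> real"
  proof -
    define m where "m t = (\<integral>z. (u z t \<bullet> j) * \<sigma> (z - t *\<^sub>R f) \<partial>lebesgue)" for t
    define m0 where "m0 = (\<integral>z. (u0 z \<bullet> j) * \<sigma> z \<partial>lebesgue)"
    have mc: "continuous_on {0..} m"
      unfolding m_def[abs_def] by (rule continuous_on_moving_average[OF u s])
    have Cs: "C_k n \<sigma>" for n by (rule test_function_C_k[OF s])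
    obtain \<rho> where \<rho>: "\<rho> > 0" "\<And>x. \<rho> \<le> norm x \<Longrightarrow> \<sigma> x = 0" using test_function_support[OF s] by blast
    have Ds0: "frechet_derivative \<sigma> (at y) v = 0" if "y \<notin> cbox p' q'" for y v
    proof -
      have "((\<lambda>x. 0) has_derivative (\<lambda>h. 0)) (at y)" by simp
      then have "(\<sigma> has_derivative (\<lambda>h. 0)) (at y)"
      proof (rule has_derivative_transform_within_open)
        show "open (- cbox p' q')" by (intro open_Compl closed_cbox)
        show "y \<in> - cbox p' q'" using that by simp
        show "0 = \<sigma> x" if "x \<in> - cbox p' q'" for x
          using that box_subset_cbox[of p' q'] supp[of x] by auto
      qed
      from frechet_derivative_at[OF this] show ?thesis by metis
    qed
    \<comment> \<open>The weak form, integrated over space, of \<open>m' = 0\<close> with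
      \<open>m 0 = m0\<close>, tested with \<alpha>.\<close>
    have key: "integrable lebesgue (\<lambda>t. indicator {0..} t * \<alpha>' t * m t) \<and>
        (\<integral>t. indicator {0..} t * \<alpha>' t * m t \<partial>lebesgue) + \<alpha> 0 * m0 = 0"
      if a: "test_function \<alpha>" and a1: "\<And>t. 1 \<le> t \<Longrightarrow> \<alpha> t = 0"
        and d: "\<And>t. (\<alpha> has_real_derivative \<alpha>' t) (at t)" and c': "continuous_on UNIV \<alpha>'" for \<alpha> \<alpha>'
    proof -
      define \<phi> where "\<phi> x = \<sigma> (fst x - snd x *\<^sub>R f) * \<alpha> (snd x)" for x :: "'a \<times> real"
      have bl: "bounded_linear (\<lambda>x::'a \<times> real. fst x - snd x *\<^sub>R f)"
        by (intro bounded_linear_sub bounded_linear_fst bounded_linear_compose[OF bounded_linear_scaleR_left bounded_linear_snd])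
      have C: "C_k n \<phi>" for n
      proof -
        have "C_k n (\<lambda>x::'a \<times> real. \<sigma> (fst x - snd x *\<^sub>R f + 0))"
          by (rule C_k_compose_affine[OF bl Cs])
        moreover have "C_k n (\<lambda>x::'a \<times> real. \<alpha> (snd x + 0))"
          by (rule C_k_compose_affine[OF bounded_linear_snd test_function_C_k[OF a]])
        ultimately have "C_k n (\<lambda>x::'a \<times> real. \<sigma> (fst x - snd x *\<^sub>R f + 0) * \<alpha> (snd x + 0))"
          by (rule C_k_mult)
        then show ?thesis by (simp add: \<phi>_def[abs_def])
      qed
      obtain r where r: "r > 0" "\<And>t. r \<le> norm t \<Longrightarrow> \<alpha> t = 0" using test_function_support[OF a] by blast
      have t: "test_function \<phi>"
      proof (rule test_functionI[OF C])
        show "bounded (cball 0 (\<rho> + r * norm f) \<times> {-r..r} :: ('a \<times> real) set)" by (intro bounded_Times) auto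
        fix x :: "'a \<times> real" assume x: "x \<notin> cball 0 (\<rho> + r * norm f) \<times> {-r..r}"
        show "\<phi> x = 0"
        proof (cases "r \<le> \<bar>snd x\<bar>")
          case True
          then show ?thesis using r(2)[of "snd x"] by (simp add: \<phi>_def)
        next
          case False
          then have "norm (snd x *\<^sub>R f) \<le> r * norm f" by (simp add: mult_right_mono)
          moreover have "\<rho> + r * norm f < norm (fst x)" using x False by (cases x) auto
          ultimately have "\<rho> \<le> norm (fst x - snd x *\<^sub>R f)"
            using norm_triangle_ineq2[of "fst x" "snd x *\<^sub>R f"] by linarith
          then show ?thesis using \<rho>(2) by (simp add: \<phi>_def)
        qed
      qed
      have Dt: "frechet_derivative \<phi> (at (z, t)) (0, 1) =
          - frechet_derivative \<sigma> (at (z - t *\<^sub>R f)) f * \<alpha> t + \<alpha>' t * \<sigma> (z - t *\<^sub>R f)" for z t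
      proof -
        have "((\<lambda>t. \<phi> (z, t)) has_real_derivative frechet_derivative \<phi> (at (z, t)) (0, 1)) (at t)"
          using C_k_line_derivative'[OF C, of "(z, 0)" "(0, 1)" t] by simp
        moreover have "((\<lambda>t. \<phi> (z, t)) has_real_derivative
            - frechet_derivative \<sigma> (at (z - t *\<^sub>R f)) f * \<alpha> t + \<alpha>' t * \<sigma> (z - t *\<^sub>R f)) (at t)"
          unfolding \<phi>_def fst_conv snd_conv by (rule DERIV_mult[OF C_k_line_derivative[OF Cs] d])
        ultimately show ?thesis by (rule DERIV_unique)
      qed
      have De: "frechet_derivative \<phi> (at (z, t)) (e, 0) = frechet_derivative \<sigma> (at (z - t *\<^sub>R f)) e * \<alpha> t" for z t
      proof -
        have "((\<lambda>s. \<phi> (z + s *\<^sub>R e, t)) has_real_derivative frechet_derivative \<phi> (at (z, t)) (e, 0)) (at 0)"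
          using C_k_line_derivative'[OF C, of "(z, t)" "(e, 0)" 0] by simp
        moreover have "((\<lambda>s. \<phi> (z + s *\<^sub>R e, t)) has_real_derivative frechet_derivative \<sigma> (at (z - t *\<^sub>R f)) e * \<alpha> t) (at 0)"
        proof -
          have "((\<lambda>s. \<sigma> ((z - t *\<^sub>R f) + s *\<^sub>R e)) has_real_derivative frechet_derivative \<sigma> (at (z - t *\<^sub>R f)) e) (at 0)"
            using C_k_line_derivative'[OF Cs, of "z - t *\<^sub>R f" e 0] by simp
          from DERIV_cmult_right[OF this, of "\<alpha> t"] show ?thesis
            by (simp add: \<phi>_def algebra_simps)
        qed
        ultimately show ?thesis by (rule DERIV_unique)
      qed
      have Df: "frechet_derivative \<sigma> (at y) f = g c * frechet_derivative \<sigma> (at y) e" for y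
      proof -
        have lin: "linear (frechet_derivative \<sigma> (at y))"
          using test_function_has_derivative[OF s] has_derivative_linear by blast
        show ?thesis unfolding f_def by (simp add: linear_scale[OF lin])
      qed
      have a'1: "\<alpha>' t = 0" if "1 < t" for t by (rule half_line_integral_derivative(1)[OF d c' a1 that])
      let ?K = "\<lambda>x. (?U x \<bullet> j) * (\<alpha>' (snd x) * \<sigma> (fst x - snd x *\<^sub>R f))"
      have ae: "AE x in lebesgue_on half_space. (?U x \<bullet> j) * (frechet_derivative \<phi> (at x) (0, 1) +
          g (norm (?U x)) * frechet_derivative \<phi> (at x) (e, 0)) = ?K x"
        using const AE_half_space_time_nonzero
      proof eventually_elim
        case (elim x)
        obtain z t where x: "x = (z, t)" by (cases x)
        have t0: "0 < t" using elim(2) x by simp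
        let ?y = "z - t *\<^sub>R f"
        \<comment> \<open>For \<open>t > 1\<close> the time factor and its derivative vanish, and
          off \<open>cbox p' q'\<close> the spatial factor and its derivatives do. In the remaining
          region \<open>inside\<close> puts the point into the cone, so the modulus is
          \<open>c\<close> and the derivatives of \<sigma> along and against the flow
          cancel.\<close>
        consider "1 < t" | "?y \<notin> cbox p' q'" | "t \<le> 1" "?y \<in> cbox p' q'" by linarith
        then show ?case
        proof cases
          case 1
          then show ?thesis using a1[of t] a'1[of t] by (simp add: x Dt De)
        next
          case 2
          then show ?thesis by (simp add: x Dt De Ds0)
        next
          case 3
          have "?y + (t * g c) *\<^sub>R e \<in> box (p + (V * t) *\<^sub>R e) (q - (V * t) *\<^sub>R e)"
            using inside[of t ?y] t0 3 by simp
          then have "z \<in> box (p + (V * t) *\<^sub>R e) (q - (V * t) *\<^sub>R e)" by (simp add: f_def)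
          then have "norm (u z t) = c" using elim(1) t0 3 x by simp
          then show ?thesis by (simp add: x Dt De Df algebra_simps)
        qed
      qed
      have K: "(\<lambda>x. \<alpha>' (snd x) * \<sigma> (fst x - snd x *\<^sub>R f)) = (\<lambda>x. frechet_derivative \<phi> (at x) (0, 1) + g c * frechet_derivative \<phi> (at x) (e, 0))"
        by (auto simp: fun_eq_iff Dt De Df)
      obtain R where R: "\<And>x v. R < norm x \<Longrightarrow> frechet_derivative \<phi> (at x) v = 0"
        and cD: "\<And>v. continuous_on UNIV (\<lambda>x. frechet_derivative \<phi> (at x) v)"
        using test_function_frechet_derivative[OF t] by metis
      have Kint: "integrable (lebesgue_on half_space) ?K"
      proof (rule integrable_half_space_times[OF Ujm Mj])
        show "continuous_on UNIV (\<lambda>x. \<alpha>' (snd x) * \<sigma> (fst x - snd x *\<^sub>R f))"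
          unfolding K by (intro continuous_intros cD)
        show "\<alpha>' (snd x) * \<sigma> (fst x - snd x *\<^sub>R f) = 0" if "R < norm x" for x
          using fun_cong[OF K, of x] R[OF that] by simp
      qed
      let ?F = "\<lambda>x. indicator half_space x * ?K x"
      have Fi: "integrable lebesgue ?F" using Kint by (simp add: integral_half_space)
      have Fm: "(\<lambda>z. ?F (z, t)) \<in> borel_measurable lebesgue" for t
      proof (cases "0 \<le> t")
        case True
        have "(\<lambda>z. (u z t \<bullet> j) * (\<alpha>' t * \<sigma> (z - t *\<^sub>R f))) \<in> borel_measurable lebesgue"
          by (intro borel_measurable_times borel_measurable_inner um[OF True] borel_measurable_const
              continuous_on_UNIV_lebesgue_measurable[OF C_k_imp_continuous_on[OF test_function_C_k[OF test_function_shift[OF s]]]])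
        then show ?thesis using True by simp
      qed simp
      have inner: "(\<integral>z. ?F (z, t) \<partial>lebesgue) = indicator {0..} t * \<alpha>' t * m t" for t
      proof -
        have "?F (z, t) = (indicator {0..} t * \<alpha>' t) * ((u z t \<bullet> j) * \<sigma> (z - t *\<^sub>R f))" for z
          by (simp add: indicator_def)
        then show ?thesis unfolding m_def by (simp only: integral_mult_right_zero)
      qed
      have 1: "integrable lebesgue (\<lambda>t. indicator {0..} t * \<alpha>' t * m t)"
        using lebesgue_Fubini(1)[OF Fi Fm] unfolding inner .
      have "(\<integral>x. ?K x \<partial>lebesgue_on half_space) = (\<integral>t. indicator {0..} t * \<alpha>' t * m t \<partial>lebesgue)"
        unfolding integral_half_space(1) lebesgue_Fubini(2)[OF Fi Fm] inner ..
      moreover have "(\<integral>x. (?U x \<bullet> j) * (frechet_derivative \<phi> (at x) (0, 1) +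
          g (norm (?U x)) * frechet_derivative \<phi> (at x) (e, 0)) \<partial>lebesgue_on half_space) = (\<integral>x. ?K x \<partial>lebesgue_on half_space)"
      proof (rule integral_cong_AE[OF _ borel_measurable_integrable[OF Kint] ae])
        have dm: "(\<lambda>x. frechet_derivative \<phi> (at x) v) \<in> borel_measurable (lebesgue_on half_space)" for v
          using continuous_on_UNIV_lebesgue_measurable[OF cD] by (rule measurable_restrict_space1)
        have gm: "(\<lambda>x. g (norm (?U x))) \<in> borel_measurable (lebesgue_on half_space)"
          using measurable_compose[OF measurable_compose[OF Um borel_measurable_norm] borel_measurable_continuous_onI[OF g]] .
        show "(\<lambda>x. (?U x \<bullet> j) * (frechet_derivative \<phi> (at x) (0, 1) +
            g (norm (?U x)) * frechet_derivative \<phi> (at x) (e, 0))) \<in> borel_measurable (lebesgue_on half_space)"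
          by (intro borel_measurable_times borel_measurable_add dm gm Ujm)
      qed
      moreover have "(\<integral>z. (u0 z \<bullet> j) * \<phi> (z, 0) \<partial>lebesgue) = \<alpha> 0 * m0"
      proof -
        have "(u0 z \<bullet> j) * \<phi> (z, 0) = \<alpha> 0 * ((u0 z \<bullet> j) * \<sigma> z)" for z by (simp add: \<phi>_def)
        then show ?thesis unfolding m0_def by (simp only: integral_mult_right_zero)
      qed
      ultimately show ?thesis using weak[OF t] 1 by simp
    qed
    define w where "w t = indicator {0..1} t * (m t - m0)" for t
    have mc1: "continuous_on {0..1} (\<lambda>t. m t - m0)"
      by (intro continuous_intros continuous_on_subset[OF mc]) auto
    have wi: "integrable lborel w"
      using borel_integrable_compact[OF compact_Icc mc1] by (simp add: w_def[abs_def])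
    have wm: "w \<in> borel_measurable lebesgue"
      using wi by (intro measurable_completion) auto
    \<comment> \<open>On \<open>t > 0\<close> the derivative of \<alpha> is \<tau>. By
      \<open>key\<close> the integral of that derivative times \<open>m\<close> is
      \<open>- \<alpha> 0 * m0\<close>, which is also its integral times \<open>m0\<close>; the
      difference is the claim.\<close>
    have zero: "(\<integral>t. \<tau> t * w t \<partial>lebesgue) = 0"
      if ts: "test_function \<tau>" and tsupp: "\<And>t. t \<notin> {0<..<1} \<Longrightarrow> \<tau> t = 0" for \<tau>
    proof -
      obtain \<alpha> where a: "test_function \<alpha>" "\<And>t. 1 \<le> t \<Longrightarrow> \<alpha> t = 0"
        "\<And>t. (\<alpha> has_real_derivative \<tau> t - \<tau> (- t)) (at t)"
        using odd_antiderivative[OF ts tsupp] by blast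
      have ct: "continuous_on UNIV \<tau>" by (rule C_k_imp_continuous_on[OF test_function_C_k[OF ts]])
      have cd: "continuous_on UNIV (\<lambda>t. \<tau> t - \<tau> (- t))"
        by (intro continuous_intros ct continuous_on_compose2[OF ct]) auto
      note k = key[OF a cd] and h = half_line_integral_derivative[OF a(3) cd a(2)]
      have "\<tau> t * w t = indicator {0..} t * (\<tau> t - \<tau> (- t)) * m t - indicator {0..} t * (\<tau> t - \<tau> (- t)) * m0" for t
      proof (cases "0 \<le> t")
        case True
        then have "\<tau> (- t) = 0" by (intro tsupp) auto
        moreover have "\<tau> t = 0" if "1 < t" using that by (intro tsupp) auto
        ultimately show ?thesis using True by (cases "t \<le> 1") (auto simp: w_def algebra_simps)
      qed (simp add: w_def)
      then have "(\<integral>t. \<tau> t * w t \<partial>lebesgue) =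
          (\<integral>t. indicator {0..} t * (\<tau> t - \<tau> (- t)) * m t - indicator {0..} t * (\<tau> t - \<tau> (- t)) * m0 \<partial>lebesgue)" by (simp only:)
      also have "\<dots> = (\<integral>t. indicator {0..} t * (\<tau> t - \<tau> (- t)) * m t \<partial>lebesgue) - (\<integral>t. indicator {0..} t * (\<tau> t - \<tau> (- t)) * m0 \<partial>lebesgue)"
        using k h(2) by (intro Bochner_Integration.integral_diff integrable_mult_left) auto
      also have "\<dots> = 0"
        unfolding integral_mult_left_zero using k h(3) by (metis add.commute diff_conv_add_uminus mult_minus_left minus_minus)
      finally show ?thesis .
    qed
    have "AE t in lebesgue. t \<in> box 0 1 \<longrightarrow> w t = 0"
    proof (rule AE_eq_0_on_box[OF wm _ zero])
      have "integrable lebesgue w" using wi by (simp add: integrable_completion)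
      then show "integrable lebesgue (\<lambda>t. box_bump 0 1 t * w t)"
      proof (rule Bochner_Integration.integrable_bound)
        show "(\<lambda>t. box_bump 0 1 t * w t) \<in> borel_measurable lebesgue"
          by (intro borel_measurable_times wm continuous_on_UNIV_lebesgue_measurable[OF C_k_imp_continuous_on[OF C_k_box_bump]])
        show "AE t in lebesgue. norm (box_bump 0 1 t * w t) \<le> norm (w t)"
          using box_bump_le_1[of 0 "1::real"] box_bump_nonneg[of 0 "1::real"] by (simp add: abs_mult mult_left_le_one_le)
      qed
    qed simp_all
    then have ae0: "AE t in lebesgue. t \<notin> {0<..<1} \<inter> m -` (- {m0})"
      by (rule eventually_mono) (auto simp: w_def)
    \<comment> \<open>Passage from almost every time to every time: the exceptional set is open by
      continuity of \<open>m\<close>, and an open null set is empty.\<close>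
    have "open ({0<..<1} \<inter> m -` (- {m0}))"
      by (rule continuous_open_preimage[OF continuous_on_subset[OF mc]]) auto
    moreover from this have "negligible ({0<..<1} \<inter> m -` (- {m0}))"
      using ae0 by (simp add: negligible_iff_null_sets AE_iff_null_sets borel_open)
    ultimately have "{0<..<1} \<inter> m -` (- {m0}) = {}" using open_not_negligible by blast
    then have "m t1 = m0" using t1 by auto
    then show ?thesis by (simp add: m_def m0_def)
  qed
  \<comment> \<open>Now time is fixed and \<sigma> varies: all averages of the difference over the
    box vanish.\<close>
  define w where "w z = u (z + t1 *\<^sub>R f) t1 \<bullet> j - u0 z \<bullet> j" for z
  have ut: "(\<lambda>z. u z t1 \<bullet> j) \<in> borel_measurable lebesgue"
    using t1 by (intro borel_measurable_inner um borel_measurable_const) auto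
  have m1: "(\<lambda>z. u (z + t1 *\<^sub>R f) t1 \<bullet> j) \<in> borel_measurable lebesgue"
    using lebesgue_measurable_shift[OF ut, of "t1 *\<^sub>R f"] by (simp only: add.commute)
  have m2: "(\<lambda>z. u0 z \<bullet> j) \<in> borel_measurable lebesgue"
    by (intro borel_measurable_inner u0(1) borel_measurable_const)
  obtain M' where "\<And>t. 0 \<le> t \<Longrightarrow> AE z in lebesgue. norm (u z t) \<le> M'"
    using u by (auto simp: weakstar_continuous_in_time_def)
  then have "AE z in lebesgue. norm (u z t1) \<le> M'" using t1 by simp
  then have "AE z in lebesgue. norm (u (t1 *\<^sub>R f + z) t1) \<le> M'" by (rule AE_lebesgue_shift)
  then have b1: "AE z in lebesgue. \<bar>u (z + t1 *\<^sub>R f) t1 \<bullet> j\<bar> \<le> \<bar>M'\<bar> * norm j"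
  proof (rule eventually_mono)
    fix z assume "norm (u (t1 *\<^sub>R f + z) t1) \<le> M'"
    then have "norm (u (z + t1 *\<^sub>R f) t1) * norm j \<le> \<bar>M'\<bar> * norm j"
      by (intro mult_right_mono) (auto simp: add.commute)
    then show "\<bar>u (z + t1 *\<^sub>R f) t1 \<bullet> j\<bar> \<le> \<bar>M'\<bar> * norm j"
      using Cauchy_Schwarz_ineq2[of "u (z + t1 *\<^sub>R f) t1" j] by linarith
  qed
  have b2: "AE z in lebesgue. \<bar>u0 z \<bullet> j\<bar> \<le> M0 * norm j"
    using Cauchy_Schwarz_ineq2[of _ j] mult_right_mono[OF u0(2) norm_ge_zero[of j]] order_trans by (intro AE_I2) blast
  note i1 = integrable_times_test_function[OF m1 b1] and i2 = integrable_times_test_function[OF m2 b2]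
  have wm: "w \<in> borel_measurable lebesgue" unfolding w_def[abs_def] by (rule borel_measurable_diff[OF m1 m2])
  have "AE z in lebesgue. z \<in> box p' q' \<longrightarrow> w z = 0"
  proof (rule AE_eq_0_on_box[OF wm])
    show "integrable lebesgue (\<lambda>z. box_bump p' q' z * w z)"
      using Bochner_Integration.integrable_diff[OF i1 i2, OF test_function_box_bump test_function_box_bump, of p' q' p' q']
      by (simp add: w_def algebra_simps)
    fix \<sigma> :: "'a \<Rightarrow> real" assume s: "test_function \<sigma>" and supp: "\<And>x. x \<notin> box p' q' \<Longrightarrow> \<sigma> x = 0"
    have "(\<lambda>z. (u z t1 \<bullet> j) * \<sigma> (z - t1 *\<^sub>R f)) \<in> borel_measurable lebesgue"
      by (intro borel_measurable_times ut
          continuous_on_UNIV_lebesgue_measurable[OF C_k_imp_continuous_on[OF test_function_C_k[OF test_function_shift[OF s]]]])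
    from lebesgue_integral_shift[OF this, of "t1 *\<^sub>R f"]
    have "(\<integral>z. (u (z + t1 *\<^sub>R f) t1 \<bullet> j) * \<sigma> z \<partial>lebesgue) = (\<integral>z. (u0 z \<bullet> j) * \<sigma> z \<partial>lebesgue)"
      using main[OF s supp] by (simp add: add.commute)
    then show "(\<integral>z. \<sigma> z * w z \<partial>lebesgue) = 0"
      using Bochner_Integration.integral_diff[OF i1[OF s] i2[OF s]] by (simp add: w_def algebra_simps)
  qed
  then show ?thesis by (rule eventually_mono) (auto simp: w_def f_def)
qed

lemma BV_loc_shift_integrable:
  fixes v \<theta> :: "'a::euclidean_space \<Rightarrow> real"
  assumes v: "BV_loc v" and t: "test_function \<theta>" and nn: "\<And>x. 0 \<le> \<theta> x"
  shows "integrable lebesgue (\<lambda>x. \<theta> x * \<bar>v (x + a) - v x\<bar>)"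
proof -
  have loc: "loc_integrable v" using v by (simp add: BV_loc_def loc_integrable_def)
  have int: "integrable lebesgue (\<lambda>x. v x * s x)" if ts: "test_function s" for s :: "'a \<Rightarrow> real"
  proof -
    obtain r where r: "\<And>x. r \<le> norm x \<Longrightarrow> s x = 0" using test_function_support[OF ts] by blast
    show ?thesis
      by (rule loc_integrable_times[OF loc C_k_imp_continuous_on[OF test_function_C_k[OF ts]] compact_cball[of 0 r]])
        (use r in auto)
  qed
  have "integrable lebesgue (\<lambda>x. v (a + x) * \<theta> ((a + x) - a))"
    by (rule lebesgue_integrable_shift[OF int[OF test_function_shift[OF t]]])
  from Bochner_Integration.integrable_diff[OF this int[OF t]]
  have "integrable lebesgue (\<lambda>x. \<bar>v (a + x) * \<theta> ((a + x) - a) - v x * \<theta> x\<bar>)" by (rule integrable_abs)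
  moreover have "\<bar>v (a + x) * \<theta> ((a + x) - a) - v x * \<theta> x\<bar> = \<theta> x * \<bar>v (x + a) - v x\<bar>" for x
  proof -
    have "v (a + x) * \<theta> ((a + x) - a) - v x * \<theta> x = \<theta> x * (v (x + a) - v x)" by (simp add: algebra_simps)
    then show ?thesis using nn[of x] by (simp only: abs_mult abs_of_nonneg)
  qed
  ultimately show ?thesis by (simp only:)
qed

lemma C1_imp_locally_lipschitz:
  fixes f :: "real \<Rightarrow> real"
  assumes d: "\<And>x. (f has_real_derivative f' x) (at x)" and c: "continuous_on UNIV f'"
  shows "\<exists>V\<ge>0. \<forall>x\<in>{a..b}. \<forall>y\<in>{a..b}. \<bar>f x - f y\<bar> \<le> V * \<bar>x - y\<bar>"
proof -
  have "bounded (f' ` {a..b})"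
    by (intro compact_imp_bounded compact_continuous_image continuous_on_subset[OF c]) auto
  then obtain B where B: "\<forall>y\<in>f' ` {a..b}. norm y \<le> B" unfolding bounded_iff by blast
  have "\<bar>f x - f y\<bar> \<le> \<bar>B\<bar> * \<bar>x - y\<bar>" if xy: "x \<in> {a..b}" "y \<in> {a..b}" for x y
  proof -
    have "norm (f x - f y) \<le> \<bar>B\<bar> * norm (x - y)"
    proof (rule field_differentiable_bound[OF _ _ _ xy])
      show "convex {a..b}" by simp
      show "(f has_field_derivative f' z) (at z within {a..b})" for z
        by (rule has_field_derivative_at_within[OF d])
      show "norm (f' z) \<le> \<bar>B\<bar>" if "z \<in> {a..b}" for z
      proof -
        have "norm (f' z) \<le> B" using B that by blast
        then show ?thesis by linarith
      qed
    qed
    then show ?thesis by simp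
  qed
  then show ?thesis by (intro exI[of _ "\<bar>B\<bar>"]) auto
qed

lemma renormalized_solution_transported:
  fixes u :: "'a::euclidean_space \<Rightarrow> real \<Rightarrow> 'b::euclidean_space" and u0 :: "'a \<Rightarrow> 'b"
  assumes u: "renormalized_entropy_solution (\<lambda>r. g r *\<^sub>R e) u0 u" and e: "e \<in> Basis"
    and u0: "u0 \<in> borel_measurable lebesgue" "\<And>z. norm (u0 z) \<le> A"
    and g: "continuous_on UNIV g"
    and lip: "\<And>K. \<exists>V\<ge>0. \<forall>x\<in>{-K..K}. \<forall>y\<in>{-K..K}. \<bar>x * g x - y * g y\<bar> \<le> V * \<bar>x - y\<bar>"
    and V: "0 \<le> V" "\<And>x y. x \<in> {0..A} \<Longrightarrow> y \<in> {0..A} \<Longrightarrow> \<bar>x * g x - y * g y\<bar> \<le> V * \<bar>x - y\<bar>"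
    and c: "c \<in> {0..A}" "\<And>z. z \<in> box p q \<Longrightarrow> norm (u0 z) = c"
    and inside: "\<And>t x. 0 \<le> t \<Longrightarrow> t \<le> 1 \<Longrightarrow> x \<in> cbox p' q' \<Longrightarrow>
      x + (t * g c) *\<^sub>R e \<in> box (p + (V * t) *\<^sub>R e) (q - (V * t) *\<^sub>R e)"
    and t: "0 < t" "t < 1"
  shows "AE z in lebesgue. z \<in> box p' q' \<longrightarrow> u (z + (t * g c) *\<^sub>R e) t \<bullet> j = u0 z \<bullet> j"
proof -
  have wc: "weakstar_continuous_in_time u"
    and k: "kruzhkov_entropy_solution (\<lambda>r. (r * g r) *\<^sub>R e) (\<lambda>z. norm (u0 z)) (\<lambda>z t. norm (u z t))"
    and w: "weak_transport_solution (\<lambda>r. g r *\<^sub>R e) (\<lambda>z. norm (u0 z)) (\<lambda>z t. norm (u z t))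
      (\<lambda>z. sgn (u0 z)) (\<lambda>z t. sgn (u z t))"
    using u by (simp_all add: renormalized_entropy_solution_def)
  have F: "continuous_on UNIV (\<lambda>r. r * g r)" by (intro continuous_intros g)
  have n0: "(\<lambda>z. norm (u0 z)) \<in> borel_measurable lebesgue" by (rule measurable_compose[OF u0(1) borel_measurable_norm])
  have max: "AE x in lebesgue_on half_space. norm (u (fst x) (snd x)) \<le> A"
    by (rule maximum_principle[OF k e _ n0 _ _ F lip]) (use u0 in auto)
  \<comment> \<open>The cone has height 2, so that times up to 1, where the transport argument takes
    place, stay below its top.\<close>
  have const: "AE x in lebesgue_on half_space. 0 < snd x \<and> snd x < 2 \<and>
      fst x \<in> box (p + (V * snd x) *\<^sub>R e) (q - (V * snd x) *\<^sub>R e) \<longrightarrow> norm (u (fst x) (snd x)) = c"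
    by (rule entropy_solution_locally_constant[OF k e _ max F c(1) V c(2)]) auto
  note W = weak_transport_solution_component[OF w kruzhkov_entropy_solutionD(1)[OF k] max g u0]
  show ?thesis
    by (rule transport_along_characteristics[OF wc W(1) max g u0 W(2) const inside t])
qed

subsection \<open>The initial data\<close>

text \<open>A shift by \<open>h\<close> along \<open>e\<close> changes membership in the box only
  for points within distance \<open>h\<close> below one of the two faces orthogonal to
  \<open>e\<close>. Each of these two layers has volume \<open>h\<close> times the area of the face;
  this is also valid when \<open>h\<close> exceeds the width of the box.\<close>

lemma shift_variation_box:
  fixes p q :: "'a::euclidean_space"
  assumes e: "e \<in> Basis" and pq: "\<And>i. i \<in> Basis \<Longrightarrow> p \<bullet> i \<le> q \<bullet> i"
  shows "shift_variation_le e (indicator (box p q) :: 'a \<Rightarrow> real) (2 * (\<Prod>i\<in>Basis - {e}. (q - p) \<bullet> i))"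
  unfolding shift_variation_le_def
proof (intro allI impI)
  fix h :: real assume h: "0 < h"
  let ?P = "\<Prod>i\<in>Basis - {e}. (q - p) \<bullet> i"
  \<comment> \<open>\<open>q1\<close> is the upper corner of the lower face orthogonal to
    \<open>e\<close> and \<open>p2\<close> the lower corner of the upper face; \<open>?A\<close> and
    \<open>?B\<close> are these faces thickened downwards by \<open>h\<close>.\<close>
  define q1 where "q1 = q - ((q - p) \<bullet> e) *\<^sub>R e"
  define p2 where "p2 = p + ((q - p) \<bullet> e) *\<^sub>R e"
  have q1: "q1 \<bullet> i = (if i = e then p \<bullet> e else q \<bullet> i)" and p2: "p2 \<bullet> i = (if i = e then q \<bullet> e else p \<bullet> i)" if "i \<in> Basis" for i
    using that e by (auto simp: q1_def p2_def inner_diff_left inner_add_left inner_Basis)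
  have he: "(x + h *\<^sub>R e) \<bullet> i = (if i = e then x \<bullet> e + h else x \<bullet> i)"
    and he': "(x - h *\<^sub>R e) \<bullet> i = (if i = e then x \<bullet> e - h else x \<bullet> i)" if "i \<in> Basis" for i x
    using that e by (auto simp: inner_diff_left inner_add_left inner_Basis)
  let ?A = "cbox (p - h *\<^sub>R e) q1" and ?B = "cbox (p2 - h *\<^sub>R e) q"
  have vol: "emeasure lborel (cbox (x - h *\<^sub>R e) y) = ennreal (h * ?P)"
    if "x \<bullet> e = y \<bullet> e" "\<And>i. i \<in> Basis - {e} \<Longrightarrow> x \<bullet> i = p \<bullet> i \<and> y \<bullet> i = q \<bullet> i" for x y :: 'a
  proof -
    have "(x - h *\<^sub>R e) \<bullet> i \<le> y \<bullet> i" if "i \<in> Basis" for i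
      using that \<open>x \<bullet> e = y \<bullet> e\<close> \<open>\<And>i. i \<in> Basis - {e} \<Longrightarrow> x \<bullet> i = p \<bullet> i \<and> y \<bullet> i = q \<bullet> i\<close>[of i] h pq[of i]
      by (auto simp: he')
    then have "emeasure lborel (cbox (x - h *\<^sub>R e) y) = ennreal (\<Prod>i\<in>Basis. (y - (x - h *\<^sub>R e)) \<bullet> i)"
      by (rule emeasure_lborel_cbox)
    also have "(\<Prod>i\<in>Basis. (y - (x - h *\<^sub>R e)) \<bullet> i) = (y - (x - h *\<^sub>R e)) \<bullet> e * (\<Prod>i\<in>Basis - {e}. (y - (x - h *\<^sub>R e)) \<bullet> i)"
      using e by (simp add: prod.remove)
    also have "(y - (x - h *\<^sub>R e)) \<bullet> e = h"
      using that(1) e he'[OF e, of x] by (simp add: inner_diff_left)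
    also have "(\<Prod>i\<in>Basis - {e}. (y - (x - h *\<^sub>R e)) \<bullet> i) = ?P"
      using that(2) he' by (intro prod.cong) (auto simp: inner_diff_left)
    finally show ?thesis .
  qed
  have "ennreal (norm (indicator (box p q) (x + h *\<^sub>R e) - indicator (box p q) x :: real)) \<le> indicator ?A x + indicator ?B x" for x
  proof (cases "x \<in> box p q \<longleftrightarrow> x + h *\<^sub>R e \<in> box p q")
    case False
    have "x \<in> ?A \<or> x \<in> ?B"
    proof (cases "x \<in> box p q")
      case True
      with False have nb: "x + h *\<^sub>R e \<notin> box p q" by simp
      have b: "p \<bullet> i < x \<bullet> i \<and> x \<bullet> i < q \<bullet> i" if "i \<in> Basis" for i using True that by (simp add: mem_box)
      have "q \<bullet> e \<le> x \<bullet> e + h"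
      proof (rule ccontr)
        assume "\<not> q \<bullet> e \<le> x \<bullet> e + h"
        then have "p \<bullet> i < (x + h *\<^sub>R e) \<bullet> i \<and> (x + h *\<^sub>R e) \<bullet> i < q \<bullet> i" if "i \<in> Basis" for i
          using b[OF that] h he[OF that, of x] by (cases "i = e") auto
        then have "x + h *\<^sub>R e \<in> box p q" by (simp add: mem_box)
        with nb show False by simp
      qed
      then have "(p2 - h *\<^sub>R e) \<bullet> i \<le> x \<bullet> i \<and> x \<bullet> i \<le> q \<bullet> i" if "i \<in> Basis" for i
        using b[OF that] p2[OF that] he'[OF that, of p2] by (cases "i = e") auto
      then show ?thesis by (simp add: mem_box)
    next
      case nx: False
      with False have "x + h *\<^sub>R e \<in> box p q" by simp
      then have b: "p \<bullet> i < (x + h *\<^sub>R e) \<bullet> i \<and> (x + h *\<^sub>R e) \<bullet> i < q \<bullet> i" if "i \<in> Basis" for i using that by (simp add: mem_box)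
      have be: "p \<bullet> e - h < x \<bullet> e" "x \<bullet> e < q \<bullet> e" using b[OF e] he[OF e, of x] h by auto
      have "x \<bullet> e \<le> p \<bullet> e"
      proof (rule ccontr)
        assume "\<not> x \<bullet> e \<le> p \<bullet> e"
        then have "p \<bullet> i < x \<bullet> i \<and> x \<bullet> i < q \<bullet> i" if "i \<in> Basis" for i
          using be b[OF that] he[OF that, of x] by (cases "i = e") auto
        then have "x \<in> box p q" by (simp add: mem_box)
        with nx show False by simp
      qed
      then have "(p - h *\<^sub>R e) \<bullet> i \<le> x \<bullet> i \<and> x \<bullet> i \<le> q1 \<bullet> i" if "i \<in> Basis" for i
        using be b[OF that] he[OF that, of x] he'[OF that, of p] q1[OF that] by (cases "i = e") auto
      then show ?thesis by (simp add: mem_box)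
    qed
    then show ?thesis using False by (auto simp: indicator_def)
  qed (auto simp: indicator_def)
  then have "(\<integral>\<^sup>+x. ennreal (norm (indicator (box p q) (x + h *\<^sub>R e) - indicator (box p q) x :: real)) \<partial>lebesgue)
      \<le> (\<integral>\<^sup>+x. indicator ?A x + indicator ?B x \<partial>lebesgue)"
    by (intro nn_integral_mono) simp
  also have "\<dots> = emeasure lborel ?A + emeasure lborel ?B"
  proof -
    have "(indicator S :: 'a \<Rightarrow> ennreal) \<in> borel_measurable lebesgue" and "(\<integral>\<^sup>+x. indicator S x \<partial>lebesgue) = emeasure lborel S"
      if "S \<in> sets lborel" for S :: "'a set"
      using that by (auto intro: measurable_completion)
    then show ?thesis by (subst nn_integral_add) auto
  qed
  also have "\<dots> = ennreal (h * ?P) + ennreal (h * ?P)"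
    by (subst (1 2) vol) (use q1 p2 e in auto)
  also have "\<dots> = ennreal (2 * ?P * h)"
  proof -
    have "0 \<le> ?P" using pq by (intro prod_nonneg) (auto simp: inner_diff_left)
    then show ?thesis using h by (simp add: ennreal_plus[symmetric] del: ennreal_plus)
  qed
  finally show "(\<integral>\<^sup>+x. ennreal (norm (indicator (box p q) (x + h *\<^sub>R e) - indicator (box p q) x :: real)) \<partial>lebesgue) \<le> ennreal (2 * ?P * h)" .
qed

text \<open>If a shift changes membership in the union, it changes membership in some
  \<open>B k\<close>, so the indicator differences are subadditive.\<close>

lemma shift_variation_Union:
  fixes B :: "'i \<Rightarrow> 'a::euclidean_space set"
  assumes I: "finite I" and B: "\<And>k. k \<in> I \<Longrightarrow> B k \<in> sets lebesgue" "\<And>k. k \<in> I \<Longrightarrow> 0 \<le> C k"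
    and sv: "\<And>k. k \<in> I \<Longrightarrow> shift_variation_le e (indicator (B k) :: 'a \<Rightarrow> real) (C k)"
  shows "shift_variation_le e (indicator (\<Union>k\<in>I. B k) :: 'a \<Rightarrow> real) (\<Sum>k\<in>I. C k)"
  unfolding shift_variation_le_def
proof (intro allI impI)
  fix h :: real assume h: "0 < h"
  let ?D = "\<lambda>A x. ennreal (norm (indicator A (x + h *\<^sub>R e) - indicator A x :: real))"
  have "?D (\<Union>k\<in>I. B k) x \<le> (\<Sum>k\<in>I. ?D (B k) x)" for x
  proof (cases "x \<in> (\<Union>k\<in>I. B k) \<longleftrightarrow> x + h *\<^sub>R e \<in> (\<Union>k\<in>I. B k)")
    case False
    then obtain k where "k \<in> I" "x \<in> B k \<longleftrightarrow> x + h *\<^sub>R e \<notin> B k" by blast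
    then have "1 \<le> ?D (B k) x" by (auto simp: indicator_def)
    also have "\<dots> \<le> (\<Sum>k\<in>I. ?D (B k) x)" using \<open>k \<in> I\<close> I by (intro member_le_sum) auto
    finally show ?thesis using False by (auto simp: indicator_def)
  qed (auto simp: indicator_def)
  then have "(\<integral>\<^sup>+x. ?D (\<Union>k\<in>I. B k) x \<partial>lebesgue) \<le> (\<integral>\<^sup>+x. (\<Sum>k\<in>I. ?D (B k) x) \<partial>lebesgue)"
    by (intro nn_integral_mono) simp
  also have "\<dots> = (\<Sum>k\<in>I. \<integral>\<^sup>+x. ?D (B k) x \<partial>lebesgue)"
  proof (rule nn_integral_sum)
    fix k assume k: "k \<in> I"
    have 1: "(indicator (B k) :: 'a \<Rightarrow> real) \<in> borel_measurable lebesgue" using B(1)[OF k] by simp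
    from lebesgue_measurable_shift[OF this, of "h *\<^sub>R e"]
    have 2: "(\<lambda>x. indicator (B k) (x + h *\<^sub>R e) :: real) \<in> borel_measurable lebesgue" by (simp only: add.commute)
    show "?D (B k) \<in> borel_measurable lebesgue"
      using measurable_compose[OF borel_measurable_diff[OF 2 1] borel_measurable_norm] by (rule measurable_compose) simp
  qed
  also have "\<dots> \<le> (\<Sum>k\<in>I. ennreal (C k * h))"
    using sv h by (intro sum_mono) (simp add: shift_variation_le_def)
  also have "\<dots> = ennreal ((\<Sum>k\<in>I. C k) * h)"
    using B(2) h by (simp add: sum_ennreal sum_distrib_right)
  finally show "(\<integral>\<^sup>+x. ?D (\<Union>k\<in>I. B k) x \<partial>lebesgue) \<le> ennreal ((\<Sum>k\<in>I. C k) * h)" .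
qed

text \<open>In layer i, \<open>M\<close> counts the pairs of strips, \<open>d\<close> is their
  thickness, \<delta> the step of the modulus, \<open>l\<close> the half period of the wave and
  \<open>2 * K\<close> the number of its turned intervals; \<open>R\<close> is the half width of the
  strips. The lower bound on \<open>K * l\<close> lets the wave cover the strips with room to spare,
  the upper bound limits the extent of its faces normal to \<open>e2\<close>. The bounds on
  \<open>d\<close> keep the total height \<open>2 * M * d\<close> within a dyadic band and limit the
  total area of the faces normal to \<open>e1\<close>.\<close>

locale shear_data =
  fixes e1 e2 :: "'a::euclidean_space" and R a :: real and \<beta> :: "'b::euclidean_space" and \<omega> :: "nat \<Rightarrow> 'b"
    and M K :: "nat \<Rightarrow> nat" and \<delta> l d :: "nat \<Rightarrow> real"
  assumes e1: "e1 \<in> Basis" and e2: "e2 \<in> Basis" and ne: "e1 \<noteq> e2"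
    and R: "1 \<le> R" and a: "0 < a" and \<beta>: "norm \<beta> = 1"
    and \<omega>: "\<And>i. norm (\<omega> i) = 1" "\<And>i. norm (\<omega> i - \<beta>) \<le> (1/2) ^ i"
    and M: "\<And>i. 1 \<le> M i"
    and \<delta>: "\<And>i. 0 < \<delta> i" "\<And>i. real (M i) * \<delta> i \<le> (1/2) ^ i"
    and l: "\<And>i. 0 < l i" "\<And>i. l i \<le> 1"
    and K: "\<And>i. R \<le> real (K i) * l i" "\<And>i. real (K i) * l i \<le> R + 1"
    and d: "\<And>i. 0 < d i" "\<And>i. 2 * real (M i) * d i \<le> (1/2) ^ (i + 1)" "\<And>i. real (K i) * (2 * real (M i) * d i) \<le> 1"
begin

definition corner :: "real \<Rightarrow> real \<Rightarrow> real \<Rightarrow> 'a" where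
  "corner x y r = x *\<^sub>R e1 + y *\<^sub>R e2 + (\<Sum>i\<in>Basis - {e1, e2}. r *\<^sub>R i)"

abbreviation slab :: "real \<Rightarrow> real \<Rightarrow> real \<Rightarrow> real \<Rightarrow> 'a set" where
  "slab x1 x2 y1 y2 \<equiv> box (corner x1 y1 (- R)) (corner x2 y2 R)"

lemma corner_inner:
  assumes "i \<in> Basis"
  shows "corner x y r \<bullet> i = (if i = e1 then x else if i = e2 then y else r)"
proof -
  have "(\<Sum>k\<in>Basis - {e1, e2}. r *\<^sub>R k) \<bullet> i = (\<Sum>k\<in>Basis - {e1, e2}. if k = i then r else 0)"
    unfolding inner_sum_left using assms by (intro sum.cong) (auto simp: inner_Basis)
  also have "\<dots> = (if i \<in> Basis - {e1, e2} then r else 0)" by simp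
  finally show ?thesis
    using assms e1 e2 ne by (auto simp: corner_def inner_add_left inner_Basis)
qed

lemma Ball_Basis_split: "(\<forall>i\<in>Basis. P i) \<longleftrightarrow> P e1 \<and> P e2 \<and> (\<forall>i\<in>Basis - {e1, e2}. P i)"
  using e1 e2 by blast

lemma mem_box_corner:
  "z \<in> box (corner x1 y1 r1) (corner x2 y2 r2) \<longleftrightarrow>
     (x1 < z \<bullet> e1 \<and> z \<bullet> e1 < x2) \<and> (y1 < z \<bullet> e2 \<and> z \<bullet> e2 < y2) \<and>
     (\<forall>i\<in>Basis - {e1, e2}. r1 < z \<bullet> i \<and> z \<bullet> i < r2)"
  unfolding mem_box Ball_Basis_split using e1 e2 ne by (simp add: corner_inner)

lemma mem_cbox_corner:
  "z \<in> cbox (corner x1 y1 r1) (corner x2 y2 r2) \<longleftrightarrow>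
     (x1 \<le> z \<bullet> e1 \<and> z \<bullet> e1 \<le> x2) \<and> (y1 \<le> z \<bullet> e2 \<and> z \<bullet> e2 \<le> y2) \<and>
     (\<forall>i\<in>Basis - {e1, e2}. r1 \<le> z \<bullet> i \<and> z \<bullet> i \<le> r2)"
  unfolding mem_box Ball_Basis_split using e1 e2 ne by (simp add: corner_inner)

text \<open>Layer i lives at heights between \<open>y0 i\<close> and \<open>2 * y0 i\<close>. These
  dyadic bands are disjoint and shrink to height 0, which makes room for infinitely many layers in a
  bounded set.\<close>

definition y0 :: "nat \<Rightarrow> real" where "y0 i = (1/2) ^ (i + 1)"

definition strip :: "nat \<Rightarrow> nat \<Rightarrow> 'a set" where
  "strip i r = slab (- R) R (y0 i + real r * d i) (y0 i + (real r + 1) * d i)"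

definition raised :: "nat \<Rightarrow> 'a set" where
  "raised i = (\<Union>r\<in>{..<M i}. strip i (2 * r))"

definition wave :: "nat \<Rightarrow> int \<Rightarrow> 'a set" where
  "wave i k = slab (2 * real_of_int k * l i) ((2 * real_of_int k + 1) * l i) (y0 i) (y0 i + 2 * real (M i) * d i)"

definition turned :: "nat \<Rightarrow> 'a set" where
  "turned i = (\<Union>k\<in>{- int (K i)..<int (K i)}. wave i k)"

text \<open>The deviation from the constant state \<open>a *\<^sub>R \<beta>\<close>. The second
  factor of the first term is always a unit vector, so the modulus depends on \<open>raised\<close>
  only and the direction on \<open>turned\<close> only.\<close>

definition layer :: "nat \<Rightarrow> 'a \<Rightarrow> 'b" where
  "layer i z = (a + \<delta> i * indicator (raised i) z) *\<^sub>R (\<beta> + indicator (turned i) z *\<^sub>R (\<omega> i - \<beta>)) - a *\<^sub>R \<beta>"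

text \<open>All data are tails of one series: the n-th keeps infinitely many layers, while its norms
  are tails of geometric series. At each point at most one summand is nonzero.\<close>

definition perturbation :: "nat \<Rightarrow> 'a \<Rightarrow> 'b" where
  "perturbation n z = (\<Sum>i. layer (n + i) z)"

lemma \<delta>_le: "\<delta> i \<le> (1/2) ^ i"
proof -
  have "1 * \<delta> i \<le> real (M i) * \<delta> i" using M[of i] \<delta>(1)[of i] by (intro mult_right_mono) auto
  then show ?thesis using \<delta>(2)[of i] by linarith
qed

lemma \<delta>_le_1: "\<delta> i \<le> 1"
  using \<delta>_le[of i] power_le_one[of "1/2::real" i] by linarith

lemma strip_sets: "strip i r \<in> sets borel" and wave_sets: "wave i k \<in> sets borel"
  by (simp_all add: strip_def wave_def)

lemma raised_sets: "raised i \<in> sets borel" and turned_sets: "turned i \<in> sets borel"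
  unfolding raised_def turned_def by (auto intro!: sets.finite_UN strip_sets wave_sets)

lemma strip_heights:
  assumes "z \<in> strip i r" "r < 2 * M i"
  shows "y0 i < z \<bullet> e2" "z \<bullet> e2 < 2 * y0 i"
proof -
  have b: "y0 i + real r * d i < z \<bullet> e2" "z \<bullet> e2 < y0 i + (real r + 1) * d i"
    using assms(1) by (auto simp: strip_def mem_box_corner)
  have "0 \<le> real r * d i" using d(1)[of i] by simp
  then show "y0 i < z \<bullet> e2" using b by linarith
  have "(real r + 1) * d i \<le> 2 * real (M i) * d i" using assms(2) d(1)[of i] by (intro mult_right_mono) auto
  then show "z \<bullet> e2 < 2 * y0 i" using b d(2)[of i] by (simp add: y0_def)
qed

text \<open>The lateral bound comes from the wave, which reaches out to
  \<open>2 * K * l \<le> 2 * R + 2\<close>; the vertical one from the height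
  \<open>2 * M * d\<close> of the layer, at most \<open>y0 i\<close>.\<close>

lemma layer_support:
  assumes "layer i z \<noteq> 0"
  shows "y0 i < z \<bullet> e2" "z \<bullet> e2 < 2 * y0 i" "\<And>j. j \<in> Basis \<Longrightarrow> \<bar>z \<bullet> j\<bar> \<le> 2 * R + 2"
proof -
  have "z \<in> raised i \<or> z \<in> turned i"
  proof (rule ccontr)
    assume "\<not> (z \<in> raised i \<or> z \<in> turned i)"
    then have "layer i z = 0" by (simp add: layer_def)
    with assms show False by simp
  qed
  moreover have "y0 i < z \<bullet> e2 \<and> z \<bullet> e2 < 2 * y0 i \<and> (\<forall>j\<in>Basis. \<bar>z \<bullet> j\<bar> \<le> 2 * R + 2)" if "z \<in> raised i"
  proof -
    obtain r where r: "r < M i" "z \<in> strip i (2 * r)" using \<open>z \<in> raised i\<close> by (auto simp: raised_def)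
    have h: "y0 i < z \<bullet> e2" "z \<bullet> e2 < 2 * y0 i" using strip_heights[OF r(2)] r(1) by auto
    have "y0 i \<le> 1 / 2" using power_le_one[of "1/2::real" i] by (simp add: y0_def)
    moreover have "0 \<le> y0 i" by (simp add: y0_def)
    ultimately have "\<bar>z \<bullet> e2\<bar> \<le> 2 * R + 2" using h R by linarith
    moreover have "- R < z \<bullet> e1 \<and> z \<bullet> e1 < R" "\<And>j. j \<in> Basis - {e1, e2} \<Longrightarrow> - R < z \<bullet> j \<and> z \<bullet> j < R"
      using r(2) by (auto simp: strip_def mem_box_corner)
    then have "\<bar>z \<bullet> j\<bar> \<le> 2 * R + 2" if "j \<in> Basis" "j \<noteq> e2" for j
      using R that by (cases "j = e1") (fastforce simp: abs_le_iff)+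
    ultimately show ?thesis using h by blast
  qed
  moreover have "y0 i < z \<bullet> e2 \<and> z \<bullet> e2 < 2 * y0 i \<and> (\<forall>j\<in>Basis. \<bar>z \<bullet> j\<bar> \<le> 2 * R + 2)" if "z \<in> turned i"
  proof -
    obtain k where k: "- int (K i) \<le> k" "k < int (K i)" "z \<in> wave i k" using \<open>z \<in> turned i\<close> by (auto simp: turned_def)
    have w: "2 * real_of_int k * l i < z \<bullet> e1" "z \<bullet> e1 < (2 * real_of_int k + 1) * l i"
      "y0 i < z \<bullet> e2" "z \<bullet> e2 < y0 i + 2 * real (M i) * d i" "\<And>j. j \<in> Basis - {e1, e2} \<Longrightarrow> - R < z \<bullet> j \<and> z \<bullet> j < R"
      using k(3) by (auto simp: wave_def mem_box_corner)
    have h: "y0 i < z \<bullet> e2" "z \<bullet> e2 < 2 * y0 i" using w d(2)[of i] by (auto simp: y0_def)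
    have "y0 i \<le> 1 / 2" using power_le_one[of "1/2::real" i] by (simp add: y0_def)
    moreover have "0 \<le> y0 i" by (simp add: y0_def)
    ultimately have "\<bar>z \<bullet> e2\<bar> \<le> 2 * R + 2" using h R by linarith
    moreover have "\<bar>z \<bullet> e1\<bar> \<le> 2 * R + 2"
    proof -
      have k': "- real (K i) \<le> real_of_int k" "real_of_int k + 1 \<le> real (K i)" using k by linarith+
      have "(- real (K i)) * l i \<le> real_of_int k * l i" "(real_of_int k + 1) * l i \<le> real (K i) * l i"
        by (rule mult_right_mono[OF k'(1) less_imp_le[OF l(1)]], rule mult_right_mono[OF k'(2) less_imp_le[OF l(1)]])
      then show ?thesis using w(1,2) K(2)[of i] l(1)[of i] by (simp add: algebra_simps abs_le_iff)
    qed
    moreover have "\<bar>z \<bullet> j\<bar> \<le> 2 * R + 2" if "j \<in> Basis - {e1, e2}" for j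
      using w(5)[OF that] R by (auto simp: abs_le_iff)
    ultimately show ?thesis using h by blast
  qed
  ultimately show "y0 i < z \<bullet> e2" "z \<bullet> e2 < 2 * y0 i" "\<And>j. j \<in> Basis \<Longrightarrow> \<bar>z \<bullet> j\<bar> \<le> 2 * R + 2"
    by blast+
qed

lemma y0_antimono: "i < j \<Longrightarrow> 2 * y0 j \<le> y0 i"
proof -
  assume "i < j"
  then have "(1/2::real) ^ j \<le> (1/2) ^ Suc i" by (intro power_decreasing) auto
  then show ?thesis by (simp add: y0_def)
qed

lemma layers_disjoint:
  assumes "y0 i < z \<bullet> e2" "z \<bullet> e2 < 2 * y0 i" "j \<noteq> i"
  shows "layer j z = 0"
proof (rule ccontr)
  assume "layer j z \<noteq> 0"
  then have "y0 j < z \<bullet> e2" "z \<bullet> e2 < 2 * y0 j" using layer_support by blast+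
  then show False using assms y0_antimono[of i j] y0_antimono[of j i] by (cases "i < j") auto
qed

lemma perturbation_eq_sum:
  assumes "finite I" "\<And>i. i \<notin> I \<Longrightarrow> layer (n + i) z = 0"
  shows "perturbation n z = (\<Sum>i\<in>I. layer (n + i) z)"
  unfolding perturbation_def by (rule suminf_finite[OF assms])

lemma perturbation_support_finite:
  obtains I where "finite I" "\<And>i. i \<notin> I \<Longrightarrow> layer (n + i) z = 0"
proof (cases "\<exists>i. layer (n + i) z \<noteq> 0")
  case True
  then obtain i where i: "layer (n + i) z \<noteq> 0" by blast
  have "layer (n + j) z = 0" if "j \<notin> {i}" for j
    using layers_disjoint[OF layer_support(1,2)[OF i], of "n + j"] that by simp
  then show ?thesis using that[of "{i}"] by blast
qed (use that[of "{}"] in auto)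

lemma perturbation_at:
  assumes "y0 (n + i) < z \<bullet> e2" "z \<bullet> e2 < 2 * y0 (n + i)"
  shows "perturbation n z = layer (n + i) z"
  using perturbation_eq_sum[of "{i}" n z] layers_disjoint[OF assms] by simp

lemma norm_layer_le: "norm (layer i z) \<le> (a + 2) * (1/2) ^ i"
proof -
  define s where "s = (indicator (raised i) z :: real)"
  define t where "t = (indicator (turned i) z :: real)"
  have st: "0 \<le> s" "s \<le> 1" "0 \<le> t" "t \<le> 1" by (auto simp: s_def t_def)
  have "layer i z = (\<delta> i * s) *\<^sub>R \<beta> + ((a + \<delta> i * s) * t) *\<^sub>R (\<omega> i - \<beta>)"
    by (simp add: layer_def s_def t_def algebra_simps)
  also have "norm \<dots> \<le> \<delta> i * s * norm \<beta> + (a + \<delta> i * s) * t * norm (\<omega> i - \<beta>)"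
    using st a \<delta>(1)[of i] by (intro norm_triangle_le) (simp add: abs_mult)
  also have "\<dots> \<le> (1/2) ^ i * 1 * 1 + (a + 1 * 1) * 1 * (1/2) ^ i"
    using st a \<delta>(1)[of i] \<delta>_le[of i] \<delta>_le_1[of i] \<omega>(2)[of i] \<beta>
    by (intro add_mono mult_mono mult_nonneg_nonneg add_nonneg_nonneg) auto
  finally show ?thesis by (simp add: algebra_simps)
qed

lemma perturbation_eq_layer:
  obtains "perturbation n z = 0" | i where "perturbation n z = layer (n + i) z" "layer (n + i) z \<noteq> 0"
proof (cases "\<exists>i. layer (n + i) z \<noteq> 0")
  case True
  then obtain i where i: "layer (n + i) z \<noteq> 0" by blast
  then show ?thesis using that(2)[of i] perturbation_at[OF layer_support(1,2)[OF i]] by blast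
qed (use that(1) in \<open>auto simp: perturbation_def\<close>)

lemma norm_perturbation_le: "norm (perturbation n z) \<le> (a + 2) * (1/2) ^ n"
proof (cases rule: perturbation_eq_layer[of n z])
  case (2 i)
  have "norm (layer (n + i) z) \<le> (a + 2) * (1/2) ^ (n + i)" by (rule norm_layer_le)
  also have "\<dots> \<le> (a + 2) * (1/2) ^ n" using a by (intro mult_left_mono power_decreasing) auto
  finally show ?thesis using 2 by simp
qed (use a in simp)

lemma perturbation_support:
  assumes "perturbation n z \<noteq> 0" "j \<in> Basis"
  shows "\<bar>z \<bullet> j\<bar> \<le> 2 * R + 2"
  using assms layer_support(3) by (cases rule: perturbation_eq_layer[of n z]) auto

lemma layer_measurable: "layer i \<in> borel_measurable borel"
proof -
  have "(indicator (raised i) :: 'a \<Rightarrow> real) \<in> borel_measurable borel" "(indicator (turned i) :: 'a \<Rightarrow> real) \<in> borel_measurable borel"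
    using raised_sets turned_sets by auto
  then show ?thesis unfolding layer_def[abs_def]
    by (intro borel_measurable_diff borel_measurable_scaleR borel_measurable_add borel_measurable_times borel_measurable_const)
qed

lemma perturbation_measurable: "perturbation n \<in> borel_measurable borel"
  unfolding perturbation_def[abs_def] by (rule borel_measurable_suminf[OF layer_measurable])

lemma perturbation_integrable:
  "integrable lebesgue (perturbation n)"
  "(\<integral>\<^sup>+z. ennreal (norm (perturbation n z)) \<partial>lebesgue)
     \<le> ennreal ((a + 2) * (1/2) ^ n * (4 * R + 4) ^ DIM('a))"
proof -
  let ?C = "cbox (- ((2 * R + 2) *\<^sub>R One)) ((2 * R + 2) *\<^sub>R One) :: 'a set"
  have "ennreal (norm (perturbation n z)) \<le> ennreal ((a + 2) * (1/2) ^ n) * indicator ?C z" for z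
  proof (cases "z \<in> ?C")
    case True
    then show ?thesis using norm_perturbation_le by (simp add: ennreal_leI)
  next
    case False
    then have "perturbation n z = 0" using perturbation_support by (force simp: mem_box abs_le_iff)
    then show ?thesis by simp
  qed
  then have "(\<integral>\<^sup>+z. ennreal (norm (perturbation n z)) \<partial>lebesgue) \<le> (\<integral>\<^sup>+z. ennreal ((a + 2) * (1/2) ^ n) * indicator ?C z \<partial>lebesgue)"
    by (intro nn_integral_mono)
  also have "\<dots> = ennreal ((a + 2) * (1/2) ^ n) * emeasure lborel ?C"
    by (simp add: nn_integral_cmult_indicator)
  also have "emeasure lborel ?C = ennreal ((4 * R + 4) ^ DIM('a))"
  proof -
    have "(\<Prod>i\<in>Basis. ((2 * R + 2) *\<^sub>R (One :: 'a) - (- ((2 * R + 2) *\<^sub>R One))) \<bullet> i) = (\<Prod>i\<in>(Basis::'a set). 4 * R + 4)"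
      by (intro prod.cong refl) (simp add: inner_add_left)
    then show ?thesis
      using R by (subst emeasure_lborel_cbox) (simp_all del: diff_minus_eq_add)
  qed
  also have "ennreal ((a + 2) * (1/2) ^ n) * \<dots> = ennreal ((a + 2) * (1/2) ^ n * (4 * R + 4) ^ DIM('a))"
    using a R by (intro ennreal_mult[symmetric]) auto
  finally show le: "(\<integral>\<^sup>+z. ennreal (norm (perturbation n z)) \<partial>lebesgue)
     \<le> ennreal ((a + 2) * (1/2) ^ n * (4 * R + 4) ^ DIM('a))" .
  have "perturbation n \<in> borel_measurable lebesgue"
    using perturbation_measurable by (intro measurable_completion) simp
  then show "integrable lebesgue (perturbation n)"
    unfolding integrable_iff_bounded using le_less_trans[OF le] by simp
qed

end

lemma shift_variation_le_mono: "shift_variation_le e f C \<Longrightarrow> C \<le> C' \<Longrightarrow> shift_variation_le e f C'"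
  unfolding shift_variation_le_def by (meson ennreal_leI less_imp_le mult_right_mono order_trans)

section \<open>Size of the perturbation in BV and in the supremum norm\<close>

context shear_data
begin

text \<open>Slabs have side \<open>2 * R \<ge> 1\<close> in every direction other than
  \<open>e1\<close> and \<open>e2\<close>, so this power bounds any product of such sides.\<close>

definition Z :: real where "Z = (2 * R) ^ DIM('a)"

lemma Z_ge_1: "1 \<le> Z"
  unfolding Z_def using R by (intro one_le_power) auto

text \<open>The area of a face orthogonal to \<open>e\<close> omits the side in direction
  \<open>e\<close>. With sides X and Y along \<open>e1\<close> and \<open>e2\<close> it is at most
  Y, X or X Y times \<open>Z\<close>, for \<open>e\<close> equal to \<open>e1\<close>, to
  \<open>e2\<close> or to neither; the sum covers the three cases.\<close>

lemma shift_variation_slab: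
  assumes e: "e \<in> Basis" and xy: "x1 \<le> x2" "y1 \<le> y2"
  shows "shift_variation_le e (indicator (slab x1 x2 y1 y2) :: 'a \<Rightarrow> real)
     (2 * ((x2 - x1) + (y2 - y1) + (x2 - x1) * (y2 - y1)) * Z)"
proof (rule shift_variation_le_mono[OF shift_variation_box[OF e]])
  show "corner x1 y1 (- R) \<bullet> i \<le> corner x2 y2 R \<bullet> i" if "i \<in> Basis" for i
    using that xy R by (simp add: corner_inner)
  define X where "X = x2 - x1"
  define Y where "Y = y2 - y1"
  have nn: "0 \<le> X" "0 \<le> Y" "0 \<le> X * Y" using xy by (auto simp: X_def Y_def)
  define len where "len i = (if i = e1 then X else if i = e2 then Y else 2 * R)" for i
  have side: "(\<Prod>i\<in>S. len i) \<le> Z" "0 \<le> (\<Prod>i\<in>S. len i)" if "S \<subseteq> Basis - {e1, e2}" for S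
  proof -
    have "(\<Prod>i\<in>S. len i) = (\<Prod>i\<in>S. 2 * R)"
    proof (rule prod.cong)
      fix i assume "i \<in> S"
      then have "i \<noteq> e1" "i \<noteq> e2" using that by blast+
      then show "len i = 2 * R" by (simp add: len_def)
    qed simp
    then have "(\<Prod>i\<in>S. len i) = (2 * R) ^ card S" by (simp only: prod_constant)
    moreover have "card S \<le> DIM('a)" using that by (intro card_mono) auto
    then have "(2 * R) ^ card S \<le> Z" unfolding Z_def using R by (intro power_increasing) auto
    moreover have "0 \<le> (2 * R) ^ card S" using R by simp
    ultimately show "(\<Prod>i\<in>S. len i) \<le> Z" "0 \<le> (\<Prod>i\<in>S. len i)" by metis+
  qed
  have l12: "len e1 = X" "len e2 = Y" using ne by (auto simp: len_def)
  have "(\<Prod>i\<in>Basis - {e}. len i) \<le> (X + Y + X * Y) * Z"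
  proof -
    have le: "t * (\<Prod>i\<in>S. len i) \<le> (X + Y + X * Y) * Z"
      if "0 \<le> t" "t \<le> X + Y + X * Y" "S \<subseteq> Basis - {e1, e2}" for t S
      using that side[OF that(3)] by (intro mult_mono) linarith+
    consider "e = e1" | "e = e2" | "e \<noteq> e1" "e \<noteq> e2" by blast
    then show ?thesis
    proof cases
      case 1
      have "(\<Prod>i\<in>Basis - {e}. len i) = Y * (\<Prod>i\<in>Basis - {e1} - {e2}. len i)"
        unfolding 1 l12[symmetric] using e2 ne by (intro prod.remove) auto
      also have "\<dots> \<le> (X + Y + X * Y) * Z" using nn by (intro le) auto
      finally show ?thesis .
    next
      case 2
      have "(\<Prod>i\<in>Basis - {e}. len i) = X * (\<Prod>i\<in>Basis - {e2} - {e1}. len i)"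
        unfolding 2 l12[symmetric] using e1 ne by (intro prod.remove) auto
      also have "\<dots> \<le> (X + Y + X * Y) * Z" using nn by (intro le) auto
      finally show ?thesis .
    next
      case 3
      have "(\<Prod>i\<in>Basis - {e}. len i) = len e1 * (\<Prod>i\<in>Basis - {e} - {e1}. len i)"
        using 3 e1 by (intro prod.remove) auto
      also have "(\<Prod>i\<in>Basis - {e} - {e1}. len i) = len e2 * (\<Prod>i\<in>Basis - {e} - {e1} - {e2}. len i)"
        using 3 e2 ne by (intro prod.remove) auto
      also have "len e1 * (len e2 * (\<Prod>i\<in>Basis - {e} - {e1} - {e2}. len i)) = (X * Y) * (\<Prod>i\<in>Basis - {e} - {e1} - {e2}. len i)"
        by (simp only: l12 mult.assoc)
      also have "\<dots> \<le> (X + Y + X * Y) * Z" using nn by (intro le) auto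
      finally show ?thesis .
    qed
  qed
  moreover have "(\<Prod>i\<in>Basis - {e}. (corner x2 y2 R - corner x1 y1 (- R)) \<bullet> i) = (\<Prod>i\<in>Basis - {e}. len i)"
    by (intro prod.cong refl) (simp add: len_def X_def Y_def inner_diff_left corner_inner)
  ultimately have "(\<Prod>i\<in>Basis - {e}. (corner x2 y2 R - corner x1 y1 (- R)) \<bullet> i) \<le> (X + Y + X * Y) * Z" by (simp only:)
  then show "2 * (\<Prod>i\<in>Basis - {e}. (corner x2 y2 R - corner x1 y1 (- R)) \<bullet> i)
      \<le> 2 * ((x2 - x1) + (y2 - y1) + (x2 - x1) * (y2 - y1)) * Z"
    unfolding X_def Y_def mult.assoc by (rule mult_left_mono) simp
qed

lemma d_le_1: "d i \<le> 1"
proof -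
  have "1 * d i \<le> 2 * real (M i) * d i" using M[of i] d(1)[of i] by (intro mult_right_mono) auto
  moreover have "(1/2::real) ^ (i + 1) \<le> 1" by (rule power_le_one) auto
  ultimately show ?thesis using d(2)[of i] by linarith
qed

text \<open>A strip costs a fixed amount however thin it is, since its long faces have area bounded
  below. The resulting factor \<open>M i\<close> is later compensated by
  \<open>\<delta> i\<close>.\<close>

lemma shift_variation_raised:
  assumes e: "e \<in> Basis"
  shows "shift_variation_le e (indicator (raised i) :: 'a \<Rightarrow> real) (real (M i) * (10 * R * Z))"
proof -
  have "shift_variation_le e (indicator (raised i) :: 'a \<Rightarrow> real) (\<Sum>r\<in>{..<M i}. 10 * R * Z)"
    unfolding raised_def
  proof (rule shift_variation_Union)
    fix r
    show "strip i (2 * r) \<in> sets lebesgue" using strip_sets[of i "2 * r"] by simp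
    show "0 \<le> 10 * R * Z" using R Z_ge_1 by simp
    let ?y = "y0 i + real (2 * r) * d i" and ?y' = "y0 i + (real (2 * r) + 1) * d i"
    have "shift_variation_le e (indicator (strip i (2 * r)) :: 'a \<Rightarrow> real)
        (2 * ((R - - R) + (?y' - ?y) + (R - - R) * (?y' - ?y)) * Z)"
      unfolding strip_def using R d(1)[of i] by (intro shift_variation_slab e) auto
    moreover have "2 * ((R - - R) + (?y' - ?y) + (R - - R) * (?y' - ?y)) * Z \<le> (10 * R) * Z"
    proof (rule mult_right_mono)
      have eq: "?y' - ?y = d i" by (simp add: algebra_simps)
      have "R * d i \<le> R * 1" using R d_le_1[of i] by (intro mult_left_mono) auto
      moreover have "2 * ((R - - R) + d i + (R - - R) * d i) = 4 * R + 2 * d i + 4 * (R * d i)" by (simp add: algebra_simps)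
      ultimately show "2 * ((R - - R) + (?y' - ?y) + (R - - R) * (?y' - ?y)) \<le> 10 * R"
        unfolding eq using R d_le_1[of i] by linarith
    qed (use Z_ge_1 in simp)
    ultimately show "shift_variation_le e (indicator (strip i (2 * r)) :: 'a \<Rightarrow> real) (10 * R * Z)"
      by (rule shift_variation_le_mono)
  qed simp
  then show ?thesis by simp
qed

text \<open>The bound is independent of the numbers of strips and of periods: the faces normal to
  \<open>e2\<close> have total length about \<open>K * l \<le> R + 1\<close>, and those normal to
  \<open>e1\<close> are short enough that \<open>K\<close> times their height is at most 1.\<close>

lemma shift_variation_turned:
  assumes e: "e \<in> Basis"
  shows "shift_variation_le e (indicator (turned i) :: 'a \<Rightarrow> real) (16 * R * Z)"
proof -
  define w where "w = 2 * real (M i) * d i"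
  have w: "0 \<le> w" "real (K i) * w \<le> 1" using d(1,3)[of i] by (auto simp: w_def less_imp_le)
  let ?C = "2 * (l i + w + l i * w) * Z"
  have C: "0 \<le> ?C" using w l(1)[of i] Z_ge_1 by simp
  have "shift_variation_le e (indicator (turned i) :: 'a \<Rightarrow> real) (\<Sum>k\<in>{- int (K i)..<int (K i)}. ?C)"
    unfolding turned_def
  proof (rule shift_variation_Union)
    fix k
    show "wave i k \<in> sets lebesgue" using wave_sets[of i k] by simp
    let ?x = "2 * real_of_int k * l i" and ?x' = "(2 * real_of_int k + 1) * l i"
    have "shift_variation_le e (indicator (wave i k) :: 'a \<Rightarrow> real)
        (2 * ((?x' - ?x) + (y0 i + w - y0 i) + (?x' - ?x) * (y0 i + w - y0 i)) * Z)"
      unfolding wave_def w_def[symmetric] using l(1)[of i] w(1) by (intro shift_variation_slab e) (auto simp: algebra_simps)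
    moreover have "?x' - ?x = l i" "y0 i + w - y0 i = w" by (simp_all add: algebra_simps)
    ultimately show "shift_variation_le e (indicator (wave i k) :: 'a \<Rightarrow> real) ?C" by (simp only:)
  qed (use C in auto)
  moreover have "(\<Sum>k\<in>{- int (K i)..<int (K i)}. ?C) \<le> 16 * R * Z"
  proof -
    have "l i * w \<le> 1 * w" using l(2) w(1) by (intro mult_right_mono) auto
    then have "real (K i) * (l i * w) \<le> real (K i) * w" by (intro mult_left_mono) auto
    moreover have "4 * (x + y + z) \<le> 16 * R" if "z \<le> y" "x \<le> R + 1" "y \<le> 1" for x y z
      using that R by simp
    ultimately have "4 * (real (K i) * l i + real (K i) * w + real (K i) * (l i * w)) \<le> 16 * R"
      using K(2)[of i] w(2) by blast
    then have "4 * (real (K i) * l i + real (K i) * w + real (K i) * (l i * w)) * Z \<le> 16 * R * Z"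
      using Z_ge_1 by (intro mult_right_mono) auto
    then show ?thesis by (simp add: algebra_simps)
  qed
  ultimately show ?thesis by (rule shift_variation_le_mono)
qed

text \<open>The number 36 + 16 a is 20 + 16 (a + 1): twice the constant 10 of
  \<open>shift_variation_raised\<close> for jumps of the modulus, and 16 from
  \<open>shift_variation_turned\<close> times the bound \<open>a + 1\<close> of the modulus.\<close>

definition C0 :: real where "C0 = (36 + 16 * a) * R * Z"

text \<open>A discrete product rule. A jump of the modulus costs \<delta> in direction \<beta> and
  at most \<delta> again in direction \<open>\<omega> i - \<beta>\<close>; a jump of the direction
  costs at most \<open>a + 1\<close> times \<open>(1/2) ^ i\<close>. The product
  \<open>M i * \<delta> i\<close> then supplies the decay for the first kind.\<close>

lemma shift_variation_layer:
  assumes e: "e \<in> Basis"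
  shows "shift_variation_le e (layer i) (C0 * (1/2) ^ i)"
  unfolding shift_variation_le_def
proof (intro allI impI)
  fix h :: real assume h: "0 < h"
  define s where "s z = (indicator (raised i) z :: real)" for z
  define t where "t z = (indicator (turned i) z :: real)" for z
  have st: "0 \<le> s z" "s z \<le> 1" "0 \<le> t z" "t z \<le> 1" for z by (auto simp: s_def t_def)
  let ?c = "(1/2::real) ^ i"
  have c: "0 \<le> ?c" "?c \<le> 1" by (auto intro: power_le_one)
  have pt: "norm (layer i z' - layer i z) \<le> 2 * \<delta> i * \<bar>s z' - s z\<bar> + (a + 1) * ?c * \<bar>t z' - t z\<bar>" for z z'
  proof -
    have eq: "layer i z = (\<delta> i * s z) *\<^sub>R \<beta> + ((a + \<delta> i * s z) * t z) *\<^sub>R (\<omega> i - \<beta>)" for z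
      by (simp add: layer_def s_def t_def algebra_simps)
    have "layer i z' - layer i z = (\<delta> i * (s z' - s z)) *\<^sub>R \<beta> +
        ((a + \<delta> i * s z') * (t z' - t z) + (\<delta> i * (s z' - s z)) * t z) *\<^sub>R (\<omega> i - \<beta>)"
      unfolding eq by (simp add: algebra_simps)
    also have "norm \<dots> \<le> \<delta> i * \<bar>s z' - s z\<bar> * 1 +
        ((a + 1) * \<bar>t z' - t z\<bar> * norm (\<omega> i - \<beta>) + \<delta> i * \<bar>s z' - s z\<bar> * norm (\<omega> i - \<beta>))"
    proof (rule norm_triangle_le, rule add_mono)
      show "norm ((\<delta> i * (s z' - s z)) *\<^sub>R \<beta>) \<le> \<delta> i * \<bar>s z' - s z\<bar> * 1"
        using \<delta>(1)[of i] \<beta> by (simp add: abs_mult)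
      have 1: "(a + \<delta> i * s z') * \<bar>t z' - t z\<bar> \<le> (a + 1) * \<bar>t z' - t z\<bar>"
        using st[of z'] \<delta>(1)[of i] \<delta>_le_1[of i] a mult_mono[of "\<delta> i" 1 "s z'" 1] by (intro mult_right_mono) auto
      have 2: "\<delta> i * \<bar>s z' - s z\<bar> * t z \<le> \<delta> i * \<bar>s z' - s z\<bar>"
        using st[of z] \<delta>(1)[of i] by (intro mult_left_le) auto
      have "\<bar>(a + \<delta> i * s z') * (t z' - t z) + (\<delta> i * (s z' - s z)) * t z\<bar> \<le>
          (a + \<delta> i * s z') * \<bar>t z' - t z\<bar> + \<delta> i * \<bar>s z' - s z\<bar> * t z"
        using abs_triangle_ineq[of "(a + \<delta> i * s z') * (t z' - t z)" "(\<delta> i * (s z' - s z)) * t z"] st[of z] st[of z'] \<delta>(1)[of i] a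
        by (simp add: abs_mult)
      also have "\<dots> \<le> (a + 1) * \<bar>t z' - t z\<bar> + \<delta> i * \<bar>s z' - s z\<bar>" using 1 2 by (rule add_mono)
      finally have 3: "\<bar>(a + \<delta> i * s z') * (t z' - t z) + (\<delta> i * (s z' - s z)) * t z\<bar> \<le> (a + 1) * \<bar>t z' - t z\<bar> + \<delta> i * \<bar>s z' - s z\<bar>" .
      show "norm (((a + \<delta> i * s z') * (t z' - t z) + (\<delta> i * (s z' - s z)) * t z) *\<^sub>R (\<omega> i - \<beta>)) \<le>
          (a + 1) * \<bar>t z' - t z\<bar> * norm (\<omega> i - \<beta>) + \<delta> i * \<bar>s z' - s z\<bar> * norm (\<omega> i - \<beta>)"
        unfolding norm_scaleR distrib_right[symmetric] by (rule mult_right_mono[OF 3 norm_ge_zero])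
    qed
    also have "\<dots> \<le> \<delta> i * \<bar>s z' - s z\<bar> * 1 + ((a + 1) * \<bar>t z' - t z\<bar> * ?c + \<delta> i * \<bar>s z' - s z\<bar> * 1)"
      using \<omega>(2)[of i] order_trans[OF \<omega>(2)[of i] c(2)] \<delta>(1)[of i] a by (intro add_mono order_refl mult_left_mono) auto
    finally show ?thesis by (simp add: algebra_simps)
  qed
  let ?A = "\<lambda>z. ennreal (norm (s (z + h *\<^sub>R e) - s z))" and ?B = "\<lambda>z. ennreal (norm (t (z + h *\<^sub>R e) - t z))"
  have meas: "(\<lambda>z. ennreal (norm (f (z + h *\<^sub>R e) - f z))) \<in> borel_measurable lebesgue"
    if "f \<in> borel_measurable lebesgue" for f :: "'a \<Rightarrow> real"
  proof -
    have "(\<lambda>z. f (z + h *\<^sub>R e)) \<in> borel_measurable lebesgue"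
      using lebesgue_measurable_shift[OF that, of "h *\<^sub>R e"] by (simp only: add.commute)
    from measurable_compose[OF borel_measurable_diff[OF this that] borel_measurable_norm] show ?thesis
      by (rule measurable_compose) simp
  qed
  have mA: "?A \<in> borel_measurable lebesgue" and mB: "?B \<in> borel_measurable lebesgue"
  proof -
    have st: "s \<in> borel_measurable lebesgue" "t \<in> borel_measurable lebesgue"
      using raised_sets[of i] turned_sets[of i] unfolding s_def[abs_def] t_def[abs_def]
      by (auto intro!: borel_measurable_indicator)
    show "?A \<in> borel_measurable lebesgue" by (rule meas[OF st(1)])
    show "?B \<in> borel_measurable lebesgue" by (rule meas[OF st(2)])
  qed
  have "(\<integral>\<^sup>+z. ennreal (norm (layer i (z + h *\<^sub>R e) - layer i z)) \<partial>lebesgue)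
      \<le> (\<integral>\<^sup>+z. ennreal (2 * \<delta> i) * ?A z + ennreal ((a + 1) * ?c) * ?B z \<partial>lebesgue)"
  proof (rule nn_integral_mono)
    fix z
    have "ennreal (norm (layer i (z + h *\<^sub>R e) - layer i z)) \<le>
        ennreal (2 * \<delta> i * \<bar>s (z + h *\<^sub>R e) - s z\<bar> + (a + 1) * ?c * \<bar>t (z + h *\<^sub>R e) - t z\<bar>)"
      by (rule ennreal_leI[OF pt])
    also have "\<dots> = ennreal (2 * \<delta> i) * ?A z + ennreal ((a + 1) * ?c) * ?B z"
      using \<delta>(1)[of i] a c by (subst ennreal_plus) (auto simp: ennreal_mult)
    finally show "ennreal (norm (layer i (z + h *\<^sub>R e) - layer i z)) \<le> ennreal (2 * \<delta> i) * ?A z + ennreal ((a + 1) * ?c) * ?B z" .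
  qed
  also have "\<dots> = ennreal (2 * \<delta> i) * (\<integral>\<^sup>+z. ?A z \<partial>lebesgue) + ennreal ((a + 1) * ?c) * (\<integral>\<^sup>+z. ?B z \<partial>lebesgue)"
    using mA mB by (subst nn_integral_add) (auto simp: nn_integral_cmult)
  also have "\<dots> \<le> ennreal (2 * \<delta> i) * ennreal (real (M i) * (10 * R * Z) * h) + ennreal ((a + 1) * ?c) * ennreal (16 * R * Z * h)"
    using shift_variation_raised[OF e, of i] shift_variation_turned[OF e, of i] h
    by (intro add_mono mult_left_mono) (auto simp: shift_variation_le_def s_def[abs_def] t_def[abs_def])
  also have "\<dots> = ennreal (2 * \<delta> i * (real (M i) * (10 * R * Z) * h) + (a + 1) * ?c * (16 * R * Z * h))"
  proof -
    have "ennreal x1 * ennreal x2 + ennreal x3 * ennreal x4 = ennreal (x1 * x2 + x3 * x4)"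
      if "0 \<le> x1" "0 \<le> x2" "0 \<le> x3" "0 \<le> x4" for x1 x2 x3 x4 :: real
      using that by (simp add: ennreal_mult)
    then show ?thesis using \<delta>(1)[of i] a c R Z_ge_1 h by simp
  qed
  also have "\<dots> \<le> ennreal (C0 * ?c * h)"
  proof (rule ennreal_leI)
    have "real (M i) * \<delta> i * (20 * R * Z * h) \<le> ?c * (20 * R * Z * h)"
      using R Z_ge_1 h by (intro mult_right_mono \<delta>(2)) auto
    then show "2 * \<delta> i * (real (M i) * (10 * R * Z) * h) + (a + 1) * ?c * (16 * R * Z * h) \<le> C0 * ?c * h"
      unfolding C0_def by (simp add: algebra_simps)
  qed
  finally show "(\<integral>\<^sup>+z. ennreal (norm (layer i (z + h *\<^sub>R e) - layer i z)) \<partial>lebesgue) \<le> ennreal (C0 * ?c * h)" .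
qed

lemma C0_nonneg: "0 \<le> C0"
  unfolding C0_def using a R Z_ge_1 by simp

text \<open>At \<open>z\<close> and at the shifted point only finitely many layers are nonzero, so
  the triangle inequality is applied to a finite sum. The factor 2 is the sum of the geometric
  series.\<close>

lemma shift_variation_perturbation:
  assumes e: "e \<in> Basis"
  shows "shift_variation_le e (perturbation n) (2 * C0 * (1/2) ^ n)"
  unfolding shift_variation_le_def
proof (intro allI impI)
  fix h :: real assume h: "0 < h"
  let ?D = "\<lambda>i z. ennreal (norm (layer (n + i) (z + h *\<^sub>R e) - layer (n + i) z))"
  have lm: "layer i \<in> borel_measurable lebesgue" for i using layer_measurable by (intro measurable_completion) simp
  have mD: "?D i \<in> borel_measurable lebesgue" for i
  proof -
    have "(\<lambda>z. layer (n + i) (z + h *\<^sub>R e)) \<in> borel_measurable lebesgue"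
      using lebesgue_measurable_shift[OF lm[of "n + i"], of "h *\<^sub>R e"] by (simp only: add.commute)
    from measurable_compose[OF borel_measurable_diff[OF this lm] borel_measurable_norm] show ?thesis
      by (rule measurable_compose) simp
  qed
  have "(\<integral>\<^sup>+z. ennreal (norm (perturbation n (z + h *\<^sub>R e) - perturbation n z)) \<partial>lebesgue) \<le> (\<integral>\<^sup>+z. (\<Sum>i. ?D i z) \<partial>lebesgue)"
  proof (rule nn_integral_mono)
    fix z
    obtain I where I: "finite I" "\<And>i. i \<notin> I \<Longrightarrow> layer (n + i) z = 0" using perturbation_support_finite by blast
    obtain J where J: "finite J" "\<And>i. i \<notin> J \<Longrightarrow> layer (n + i) (z + h *\<^sub>R e) = 0" using perturbation_support_finite by blast
    have p: "perturbation n z = (\<Sum>i\<in>I \<union> J. layer (n + i) z)"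
      "perturbation n (z + h *\<^sub>R e) = (\<Sum>i\<in>I \<union> J. layer (n + i) (z + h *\<^sub>R e))"
      using I J by (auto intro!: perturbation_eq_sum)
    have "ennreal (norm (perturbation n (z + h *\<^sub>R e) - perturbation n z)) \<le> ennreal (\<Sum>i\<in>I \<union> J. norm (layer (n + i) (z + h *\<^sub>R e) - layer (n + i) z))"
      unfolding p sum_subtractf[symmetric] by (intro ennreal_leI norm_sum)
    also have "\<dots> = (\<Sum>i\<in>I \<union> J. ?D i z)" by simp
    also have "\<dots> \<le> (\<Sum>i. ?D i z)" using I J by (intro sum_le_suminf) auto
    finally show "ennreal (norm (perturbation n (z + h *\<^sub>R e) - perturbation n z)) \<le> (\<Sum>i. ?D i z)" .
  qed
  also have "\<dots> = (\<Sum>i. \<integral>\<^sup>+z. ?D i z \<partial>lebesgue)" by (rule nn_integral_suminf[OF mD])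
  also have "\<dots> \<le> (\<Sum>i. ennreal (C0 * (1/2) ^ (n + i) * h))"
    using shift_variation_layer[OF e] h by (intro suminf_le) (auto simp: shift_variation_le_def)
  also have "\<dots> = ennreal (2 * C0 * (1/2) ^ n * h)"
  proof -
    have "(\<lambda>i. (C0 * (1/2) ^ n * h) * (1/2) ^ i) sums ((C0 * (1/2) ^ n * h) * (1 / (1 - 1/2)))"
      by (intro sums_mult geometric_sums) simp
    then have "(\<lambda>i. C0 * (1/2) ^ (n + i) * h) sums (2 * C0 * (1/2) ^ n * h)"
      by (simp add: power_add mult_ac)
    then show ?thesis using C0_nonneg h by (intro suminf_ennreal_eq) auto
  qed
  finally show "(\<integral>\<^sup>+z. ennreal (norm (perturbation n (z + h *\<^sub>R e) - perturbation n z)) \<partial>lebesgue) \<le> ennreal (2 * C0 * (1/2) ^ n * h)" .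
qed

lemma total_variation_perturbation:
  "total_variation UNIV (perturbation n) \<le> ennreal (DIM('b) * DIM('a) * (2 * C0 * (1/2) ^ n))"
  using C0_nonneg by (intro total_variation_le perturbation_integrable shift_variation_perturbation) auto

lemma Linf_norm_perturbation: "Linf_norm (perturbation n) \<le> ennreal ((a + 2) * (1/2) ^ n)"
  unfolding Linf_norm_def
proof (rule esssup_I)
  have "perturbation n \<in> borel_measurable lebesgue"
    using perturbation_measurable by (intro measurable_completion) simp
  from measurable_compose[OF this borel_measurable_norm]
  show "(\<lambda>z. ennreal (norm (perturbation n z))) \<in> borel_measurable lebesgue" by (rule measurable_compose) simp
qed (use norm_perturbation_le in \<open>simp add: ennreal_leI\<close>)

lemma BV_perturbation: "BV (perturbation n)"
  unfolding BV_def using perturbation_integrable(1) le_less_trans[OF total_variation_perturbation] by auto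

lemma perturbation_tendsto_0:
  "(\<lambda>n. BV_norm (perturbation n) + Linf_norm (perturbation n)) \<longlonglongrightarrow> 0"
proof -
  define C where "C = (a + 2) * (4 * R + 4) ^ DIM('a) + DIM('b) * DIM('a) * (2 * C0) + (a + 2)"
  have "BV_norm (perturbation n) + Linf_norm (perturbation n) \<le> ennreal (C * (1/2) ^ n)" for n
  proof -
    define c where "c = (1/2::real) ^ n"
    have c: "0 \<le> c" by (simp add: c_def)
    define A where "A = (4 * R + 4) ^ DIM('a)"
    have A: "0 \<le> A" using R by (simp add: A_def)
    have gen: "ennreal x1 + ennreal x2 + ennreal x3 = ennreal (x1 + x2 + x3)"
      if "0 \<le> x1" "0 \<le> x2" "0 \<le> x3" for x1 x2 x3 :: real
      using that by simp
    have "BV_norm (perturbation n) + Linf_norm (perturbation n) \<le>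
        ennreal ((a + 2) * c * A) + ennreal (DIM('b) * DIM('a) * (2 * C0 * c)) + ennreal ((a + 2) * c)"
      unfolding BV_norm_def c_def A_def
      by (intro add_mono perturbation_integrable(2) total_variation_perturbation Linf_norm_perturbation)
    also have "\<dots> = ennreal ((a + 2) * c * A + DIM('b) * DIM('a) * (2 * C0 * c) + (a + 2) * c)"
      by (rule gen) (use a c A C0_nonneg in simp_all)
    also have "(a + 2) * c * A + DIM('b) * DIM('a) * (2 * C0 * c) + (a + 2) * c = C * c"
      unfolding C_def A_def by (simp only: distrib_right distrib_left mult_ac)
    finally show ?thesis unfolding c_def .
  qed
  note le = this
  have "(\<lambda>n. C * (1/2) ^ n) \<longlonglongrightarrow> 0"
    by (rule tendsto_mult_right_zero, rule LIMSEQ_power_zero) simp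
  from tendsto_ennrealI[OF this] have lim: "(\<lambda>n. ennreal (C * (1/2) ^ n)) \<longlonglongrightarrow> 0"
    by (simp only: ennreal_0)
  show ?thesis
  proof (rule tendsto_sandwich[OF _ _ tendsto_const lim])
    show "\<forall>\<^sub>F n in sequentially. 0 \<le> BV_norm (perturbation n) + Linf_norm (perturbation n)"
      by (rule always_eventually) simp
    show "\<forall>\<^sub>F n in sequentially. BV_norm (perturbation n) + Linf_norm (perturbation n) \<le> ennreal (C * (1/2) ^ n)"
      by (rule always_eventually) (blast intro: le)
  qed
qed

section \<open>Values of the datum on the strips\<close>

lemma strip_raised_iff:
  assumes z: "z \<in> strip i r" "r < 2 * M i"
  shows "z \<in> raised i \<longleftrightarrow> even r"
proof
  assume "even r"
  then obtain k where k: "r = 2 * k" by blast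
  then show "z \<in> raised i" using z by (auto simp: raised_def)
next
  assume "z \<in> raised i"
  then obtain k where k: "z \<in> strip i (2 * k)" by (auto simp: raised_def)
  have "real r * d i < (real (2 * k) + 1) * d i" "real (2 * k) * d i < (real r + 1) * d i"
    using z(1) k by (auto simp: strip_def mem_box_corner)
  then have "real r < real (2 * k) + 1" "real (2 * k) < real r + 1" using d(1)[of i] by (auto simp: mult_less_cancel_right)
  then have "r = 2 * k" by linarith
  then show "even r" by simp
qed

lemma strip_turned_iff:
  assumes z: "z \<in> strip i r" "r < 2 * M i"
    and k: "real_of_int k * l i < z \<bullet> e1" "z \<bullet> e1 < (real_of_int k + 1) * l i" "- 1 \<le> k" "k < 2 * int (K i)"
  shows "z \<in> turned i \<longleftrightarrow> even k"
proof
  have h: "y0 i < z \<bullet> e2" "z \<bullet> e2 < y0 i + 2 * real (M i) * d i"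
  proof -
    have b: "y0 i + real r * d i < z \<bullet> e2" "z \<bullet> e2 < y0 i + (real r + 1) * d i"
      using z(1) by (auto simp: strip_def mem_box_corner)
    have "(real r + 1) * d i \<le> 2 * real (M i) * d i" using z(2) d(1)[of i] by (intro mult_right_mono) auto
    moreover have "0 \<le> real r * d i" using d(1)[of i] by simp
    ultimately show "y0 i < z \<bullet> e2" "z \<bullet> e2 < y0 i + 2 * real (M i) * d i" using b by linarith+
  qed
  assume "even k"
  then obtain m where m: "k = 2 * m" by blast
  then have "z \<in> wave i m" using k(1,2) h z(1) by (auto simp: wave_def strip_def mem_box_corner)
  moreover have "m \<in> {- int (K i)..<int (K i)}" using k(3,4) m by auto
  ultimately show "z \<in> turned i" by (auto simp: turned_def)
next
  assume "z \<in> turned i"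
  then obtain m where "z \<in> wave i m" by (auto simp: turned_def)
  then have w: "2 * real_of_int m * l i < z \<bullet> e1" "z \<bullet> e1 < (2 * real_of_int m + 1) * l i"
    by (auto simp: wave_def mem_box_corner)
  have "2 * real_of_int m * l i < (real_of_int k + 1) * l i" "real_of_int k * l i < (2 * real_of_int m + 1) * l i"
    using w k(1,2) by linarith+
  then have "2 * real_of_int m < real_of_int k + 1" "real_of_int k < 2 * real_of_int m + 1"
    using l(1)[of i] by (auto simp: mult_less_cancel_right)
  then have "k = 2 * m" by linarith
  then show "even k" by simp
qed

lemma data_eq:
  assumes z: "z \<in> strip (n + i) r" "r < 2 * M (n + i)"
  shows "a *\<^sub>R \<beta> + perturbation n z =
    (a + (if even r then \<delta> (n + i) else 0)) *\<^sub>R (if z \<in> turned (n + i) then \<omega> (n + i) else \<beta>)"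
  using perturbation_at[OF strip_heights[OF z]] strip_raised_iff[OF z]
  by (simp add: layer_def indicator_def)

lemma norm_data_eq:
  assumes z: "z \<in> strip (n + i) r" "r < 2 * M (n + i)"
  shows "norm (a *\<^sub>R \<beta> + perturbation n z) = a + (if even r then \<delta> (n + i) else 0)"
  unfolding data_eq[OF z] using a \<delta>(1)[of "n + i"] \<omega>(1) \<beta> by simp

end

subsection \<open>Choice of the parameters\<close>

text \<open>\<beta> is moved a little along \<open>k\<close>, orthogonally to \<open>j\<close>, and
  normalized. The move leaves the component \<open>\<beta> \<bullet> j\<close> alone, but the
  normalization divides it by a norm greater than 1, and it is nonzero.\<close>

lemma unit_vector_rotation:
  fixes \<beta> :: "'b::euclidean_space"
  assumes "norm \<beta> = 1" and k: "k \<in> Basis" and j: "j \<in> Basis" "j \<noteq> k" "\<beta> \<bullet> j \<noteq> 0" and \<epsilon>: "0 < \<epsilon>"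
  obtains \<omega> where "norm \<omega> = 1" "norm (\<omega> - \<beta>) \<le> \<epsilon>" "\<omega> \<bullet> j \<noteq> \<beta> \<bullet> j"
proof -
  \<comment> \<open>The sign is chosen such that the move does not shorten the component along
    \<open>k\<close>, which makes the norm of \<open>x\<close> exceed 1.\<close>
  define s where "s = (if 0 \<le> \<beta> \<bullet> k then \<epsilon> / 2 else - (\<epsilon> / 2))"
  define x where "x = \<beta> + s *\<^sub>R k"
  have s: "s \<noteq> 0" "\<bar>s\<bar> = \<epsilon> / 2" "0 \<le> s * (\<beta> \<bullet> k)" using \<epsilon> by (auto simp: s_def mult_nonneg_nonpos)
  have nk: "norm k = 1" "k \<bullet> k = 1" using k by auto
  have "(norm x)\<^sup>2 = \<beta> \<bullet> \<beta> + 2 * (s * (\<beta> \<bullet> k)) + s\<^sup>2 * (k \<bullet> k)"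
    unfolding x_def power2_norm_eq_inner
    by (simp add: inner_add_left inner_add_right inner_commute power2_eq_square algebra_simps)
  moreover have "\<beta> \<bullet> \<beta> = 1" using assms(1) by (simp add: dot_square_norm)
  moreover have "0 < s\<^sup>2" using s(1) by simp
  ultimately have "1\<^sup>2 < (norm x)\<^sup>2" using s(3) unfolding nk(2) power_one mult_1_right by linarith
  then have nx: "1 < norm x" by (rule power2_less_imp_less) simp
  have jk: "k \<bullet> j = 0" using k j by (simp add: inner_not_same_Basis)
  show ?thesis
  proof (rule that[of "sgn x"])
    show "norm (sgn x) = 1" using nx by (auto simp: norm_sgn)
    have "norm (sgn x - x) = \<bar>1 - norm x\<bar>"
    proof -
      have "sgn x - x = (1 - norm x) *\<^sub>R sgn x" by (simp add: scaleR_diff_left norm_scaleR_sgn)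
      then show ?thesis using nx by (auto simp: norm_sgn)
    qed
    also have "\<dots> \<le> \<epsilon> / 2"
      using norm_triangle_ineq3[of x \<beta>] assms(1) s(2) nk(1) by (simp add: x_def abs_minus_commute)
    finally have "norm (sgn x - x) \<le> \<epsilon> / 2" .
    moreover have "norm (x - \<beta>) \<le> \<epsilon> / 2" using s(2) nk(1) by (simp add: x_def)
    ultimately show "norm (sgn x - \<beta>) \<le> \<epsilon>" using norm_triangle_ineq[of "sgn x - x" "x - \<beta>"] by simp
    have "sgn x \<bullet> j = (\<beta> \<bullet> j) / norm x"
      by (simp add: sgn_div_norm x_def inner_add_left jk divide_inverse mult.commute)
    moreover have "norm x \<noteq> 0" using nx by linarith
    ultimately show "sgn x \<bullet> j \<noteq> \<beta> \<bullet> j" using nx j(3) by (metis divide_eq_eq less_irrefl mult_cancel_left1)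
  qed
qed

text \<open>The order of choice matters. \<omega> fixes the jump \<kappa>; \<open>M\<close> is large
  in terms of \<kappa>; \<delta> is small in terms of \<open>M\<close> and \<kappa>; the difference
  of speeds is then known and serves as \<open>l\<close>, which determines \<open>K\<close>; finally
  \<open>d\<close> is small in terms of \<open>M\<close> and \<open>K\<close>.\<close>

lemma shear_parameters_exist:
  fixes g :: "real \<Rightarrow> real" and \<beta> :: "'b::euclidean_space"
  assumes g: "continuous_on UNIV g" "\<And>\<epsilon>. 0 < \<epsilon> \<Longrightarrow> \<exists>x. 0 < x \<and> x < \<epsilon> \<and> g (a + x) \<noteq> g a"
    and \<beta>: "norm \<beta> = 1" and k: "k \<in> Basis" and j: "j \<in> Basis" "j \<noteq> k" "\<beta> \<bullet> j \<noteq> 0" and a: "0 < a" and R: "1 \<le> R"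
  shows "\<exists>\<omega> M K \<delta> d. norm \<omega> = 1 \<and> norm (\<omega> - \<beta>) \<le> (1/2) ^ i \<and> 1 \<le> (M::nat) \<and> 0 < \<delta> \<and> real M * \<delta> \<le> (1/2) ^ i \<and>
     0 < \<bar>g (a + \<delta>) - g a\<bar> \<and> \<bar>g (a + \<delta>) - g a\<bar> \<le> 1 \<and>
     R \<le> real K * \<bar>g (a + \<delta>) - g a\<bar> \<and> real (K::nat) * \<bar>g (a + \<delta>) - g a\<bar> \<le> R + 1 \<and>
     0 < d \<and> 2 * real M * d \<le> (1/2) ^ (i + 1) \<and> real K * (2 * real M * d) \<le> 1 \<and>
     0 < a * \<bar>\<omega> \<bullet> j - \<beta> \<bullet> j\<bar> / 2 \<and> \<delta> \<le> a * \<bar>\<omega> \<bullet> j - \<beta> \<bullet> j\<bar> / 2 \<and>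
     real i + 1 \<le> real M * (min (a * \<bar>\<omega> \<bullet> j - \<beta> \<bullet> j\<bar> / 2) 1) ^ i"
proof -
  obtain \<omega> where \<omega>: "norm \<omega> = 1" "norm (\<omega> - \<beta>) \<le> (1/2) ^ i" "\<omega> \<bullet> j \<noteq> \<beta> \<bullet> j"
    using unit_vector_rotation[OF \<beta> k j, of "(1/2) ^ i"] by auto
  define \<kappa> where "\<kappa> = a * \<bar>\<omega> \<bullet> j - \<beta> \<bullet> j\<bar> / 2"
  have \<kappa>: "0 < \<kappa>" using a \<omega>(3) by (simp add: \<kappa>_def)
  \<comment> \<open>Capping at 1 makes the powers decrease in the exponent, so a bound with exponent
    \<open>i\<close> implies the one with exponent \<open>1 / s\<close> once
    \<open>1 / s \<le> i\<close>.\<close>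
  define q where "q = (min \<kappa> 1) ^ i"
  have q: "0 < q" using \<kappa> by (simp add: q_def)
  obtain M0 :: nat where "(real i + 1) / q \<le> real M0" using real_arch_simple by blast
  define M where "M = Suc M0"
  have Mq: "real i + 1 \<le> real M * q"
  proof -
    have "(real i + 1) / q \<le> real M" using \<open>(real i + 1) / q \<le> real M0\<close> by (simp add: M_def)
    then show ?thesis using q by (simp add: divide_le_eq)
  qed
  have M: "1 \<le> M" by (simp add: M_def)
  have "isCont g a" using g(1) by (simp add: continuous_on_eq_continuous_at)
  then obtain r where r: "0 < r" "\<And>x. \<bar>x - a\<bar> < r \<Longrightarrow> \<bar>g x - g a\<bar> < 1"
    unfolding continuous_at_eps_delta dist_real_def by (metis zero_less_one)
  \<comment> \<open>\<open>r\<close> keeps the difference of speeds below 1, \<kappa> keeps the step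
    of the modulus below the jump of direction, and the last entry keeps the variation of the
    modulus small.\<close>
  define \<epsilon> where "\<epsilon> = min (min r \<kappa>) ((1/2) ^ i / real M)"
  have "0 < \<epsilon>" using r(1) \<kappa> M by (simp add: \<epsilon>_def)
  then obtain \<delta> where \<delta>: "0 < \<delta>" "\<delta> < \<epsilon>" "g (a + \<delta>) \<noteq> g a" using g(2) by blast
  have \<delta>': "\<delta> < r" "\<delta> \<le> \<kappa>" "\<delta> < (1/2) ^ i / real M" using \<delta>(2) by (auto simp: \<epsilon>_def)
  have \<delta>M: "real M * \<delta> \<le> (1/2) ^ i" using \<delta>'(3) M by (simp add: less_divide_eq mult.commute)
  define l where "l = \<bar>g (a + \<delta>) - g a\<bar>"
  have l: "0 < l" "l \<le> 1" using \<delta>(3) r(2)[of "a + \<delta>"] \<delta>(1) \<delta>'(1) by (auto simp: l_def)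
  define K where "K = nat \<lceil>R / l\<rceil>"
  have K': "R / l \<le> real K" "real K \<le> R / l + 1" using R l by (auto simp: K_def intro: less_imp_le)
  have K: "R \<le> real K * l" "real K * l \<le> R + 1"
  proof -
    show "R \<le> real K * l" using K'(1) l by (simp add: divide_le_eq)
    have "real K * l \<le> (R / l + 1) * l" using K'(2) l by (intro mult_right_mono) auto
    also have "\<dots> = R + l" using l by (simp add: field_simps)
    finally show "real K * l \<le> R + 1" using l by linarith
  qed
  define d where "d = (1/2) ^ (i + 1) / (2 * real M * (real K + 1))"
  have "0 < 2 * real M * (real K + 1)" using M by simp
  then have d: "0 < d" unfolding d_def by (intro divide_pos_pos) auto
  have gen: "2 * m * (Q / (2 * m * n)) = Q / n" if "m \<noteq> 0" for m n Q :: real using that by simp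
  have eq: "2 * real M * d = (1/2) ^ (i + 1) / (real K + 1)" unfolding d_def by (rule gen) (use M in simp)
  have d2: "2 * real M * d \<le> (1/2) ^ (i + 1)" unfolding eq by (simp add: divide_le_eq)
  have "(1/2::real) ^ (i + 1) \<le> 1" by (rule power_le_one) auto
  then have "real K * (1/2) ^ (i + 1) \<le> (real K + 1) * 1" by (intro mult_mono) auto
  then have d3: "real K * (2 * real M * d) \<le> 1" unfolding eq by (simp add: divide_le_eq)
  show ?thesis
    using \<omega>(1,2) M \<delta>(1) \<delta>M l K d d2 d3 \<kappa> \<delta>'(2) Mq unfolding l_def \<kappa>_def q_def by blast
qed

context shear_data
begin

subsection \<open>Irregularity of the solution\<close>

text \<open>A point with first coordinate of modulus at most \<open>2 * G + 2\<close> travels at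
  most \<open>G\<close> until time 1, while the cone over the strip loses at most \<open>V\<close>
  at either end, and \<open>R\<close> leaves room for both. Across the strip the cone does not
  narrow; omitting the outer quarters places a closed box inside the open strip.\<close>

lemma transported_in_strip:
  assumes u: "renormalized_entropy_solution (\<lambda>r. g r *\<^sub>R e1) (\<lambda>z. a *\<^sub>R \<beta> + perturbation n z) u"
    and g: "continuous_on UNIV g"
    and lip: "\<And>K. \<exists>V\<ge>0. \<forall>x\<in>{-K..K}. \<forall>y\<in>{-K..K}. \<bar>x * g x - y * g y\<bar> \<le> V * \<bar>x - y\<bar>"
    and V: "0 \<le> V" "\<And>x y. x \<in> {0..2 * a + 2} \<Longrightarrow> y \<in> {0..2 * a + 2} \<Longrightarrow> \<bar>x * g x - y * g y\<bar> \<le> V * \<bar>x - y\<bar>"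
    and G: "\<And>x. x \<in> {0..2 * a + 2} \<Longrightarrow> \<bar>g x\<bar> \<le> G" and RGV: "3 * G + V + 4 \<le> R"
    and t: "0 < t" "t < 1" and r: "r < 2 * M (n + i)"
    and c: "c = a + (if even r then \<delta> (n + i) else 0)"
  shows "AE z in lebesgue. z \<in> box (corner (- (2 * G + 2)) (y0 (n + i) + real r * d (n + i) + d (n + i) / 4) (- 1))
      (corner (2 * G + 2) (y0 (n + i) + real r * d (n + i) + 3 * d (n + i) / 4) 1) \<longrightarrow>
    u (z + (t * g c) *\<^sub>R e1) t \<bullet> j = (a *\<^sub>R \<beta> + perturbation n z) \<bullet> j"
proof (rule renormalized_solution_transported[OF u e1 _ _ g lip V _ _ _ t])
  let ?y = "y0 (n + i) + real r * d (n + i)" and ?y' = "y0 (n + i) + (real r + 1) * d (n + i)"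
  have "perturbation n \<in> borel_measurable lebesgue"
    using perturbation_measurable by (intro measurable_completion) simp
  then show "(\<lambda>z. a *\<^sub>R \<beta> + perturbation n z) \<in> borel_measurable lebesgue"
    by (intro borel_measurable_add borel_measurable_const)
  \<comment> \<open>Modulus \<open>a\<close> plus a perturbation of at most \<open>a + 2\<close>:
    this is the origin of the interval \<open>{0..2 * a + 2}\<close> on which \<open>V\<close> and
    \<open>G\<close> are taken.\<close>
  show "norm (a *\<^sub>R \<beta> + perturbation n z) \<le> 2 * a + 2" for z
  proof -
    have "norm (a *\<^sub>R \<beta> + perturbation n z) \<le> norm (a *\<^sub>R \<beta>) + norm (perturbation n z)" by (rule norm_triangle_ineq)
    also have "norm (a *\<^sub>R \<beta>) = a" using a \<beta> by simp
    also have "norm (perturbation n z) \<le> (a + 2) * (1/2) ^ n" by (rule norm_perturbation_le)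
    also have "\<dots> \<le> (a + 2) * 1" using a by (intro mult_left_mono power_le_one) auto
    finally show ?thesis by simp
  qed
  show cA: "c \<in> {0..2 * a + 2}" using a \<delta>(1)[of "n + i"] \<delta>_le_1[of "n + i"] by (auto simp: c)
  show "norm (a *\<^sub>R \<beta> + perturbation n z) = c" if "z \<in> slab (- R) R ?y ?y'" for z
    using norm_data_eq[of z n i r] r that by (simp add: strip_def c)
  fix q :: real and x assume q: "0 \<le> q" "q \<le> 1"
    and x: "x \<in> cbox (corner (- (2 * G + 2)) (?y + d (n + i) / 4) (- 1)) (corner (2 * G + 2) (?y + 3 * d (n + i) / 4) 1)"
  have b: "- (2 * G + 2) \<le> x \<bullet> e1" "x \<bullet> e1 \<le> 2 * G + 2" "?y + d (n + i) / 4 \<le> x \<bullet> e2" "x \<bullet> e2 \<le> ?y + 3 * d (n + i) / 4"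
    and bi: "\<And>i. i \<in> Basis - {e1, e2} \<Longrightarrow> - 1 \<le> x \<bullet> i \<and> x \<bullet> i \<le> 1"
    using x by (auto simp: mem_cbox_corner)
  have qg: "\<bar>q * g c\<bar> \<le> G"
  proof -
    have "\<bar>q * g c\<bar> = q * \<bar>g c\<bar>" using q by (simp add: abs_mult)
    also have "\<dots> \<le> 1 * \<bar>g c\<bar>" using q by (intro mult_right_mono) auto
    finally show ?thesis using G[OF cA] by simp
  qed
  have qV: "V * q \<le> V" "0 \<le> V * q" using q V(1) by (auto simp: mult_left_le)
  have G0: "0 \<le> G" using G[OF cA] by linarith
  have sp: "(x + s *\<^sub>R e1) \<bullet> e1 = x \<bullet> e1 + s" "(x + s *\<^sub>R e1) \<bullet> e2 = x \<bullet> e2"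
    "i \<in> Basis - {e1, e2} \<Longrightarrow> (x + s *\<^sub>R e1) \<bullet> i = x \<bullet> i" for x s i
    using e1 e2 ne by (auto simp: inner_add_left inner_Basis)
  have sm: "(x - s *\<^sub>R e1) \<bullet> e1 = x \<bullet> e1 - s" "(x - s *\<^sub>R e1) \<bullet> e2 = x \<bullet> e2"
    "i \<in> Basis - {e1, e2} \<Longrightarrow> (x - s *\<^sub>R e1) \<bullet> i = x \<bullet> i" for x s i
    using e1 e2 ne by (auto simp: inner_diff_left inner_Basis)
  have ce: "corner x y r \<bullet> e1 = x" "corner x y r \<bullet> e2 = y" "i \<in> Basis - {e1, e2} \<Longrightarrow> corner x y r \<bullet> i = r" for x y r i
    using e1 e2 ne by (auto simp: corner_inner)
  have d': "0 < d (n + i)" by (rule d(1))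
  show "x + (q * g c) *\<^sub>R e1 \<in> box (corner (- R) ?y (- R) + (V * q) *\<^sub>R e1) (corner R ?y' R - (V * q) *\<^sub>R e1)"
    unfolding mem_box Ball_Basis_split
  proof (intro conjI ballI)
    show "(corner (- R) ?y (- R) + (V * q) *\<^sub>R e1) \<bullet> e1 < (x + (q * g c) *\<^sub>R e1) \<bullet> e1"
      "(x + (q * g c) *\<^sub>R e1) \<bullet> e1 < (corner R ?y' R - (V * q) *\<^sub>R e1) \<bullet> e1"
      unfolding sp sm ce using b(1,2) qg qV RGV by linarith+
    show "(corner (- R) ?y (- R) + (V * q) *\<^sub>R e1) \<bullet> e2 < (x + (q * g c) *\<^sub>R e1) \<bullet> e2"
      unfolding sp sm ce using b(3) d' by linarith
    have "?y' = ?y + d (n + i)" by (simp add: algebra_simps)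
    then show "(x + (q * g c) *\<^sub>R e1) \<bullet> e2 < (corner R ?y' R - (V * q) *\<^sub>R e1) \<bullet> e2"
      unfolding sp sm ce using b(4) d' by linarith
    fix i assume i: "i \<in> Basis - {e1, e2}"
    show "(corner (- R) ?y (- R) + (V * q) *\<^sub>R e1) \<bullet> i < (x + (q * g c) *\<^sub>R e1) \<bullet> i"
      "(x + (q * g c) *\<^sub>R e1) \<bullet> i < (corner R ?y' R - (V * q) *\<^sub>R e1) \<bullet> i"
      unfolding sp(3)[OF i] sm(3)[OF i] ce(3)[OF i] using bi[OF i] RGV G0 V(1) by linarith+
  qed
qed

text \<open>With \<open>\<tau>\<close> equal to \<open>t\<close> times the smaller of the two speeds, the cells are the places where at time
  \<open>t\<close> the waves in the strips \<open>2 r\<close> and \<open>2 r + 1\<close> are out of phase. The outer quarters of the strips are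
  left out.\<close>

definition cell :: "nat \<Rightarrow> real \<Rightarrow> real \<Rightarrow> nat \<Rightarrow> nat \<Rightarrow> 'a set" where
  "cell i \<tau> t r k = box (corner (\<tau> + real k * l i) (y0 i + real (2 * r) * d i + d i / 4) (- 1))
     (corner (\<tau> + real k * l i + t * l i) (y0 i + real (2 * r) * d i + 3 * d i / 4) 1)"

definition cells :: "nat \<Rightarrow> real \<Rightarrow> real \<Rightarrow> 'a set" where
  "cells i \<tau> t = (\<Union>(r, k)\<in>{..<M i} \<times> {..<nat \<lfloor>1 / l i\<rfloor>}. cell i \<tau> t r k)"

text \<open>Rounding \<open>1 / l i\<close> down loses at most half of it, because
  \<open>l i \<le> 1\<close> makes the rounded number at least 1.\<close>

lemma period_count: "real (nat \<lfloor>1 / l i\<rfloor>) * l i \<le> 1" "1 / 2 \<le> real (nat \<lfloor>1 / l i\<rfloor>) * l i"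
proof -
  define N where "N = nat \<lfloor>1 / l i\<rfloor>"
  have l1: "1 \<le> 1 / l i" using l[of i] by simp
  then have "1 \<le> \<lfloor>1 / l i\<rfloor>" by (simp only: one_le_floor)
  moreover have "real (nat m) = of_int m \<and> 1 \<le> real (nat m)" if "1 \<le> m" for m
    using that by (simp add: nat_le_iff Suc_le_eq)
  ultimately have "real N = of_int \<lfloor>1 / l i\<rfloor> \<and> 1 \<le> real N" unfolding N_def by blast
  then have N: "real N \<le> 1 / l i" "1 / l i < real N + 1" "1 \<le> real N"
    using of_int_floor_le[of "1 / l i"] floor_correct[of "1 / l i"] by linarith+
  then show "real (nat \<lfloor>1 / l i\<rfloor>) * l i \<le> 1" using l(1)[of i] by (simp add: N_def[symmetric] le_divide_eq)
  have "1 < (real N + 1) * l i" using N(2) l(1)[of i] by (simp add: divide_less_eq)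
  moreover have "1 * l i \<le> real N * l i" using N(3) l(1)[of i] by (intro mult_right_mono) auto
  ultimately show "1 / 2 \<le> real (nat \<lfloor>1 / l i\<rfloor>) * l i"
    by (simp add: N_def[symmetric] algebra_simps)
qed

text \<open>The cells are disjoint boxes with sides \<open>t * l i\<close> and
  \<open>d i / 2\<close>, the remaining sides being 2 and estimated from below by 1. One factor 1/2
  is the omission of the outer quarters of the strips, the other the rounding in
  \<open>period_count\<close>.\<close>

lemma measure_cells:
  assumes t: "0 < t" "t < 1"
  shows "cells i \<tau> t \<in> sets lborel" "real (M i) * d i * t / 4 \<le> measure lebesgue (cells i \<tau> t)"
    "emeasure lborel (cells i \<tau> t) < \<infinity>"
proof -
  let ?I = "{..<M i} \<times> {..<nat \<lfloor>1 / l i\<rfloor>}"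
  let ?F = "\<lambda>(r, k). cell i \<tau> t r k"
  have cells: "cells i \<tau> t = (\<Union>x\<in>?I. ?F x)" by (simp add: cells_def)
  have cs: "?F x \<in> sets lborel" for x by (cases x) (simp add: cell_def)
  have ef: "emeasure lborel (?F x) < \<infinity>" for x by (cases x) (simp only: cell_def prod.case emeasure_lborel_box_finite)
  have fm: "?F x \<in> fmeasurable lborel" for x using cs[of x] ef[of x] by (intro fmeasurableI) auto
  show sets: "cells i \<tau> t \<in> sets lborel" unfolding cells by (intro sets.finite_UN cs) auto
  have "cells i \<tau> t \<in> fmeasurable lborel" unfolding cells by (intro fmeasurable.finite_UN fm) auto
  then show "emeasure lborel (cells i \<tau> t) < \<infinity>" by (simp add: fmeasurable_def)
  have box: "t * l i * (d i / 2) \<le> measure lborel (?F x)" for x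
  proof -
    obtain r k where x: "x = (r, k)" by (cases x)
    let ?p = "corner (\<tau> + real k * l i) (y0 i + real (2 * r) * d i + d i / 4) (- 1)"
    let ?q = "corner (\<tau> + real k * l i + t * l i) (y0 i + real (2 * r) * d i + 3 * d i / 4) 1"
    have "measure lborel (box ?p ?q) = (\<Prod>b\<in>Basis. (?q - ?p) \<bullet> b)"
      using t l(1)[of i] d(1)[of i] by (intro measure_lborel_box) (auto simp: corner_inner)
    also have "\<dots> = (?q - ?p) \<bullet> e1 * ((?q - ?p) \<bullet> e2 * (\<Prod>b\<in>Basis - {e1} - {e2}. (?q - ?p) \<bullet> b))"
      using e1 e2 ne by (subst prod.remove[of _ e1], simp, simp, subst prod.remove[of _ e2]) auto
    also have "(?q - ?p) \<bullet> e1 = t * l i" using e1 by (simp add: inner_diff_left corner_inner)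
    also have "(?q - ?p) \<bullet> e2 = d i / 2" using e2 ne by (simp add: inner_diff_left corner_inner)
    also have "(\<Prod>b\<in>Basis - {e1} - {e2}. (?q - ?p) \<bullet> b) = (\<Prod>b\<in>Basis - {e1} - {e2}. 2)"
      by (intro prod.cong refl) (simp add: inner_diff_left corner_inner)
    also have "\<dots> = 2 ^ card (Basis - {e1} - {e2})" by simp
    finally have eq: "measure lborel (box ?p ?q) = t * l i * (d i / 2) * 2 ^ card (Basis - {e1} - {e2})" by simp
    have "t * l i * (d i / 2) * 1 \<le> t * l i * (d i / 2) * 2 ^ card (Basis - {e1} - {e2})"
      using t l(1)[of i] d(1)[of i] by (intro mult_left_mono) auto
    then show ?thesis unfolding x cell_def prod.case eq by simp
  qed
  have disj: "pairwise (\<lambda>x y. disjnt (?F x) (?F y)) ?I"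
  proof (rule pairwiseI)
    fix x y :: "nat \<times> nat" assume "x \<noteq> y"
    obtain r k r' k' where xy: "x = (r, k)" "y = (r', k')" by (cases x, cases y)
    show "disjnt (?F x) (?F y)"
    proof (rule ccontr)
      assume "\<not> disjnt (?F x) (?F y)"
      then obtain z where z: "z \<in> cell i \<tau> t r k" "z \<in> cell i \<tau> t r' k'" unfolding disjnt_def xy by auto
      have "real (2 * r) * d i < real (2 * r') * d i + d i" "real (2 * r') * d i < real (2 * r) * d i + d i"
        using z d(1)[of i] unfolding cell_def mem_box_corner by linarith+
      then have "real (2 * r) * d i < (real (2 * r') + 1) * d i" "real (2 * r') * d i < (real (2 * r) + 1) * d i"
        by (simp_all add: algebra_simps)
      then have "real (2 * r) < real (2 * r') + 1" "real (2 * r') < real (2 * r) + 1"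
        using d(1)[of i] by (simp_all only: mult_less_cancel_right_pos)
      then have r: "r = r'" by linarith
      have "t * l i \<le> 1 * l i" using t l(1)[of i] by (intro mult_right_mono) auto
      then have "real k * l i < real k' * l i + l i" "real k' * l i < real k * l i + l i"
        using z unfolding cell_def mem_box_corner by linarith+
      then have "real k * l i < (real k' + 1) * l i" "real k' * l i < (real k + 1) * l i"
        by (simp_all add: algebra_simps)
      then have "real k < real k' + 1" "real k' < real k + 1"
        using l(1)[of i] by (simp_all only: mult_less_cancel_right_pos)
      then have "k = k'" by linarith
      with r \<open>x \<noteq> y\<close> xy show False by simp
    qed
  qed
  have "real (M i) * d i * t / 4 = real (M i) * (1 / 2) * (t * (d i / 2))" by simp
  also have "\<dots> \<le> real (M i) * (real (nat \<lfloor>1 / l i\<rfloor>) * l i) * (t * (d i / 2))"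
    using period_count(2)[of i] t d(1)[of i] by (intro mult_right_mono mult_left_mono) auto
  also have "\<dots> = (\<Sum>x\<in>?I. t * l i * (d i / 2))" by (simp add: card_cartesian_product)
  also have "\<dots> \<le> (\<Sum>x\<in>?I. measure lborel (?F x))" by (intro sum_mono box)
  also have "\<dots> = measure lborel (cells i \<tau> t)"
    unfolding cells by (rule measure_UNION'[symmetric, OF _ fm disj]) simp
  also have "\<dots> = measure lebesgue (cells i \<tau> t)" using sets by simp
  finally show "real (M i) * d i * t / 4 \<le> measure lebesgue (cells i \<tau> t)" .
qed


text \<open>The change of direction alone contributes \<open>a * \<bar>\<omega> (n + i) \<bullet> j
  - \<beta> \<bullet> j\<bar>\<close>. The change of modulus can undo at most
  \<open>\<delta> (n + i)\<close>, which is at most half of it.\<close>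

lemma jump_between_strips:
  assumes x: "x \<in> strip (n + i) (2 * r)" "r < M (n + i)" and x': "x' \<in> strip (n + i) (2 * r + 1)"
    and alt: "x \<in> turned (n + i) \<longleftrightarrow> x' \<notin> turned (n + i)"
    and j: "j \<in> Basis" and \<kappa>: "\<delta> (n + i) \<le> a * \<bar>\<omega> (n + i) \<bullet> j - \<beta> \<bullet> j\<bar> / 2"
  shows "a * \<bar>\<omega> (n + i) \<bullet> j - \<beta> \<bullet> j\<bar> / 2 \<le>
    \<bar>(a *\<^sub>R \<beta> + perturbation n x') \<bullet> j - (a *\<^sub>R \<beta> + perturbation n x) \<bullet> j\<bar>"
proof -
  let ?W = "if x \<in> turned (n + i) then \<omega> (n + i) else \<beta>" and ?W' = "if x' \<in> turned (n + i) then \<omega> (n + i) else \<beta>"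
  have e: "(a *\<^sub>R \<beta> + perturbation n x) \<bullet> j = (a + \<delta> (n + i)) * (?W \<bullet> j)"
    "(a *\<^sub>R \<beta> + perturbation n x') \<bullet> j = a * (?W' \<bullet> j)"
    using data_eq[OF x(1)] data_eq[OF x'] x(2) by simp_all
  have "\<bar>?W \<bullet> j\<bar> \<le> 1" using Basis_le_norm[OF j] \<omega>(1)[of "n + i"] \<beta> by (metis (full_types))
  then have "\<delta> (n + i) * \<bar>?W \<bullet> j\<bar> \<le> \<delta> (n + i) * 1" using \<delta>(1)[of "n + i"] by (intro mult_left_mono) auto
  then have 1: "\<bar>\<delta> (n + i) * (?W \<bullet> j)\<bar> \<le> \<delta> (n + i)" using \<delta>(1)[of "n + i"] by (simp add: abs_mult)
  have 2: "\<bar>a * (?W' \<bullet> j) - a * (?W \<bullet> j)\<bar> = a * \<bar>\<omega> (n + i) \<bullet> j - \<beta> \<bullet> j\<bar>"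
  proof -
    have "a * (?W' \<bullet> j) - a * (?W \<bullet> j) = a * (?W' \<bullet> j - ?W \<bullet> j)" by (simp only: right_diff_distrib)
    moreover have "\<bar>?W' \<bullet> j - ?W \<bullet> j\<bar> = \<bar>\<omega> (n + i) \<bullet> j - \<beta> \<bullet> j\<bar>" using alt by (auto simp: abs_minus_commute)
    ultimately show ?thesis using a by (simp only: abs_mult abs_of_pos)
  qed
  have "a * (?W' \<bullet> j) - (a + \<delta> (n + i)) * (?W \<bullet> j) = (a * (?W' \<bullet> j) - a * (?W \<bullet> j)) - \<delta> (n + i) * (?W \<bullet> j)"
    by (simp only: distrib_right diff_diff_eq)
  then show ?thesis unfolding e using 1 2 \<kappa> by linarith
qed

text \<open>\<open>x\<close> and \<open>x'\<close> are the feet at time 0 of the characteristics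
  through \<open>z\<close> and through the point at height \<open>d\<close> above it, in the raised
  strip and in the next one. The foot of the slower wave lies in the interval with index
  \<open>k\<close>, that of the faster one in the interval with index \<open>k - 1\<close>, so
  exactly one of them is turned. A cell has first coordinates of modulus at most
  \<open>G + 1\<close>, and going back along a characteristic adds at most \<open>G\<close>; this
  explains the boxes of half width \<open>2 * G + 2\<close>.\<close>

lemma cell_values:
  assumes g: "l (n + i) = \<bar>g (a + \<delta> (n + i)) - g a\<bar>"
    and t: "0 < t" "t < 1" and z: "z \<in> cell (n + i) (t * min (g (a + \<delta> (n + i))) (g a)) t r k"
    and rk: "r < M (n + i)" "k < nat \<lfloor>1 / l (n + i)\<rfloor>"
    and G: "\<bar>g a\<bar> \<le> G" "\<bar>g (a + \<delta> (n + i))\<bar> \<le> G" and RG: "3 * G + 4 \<le> R"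
    and j: "j \<in> Basis" and \<kappa>: "\<delta> (n + i) \<le> a * \<bar>\<omega> (n + i) \<bullet> j - \<beta> \<bullet> j\<bar> / 2"
  defines "x \<equiv> z - (t * g (a + \<delta> (n + i))) *\<^sub>R e1" and "x' \<equiv> z + d (n + i) *\<^sub>R e2 - (t * g a) *\<^sub>R e1"
  shows "x \<in> box (corner (- (2 * G + 2)) (y0 (n + i) + real (2 * r) * d (n + i) + d (n + i) / 4) (- 1))
      (corner (2 * G + 2) (y0 (n + i) + real (2 * r) * d (n + i) + 3 * d (n + i) / 4) 1)"
    and "x' \<in> box (corner (- (2 * G + 2)) (y0 (n + i) + real (2 * r + 1) * d (n + i) + d (n + i) / 4) (- 1))
      (corner (2 * G + 2) (y0 (n + i) + real (2 * r + 1) * d (n + i) + 3 * d (n + i) / 4) 1)"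
    and "a * \<bar>\<omega> (n + i) \<bullet> j - \<beta> \<bullet> j\<bar> / 2 \<le>
      \<bar>(a *\<^sub>R \<beta> + perturbation n x') \<bullet> j - (a *\<^sub>R \<beta> + perturbation n x) \<bullet> j\<bar>"
    and "z \<in> cbox (- ((G + 2) *\<^sub>R One)) ((G + 2) *\<^sub>R One)"
proof -
  define N where "N = n + i"
  define \<tau> where "\<tau> = t * min (g (a + \<delta> N)) (g a)"
  note lN = l[of N] and dN = d(1)[of N]
  have zb: "\<tau> + real k * l N < z \<bullet> e1" "z \<bullet> e1 < \<tau> + real k * l N + t * l N"
    "y0 N + real (2 * r) * d N + d N / 4 < z \<bullet> e2" "z \<bullet> e2 < y0 N + real (2 * r) * d N + 3 * d N / 4"
    and zi: "\<And>i. i \<in> Basis - {e1, e2} \<Longrightarrow> - 1 < z \<bullet> i \<and> z \<bullet> i < 1"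
    using z unfolding cell_def mem_box_corner N_def[symmetric] \<tau>_def[symmetric] by blast+
  have xc: "x \<bullet> e1 = z \<bullet> e1 - t * g (a + \<delta> N)" "x \<bullet> e2 = z \<bullet> e2" "\<And>i. i \<in> Basis - {e1, e2} \<Longrightarrow> x \<bullet> i = z \<bullet> i"
    and xc': "x' \<bullet> e1 = z \<bullet> e1 - t * g a" "x' \<bullet> e2 = z \<bullet> e2 + d N" "\<And>i. i \<in> Basis - {e1, e2} \<Longrightarrow> x' \<bullet> i = z \<bullet> i"
    using e1 e2 ne by (auto simp: x_def x'_def N_def inner_diff_left inner_add_left inner_Basis)
  have kl: "real k * l N + l N \<le> 1"
  proof -
    have "real k + 1 \<le> real (nat \<lfloor>1 / l N\<rfloor>)" using rk(2) by (simp add: N_def)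
    then have "(real k + 1) * l N \<le> real (nat \<lfloor>1 / l N\<rfloor>) * l N" using lN by (intro mult_right_mono) auto
    then show ?thesis using period_count(1)[of N] by (simp add: algebra_simps)
  qed
  have tl: "0 < t * l N" "t * l N < l N" "0 \<le> real k * l N" using t lN by auto
  have tG: "\<bar>t * y\<bar> \<le> G" if "\<bar>y\<bar> \<le> G" for y
  proof -
    have "t * \<bar>y\<bar> \<le> 1 * \<bar>y\<bar>" using t by (intro mult_right_mono) auto
    then show ?thesis using that t by (simp add: abs_mult)
  qed
  have G1: "\<bar>t * g a\<bar> \<le> G" "\<bar>t * g (a + \<delta> N)\<bar> \<le> G" using G by (auto simp: N_def intro: tG)
  have G2: "\<bar>\<tau>\<bar> \<le> G" unfolding \<tau>_def by (rule tG) (use G in \<open>auto simp: N_def min_def\<close>)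
  have y: "real (2 * r + 1) * d N = real (2 * r) * d N + d N" by (simp add: algebra_simps)
  show bx: "x \<in> box (corner (- (2 * G + 2)) (y0 (n + i) + real (2 * r) * d (n + i) + d (n + i) / 4) (- 1))
      (corner (2 * G + 2) (y0 (n + i) + real (2 * r) * d (n + i) + 3 * d (n + i) / 4) 1)"
    unfolding mem_box_corner N_def[symmetric]
  proof (intro conjI ballI)
    show "- (2 * G + 2) < x \<bullet> e1" "x \<bullet> e1 < 2 * G + 2" unfolding xc using zb(1,2) G1 G2 kl tl lN by linarith+
    show "y0 N + real (2 * r) * d N + d N / 4 < x \<bullet> e2" "x \<bullet> e2 < y0 N + real (2 * r) * d N + 3 * d N / 4"
      unfolding xc using zb(3,4) by auto
  qed (use xc(3) zi in auto)
  show bx': "x' \<in> box (corner (- (2 * G + 2)) (y0 (n + i) + real (2 * r + 1) * d (n + i) + d (n + i) / 4) (- 1))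
      (corner (2 * G + 2) (y0 (n + i) + real (2 * r + 1) * d (n + i) + 3 * d (n + i) / 4) 1)"
    unfolding mem_box_corner N_def[symmetric]
  proof (intro conjI ballI)
    show "- (2 * G + 2) < x' \<bullet> e1" "x' \<bullet> e1 < 2 * G + 2" unfolding xc' using zb(1,2) G1 G2 kl tl lN by linarith+
    show "y0 N + real (2 * r + 1) * d N + d N / 4 < x' \<bullet> e2" "x' \<bullet> e2 < y0 N + real (2 * r + 1) * d N + 3 * d N / 4"
      unfolding xc' y using zb(3,4) by linarith+
  qed (use xc'(3) zi in auto)
  have G0: "0 \<le> G" using G(1) by linarith
  have strip: "w \<in> strip N q" if "w \<in> box (corner (- (2 * G + 2)) (y0 N + real q * d N + d N / 4) (- 1))
      (corner (2 * G + 2) (y0 N + real q * d N + 3 * d N / 4) 1)" for w q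
    unfolding strip_def mem_box_corner
  proof (intro conjI ballI)
    have b: "- (2 * G + 2) < w \<bullet> e1" "w \<bullet> e1 < 2 * G + 2" "y0 N + real q * d N + d N / 4 < w \<bullet> e2"
      "w \<bullet> e2 < y0 N + real q * d N + 3 * d N / 4" and bi: "\<And>i. i \<in> Basis - {e1, e2} \<Longrightarrow> - 1 < w \<bullet> i \<and> w \<bullet> i < 1"
      using that unfolding mem_box_corner by blast+
    show "- R < w \<bullet> e1" "w \<bullet> e1 < R" using b RG G0 by linarith+
    have "(real q + 1) * d N = real q * d N + d N" by (simp add: algebra_simps)
    then show "y0 N + real q * d N < w \<bullet> e2" "w \<bullet> e2 < y0 N + (real q + 1) * d N" using b dN by linarith+
    fix i assume i: "i \<in> Basis - {e1, e2}"
    show "- R < w \<bullet> i" "w \<bullet> i < R" using bi[OF i] RG G0 by linarith+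
  qed
  have sx: "x \<in> strip N (2 * r)" by (rule strip) (use bx in \<open>simp only: N_def\<close>)
  have sx': "x' \<in> strip N (2 * r + 1)" by (rule strip) (use bx' in \<open>simp only: N_def\<close>)
  \<comment> \<open>The cells stay within unit length, and the wave extends beyond
    \<open>R \<ge> 1\<close>, so the index is in range.\<close>
  have kK: "int k < 2 * int (K N)"
  proof -
    have "real k * l N < real (K N) * l N" using kl K(1)[of N] R lN by linarith
    then have "k < K N" using lN by simp
    then show ?thesis by linarith
  qed
  \<comment> \<open>\<open>on\<close> describes the first part of interval \<open>k\<close>, where
    the slower wave is read; \<open>off\<close> the last part of interval \<open>k - 1\<close>,
    where the faster one is read.\<close>
  have on: "w \<in> turned N \<longleftrightarrow> even k" if "w \<in> strip N q" "q < 2 * M N" "real k * l N < w \<bullet> e1" "w \<bullet> e1 < real k * l N + t * l N" for w q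
    using strip_turned_iff[OF that(1,2), of "int k"] that(3,4) tl(2) kK by (simp add: algebra_simps)
  have off: "w \<in> turned N \<longleftrightarrow> odd k" if "w \<in> strip N q" "q < 2 * M N" "real k * l N - t * l N < w \<bullet> e1" "w \<bullet> e1 < real k * l N" for w q
    using strip_turned_iff[OF that(1,2), of "int k - 1"] that(3,4) tl(2) kK by (simp add: algebra_simps)
  have r2: "2 * r < 2 * M N" "2 * r + 1 < 2 * M N" using rk(1) by (auto simp: N_def)
  have alt: "x \<in> turned N \<longleftrightarrow> x' \<notin> turned N"
  proof (cases "g a \<le> g (a + \<delta> N)")
    case True
    have "g (a + \<delta> N) = g a + l N" using True g by (simp add: N_def)
    then have "t * g (a + \<delta> N) = t * g a + t * l N" by (simp only: distrib_left)
    moreover have "\<tau> = t * g a" using True by (simp add: \<tau>_def)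
    ultimately show ?thesis
      using off[OF sx r2(1)] on[OF sx' r2(2)] zb(1,2) unfolding xc(1) xc'(1) by auto
  next
    case False
    have "g a = g (a + \<delta> N) + l N" using False g by (simp add: N_def)
    then have "t * g a = t * g (a + \<delta> N) + t * l N" by (metis distrib_left)
    moreover have "\<tau> = t * g (a + \<delta> N)" using False by (simp add: \<tau>_def)
    ultimately show ?thesis
      using on[OF sx r2(1)] off[OF sx' r2(2)] zb(1,2) unfolding xc(1) xc'(1) by auto
  qed
  show "a * \<bar>\<omega> (n + i) \<bullet> j - \<beta> \<bullet> j\<bar> / 2 \<le>
      \<bar>(a *\<^sub>R \<beta> + perturbation n x') \<bullet> j - (a *\<^sub>R \<beta> + perturbation n x) \<bullet> j\<bar>"
    using jump_between_strips[of x n i r x', OF _ rk(1) _ _ j \<kappa>] sx sx' alt by (simp only: N_def)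
  have h: "y0 N < z \<bullet> e2" "z \<bullet> e2 < 2 * y0 N"
    using strip_heights[OF sx r2(1)] unfolding xc by auto
  have "y0 N \<le> 1 / 2" "0 \<le> y0 N" using power_le_one[of "1/2::real" N] by (auto simp: y0_def)
  then have "\<bar>z \<bullet> e2\<bar> \<le> G + 2" using h G0 by linarith
  moreover have "\<bar>z \<bullet> e1\<bar> \<le> G + 2" using zb(1,2) G2 kl tl by linarith
  moreover have "\<bar>z \<bullet> i\<bar> \<le> G + 2" if "i \<in> Basis - {e1, e2}" for i using zi[OF that] G0 by linarith
  ultimately have "\<forall>i\<in>Basis. \<bar>z \<bullet> i\<bar> \<le> G + 2" unfolding Ball_Basis_split by blast
  then show "z \<in> cbox (- ((G + 2) *\<^sub>R One)) ((G + 2) *\<^sub>R One)" by (auto simp: mem_box abs_le_iff)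
qed


text \<open>On the cells a shift by \<open>d\<close> along \<open>e2\<close> changes component
  \<open>j\<close> of \<open>u\<close> by at least \<kappa>, hence \<open>v\<close> by at least
  \<open>(\<kappa> / C) powr (1 / s)\<close>. Integrating gives a quantity proportional to
  \<open>M * d\<close> below a bound \<open>d\<close> times the variation; \<open>d\<close> cancels
  and the number of strips remains.\<close>

lemma cell_variation_bound:
  fixes u :: "'a \<Rightarrow> real \<Rightarrow> 'b" and \<theta> :: "'a \<Rightarrow> real"
  assumes u: "renormalized_entropy_solution (\<lambda>r. g r *\<^sub>R e1) (\<lambda>z. a *\<^sub>R \<beta> + perturbation n z) u"
    and g: "continuous_on UNIV g"
    and lip: "\<And>K. \<exists>V\<ge>0. \<forall>x\<in>{-K..K}. \<forall>y\<in>{-K..K}. \<bar>x * g x - y * g y\<bar> \<le> V * \<bar>x - y\<bar>"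
    and V: "0 \<le> V" "\<And>x y. x \<in> {0..2 * a + 2} \<Longrightarrow> y \<in> {0..2 * a + 2} \<Longrightarrow> \<bar>x * g x - y * g y\<bar> \<le> V * \<bar>x - y\<bar>"
    and G: "\<And>x. x \<in> {0..2 * a + 2} \<Longrightarrow> \<bar>g x\<bar> \<le> G" and RGV: "3 * G + V + 4 \<le> R"
    and lg: "l (n + i) = \<bar>g (a + \<delta> (n + i)) - g a\<bar>"
    and j: "j \<in> Basis" and \<kappa>: "\<delta> (n + i) \<le> \<kappa>" "\<kappa> = a * \<bar>\<omega> (n + i) \<bullet> j - \<beta> \<bullet> j\<bar> / 2"
    and t: "0 < t" "t < 1" and s: "0 < s"
    and L: "\<And>x y. \<bar>L x - L y\<bar> \<le> C * \<bar>x - y\<bar> powr s" "0 < C"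
    and v: "BV_loc v" "AE z in lebesgue. u z t \<bullet> j = L (v z)"
    and b: "test_function \<theta>" "\<And>x. 0 \<le> \<theta> x" "\<And>x. \<theta> x \<le> 1" "\<And>x. \<rho> \<le> norm x \<Longrightarrow> \<theta> x = 0"
    and c0: "0 \<le> c0" "\<And>x. x \<in> cbox (- ((G + 2) *\<^sub>R One)) ((G + 2) *\<^sub>R One) \<Longrightarrow> c0 \<le> \<theta> x"
  shows "c0 * (\<kappa> / C) powr (1 / s) * (real (M (n + i)) * t / 4) \<le> enn2real (total_variation (ball 0 (\<rho> + 2)) v)"
proof -
  let ?N = "n + i"
  let ?g1 = "g (a + \<delta> ?N)" and ?g0 = "g a"
  let ?d = "d ?N"
  let ?T = "enn2real (total_variation (ball 0 (\<rho> + 2)) v)"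
  let ?x = "\<lambda>z. z - (t * ?g1) *\<^sub>R e1" and ?x' = "\<lambda>z. z + ?d *\<^sub>R e2 - (t * ?g0) *\<^sub>R e1"
  let ?B = "\<lambda>q. box (corner (- (2 * G + 2)) (y0 ?N + real q * ?d + ?d / 4) (- 1))
      (corner (2 * G + 2) (y0 ?N + real q * ?d + 3 * ?d / 4) 1)"
  have tr: "AE z in lebesgue. z \<in> ?B q \<longrightarrow> u (z + (t * g c) *\<^sub>R e1) t \<bullet> j = (a *\<^sub>R \<beta> + perturbation n z) \<bullet> j"
    if "q < 2 * M ?N" "c = a + (if even q then \<delta> ?N else 0)" for q c
    by (rule transported_in_strip[OF u g lip V G RGV t that])
  have even: "AE z in lebesgue. ?x z \<in> ?B (2 * r) \<longrightarrow> u z t \<bullet> j = (a *\<^sub>R \<beta> + perturbation n (?x z)) \<bullet> j"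
    if "r < M ?N" for r
  proof -
    have "AE z in lebesgue. z \<in> ?B (2 * r) \<longrightarrow> u (z + (t * ?g1) *\<^sub>R e1) t \<bullet> j = (a *\<^sub>R \<beta> + perturbation n z) \<bullet> j"
      by (rule tr) (use that in auto)
    from AE_lebesgue_shift[OF this, of "- ((t * ?g1) *\<^sub>R e1)"] show ?thesis by simp
  qed
  have odd: "AE z in lebesgue. ?x' z \<in> ?B (2 * r + 1) \<longrightarrow> u (z + ?d *\<^sub>R e2) t \<bullet> j = (a *\<^sub>R \<beta> + perturbation n (?x' z)) \<bullet> j"
    if "r < M ?N" for r
  proof -
    have "AE z in lebesgue. z \<in> ?B (2 * r + 1) \<longrightarrow> u (z + (t * ?g0) *\<^sub>R e1) t \<bullet> j = (a *\<^sub>R \<beta> + perturbation n z) \<bullet> j"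
      by (rule tr) (use that in auto)
    from AE_lebesgue_shift[OF this, of "?d *\<^sub>R e2 - (t * ?g0) *\<^sub>R e1"]
    show ?thesis by (rule eventually_mono) (simp add: algebra_simps)
  qed
  have v2: "AE z in lebesgue. u (z + ?d *\<^sub>R e2) t \<bullet> j = L (v (z + ?d *\<^sub>R e2))"
    using AE_lebesgue_shift[OF v(2), of "?d *\<^sub>R e2"] by (simp add: add.commute)
  \<comment> \<open>The exceptional null sets depend on the strip; as there are finitely many
    strips, one null set serves for all.\<close>
  have all_even: "AE z in lebesgue. \<forall>r\<in>{..<M ?N}. ?x z \<in> ?B (2 * r) \<longrightarrow> u z t \<bullet> j = (a *\<^sub>R \<beta> + perturbation n (?x z)) \<bullet> j"
    by (rule AE_finite_allI) (use even in auto)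
  have all_odd: "AE z in lebesgue. \<forall>r\<in>{..<M ?N}. ?x' z \<in> ?B (2 * r + 1) \<longrightarrow> u (z + ?d *\<^sub>R e2) t \<bullet> j = (a *\<^sub>R \<beta> + perturbation n (?x' z)) \<bullet> j"
    by (rule AE_finite_allI) (use odd in auto)
  define E where "E = cells ?N (t * min ?g1 ?g0) t"
  let ?p = "(\<kappa> / C) powr (1 / s)"
  have inA: "a \<in> {0..2 * a + 2}" "a + \<delta> ?N \<in> {0..2 * a + 2}" using a \<delta>(1)[of ?N] \<delta>_le_1[of ?N] by auto
  have V0: "3 * G + 4 \<le> R" using RGV V(1) by linarith
  have \<kappa>0: "0 < \<kappa>" using \<kappa>(1) \<delta>(1)[of ?N] by linarith
  have "AE z in lebesgue. c0 * ?p * indicator E z \<le> \<theta> z * \<bar>v (z + ?d *\<^sub>R e2) - v z\<bar>"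
    using v(2) v2 all_even all_odd
  proof eventually_elim
    case (elim z)
    show ?case
    proof (cases "z \<in> E")
      case True
      then obtain r k where rk: "r < M ?N" "k < nat \<lfloor>1 / l ?N\<rfloor>" and z: "z \<in> cell ?N (t * min ?g1 ?g0) t r k"
        by (auto simp: E_def cells_def)
      note cv = cell_values[OF lg t z rk G[OF inA(1)] G[OF inA(2)] V0 j \<kappa>(1)[unfolded \<kappa>(2)]]
      have r: "r \<in> {..<M ?N}" using rk(1) by simp
      have "u z t \<bullet> j = (a *\<^sub>R \<beta> + perturbation n (?x z)) \<bullet> j"
        by (rule mp[OF bspec[OF elim(3) r] cv(1)])
      moreover have "u (z + ?d *\<^sub>R e2) t \<bullet> j = (a *\<^sub>R \<beta> + perturbation n (?x' z)) \<bullet> j"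
        by (rule mp[OF bspec[OF elim(4) r] cv(2)])
      ultimately have "\<kappa> \<le> \<bar>u (z + ?d *\<^sub>R e2) t \<bullet> j - u z t \<bullet> j\<bar>"
        using cv(3) unfolding \<kappa>(2) by (simp only:)
      also have "\<dots> \<le> C * \<bar>v (z + ?d *\<^sub>R e2) - v z\<bar> powr s"
        unfolding elim(1,2) by (rule L(1))
      finally have "\<kappa> / C \<le> \<bar>v (z + ?d *\<^sub>R e2) - v z\<bar> powr s" using L(2) by (simp add: divide_le_eq mult.commute)
      then have "?p \<le> (\<bar>v (z + ?d *\<^sub>R e2) - v z\<bar> powr s) powr (1 / s)"
        using s \<kappa>0 L(2) by (intro powr_mono2) auto
      also have "\<dots> = \<bar>v (z + ?d *\<^sub>R e2) - v z\<bar>" using s by (simp add: powr_powr)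
      finally have "?p \<le> \<bar>v (z + ?d *\<^sub>R e2) - v z\<bar>" .
      then have "c0 * ?p \<le> \<theta> z * \<bar>v (z + ?d *\<^sub>R e2) - v z\<bar>"
        using c0(2)[OF cv(4)] c0(1) b(2)[of z] by (intro mult_mono) auto
      then show ?thesis using True by simp
    qed (use b(2) in simp)
  qed
  moreover have "integrable lebesgue (\<lambda>z. c0 * ?p * indicator E z)"
    using measure_cells(1,3)[OF t, of ?N "t * min ?g1 ?g0"] by (intro integrable_mult_right) (simp add: E_def)
  moreover have "integrable lebesgue (\<lambda>z. \<theta> z * \<bar>v (z + ?d *\<^sub>R e2) - v z\<bar>)"
    by (rule BV_loc_shift_integrable[OF v(1) b(1,2)])
  ultimately have "(\<integral>z. c0 * ?p * indicator E z \<partial>lebesgue) \<le> (\<integral>z. \<theta> z * \<bar>v (z + ?d *\<^sub>R e2) - v z\<bar> \<partial>lebesgue)"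
    by (intro integral_mono_AE)
  also have "\<dots> \<le> ?d * ?T"
    by (rule BV_loc_shift_le[OF v(1) b e2 d(1) d_le_1])
  finally have "c0 * ?p * measure lebesgue E \<le> ?d * ?T" by simp
  moreover have "c0 * ?p * (real (M ?N) * ?d * t / 4) \<le> c0 * ?p * measure lebesgue E"
    unfolding E_def using c0(1) by (intro mult_left_mono measure_cells(2)[OF t]) auto
  ultimately have "?d * (c0 * ?p * (real (M ?N) * t / 4)) \<le> ?d * ?T" by (simp add: mult_ac)
  then show ?thesis using d(1)[of ?N] by (simp only: mult_le_cancel_left_pos)
qed

text \<open>The lower bound \<open>A * (real (M N) * \<kappa>' powr (1 / s))\<close> for the
  variation of \<open>v\<close> holds in every layer \<open>N \<ge> n\<close> with the same constant
  \<open>A\<close> and on the same ball. By \<open>growth\<close> it is unbounded in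
  \<open>N\<close>, whereas the variation of \<open>v\<close> on the ball is finite.\<close>

lemma not_BVs_loc_scalar:
  assumes u: "renormalized_entropy_solution (\<lambda>r. g r *\<^sub>R e1) (\<lambda>z. a *\<^sub>R \<beta> + perturbation n z) u"
    and g: "continuous_on UNIV g"
    and lip: "\<And>K. \<exists>V\<ge>0. \<forall>x\<in>{-K..K}. \<forall>y\<in>{-K..K}. \<bar>x * g x - y * g y\<bar> \<le> V * \<bar>x - y\<bar>"
    and V: "0 \<le> V" "\<And>x y. x \<in> {0..2 * a + 2} \<Longrightarrow> y \<in> {0..2 * a + 2} \<Longrightarrow> \<bar>x * g x - y * g y\<bar> \<le> V * \<bar>x - y\<bar>"
    and G: "\<And>x. x \<in> {0..2 * a + 2} \<Longrightarrow> \<bar>g x\<bar> \<le> G" and RGV: "3 * G + V + 4 \<le> R"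
    and lg: "\<And>i. l i = \<bar>g (a + \<delta> i) - g a\<bar>"
    and j: "j \<in> Basis" and \<kappa>: "\<And>i. \<delta> i \<le> a * \<bar>\<omega> i \<bullet> j - \<beta> \<bullet> j\<bar> / 2"
    and growth: "\<And>i. real i + 1 \<le> real (M i) * (min (a * \<bar>\<omega> i \<bullet> j - \<beta> \<bullet> j\<bar> / 2) 1) ^ i"
    and t: "0 < t" "t < 1" and s: "0 < s"
  shows "\<not> BVs_loc_scalar s (\<lambda>z. u z t \<bullet> j)"
proof
  assume "BVs_loc_scalar s (\<lambda>z. u z t \<bullet> j)"
  then obtain L v C' where C': "\<And>x y. \<bar>L x - L y\<bar> \<le> C' * \<bar>x - y\<bar> powr s"
    and v: "BV_loc v" "AE z in lebesgue. u z t \<bullet> j = L (v z)"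
    unfolding BVs_loc_scalar_def Lip_s_def by blast
  define C where "C = max C' 1"
  have L: "\<bar>L x - L y\<bar> \<le> C * \<bar>x - y\<bar> powr s" for x y
  proof -
    have "C' * \<bar>x - y\<bar> powr s \<le> C * \<bar>x - y\<bar> powr s" by (intro mult_right_mono) (auto simp: C_def)
    then show ?thesis using C'[of x y] by linarith
  qed
  have C: "0 < C" by (simp add: C_def)
  have "0 \<le> \<bar>g 0\<bar>" "\<bar>g 0\<bar> \<le> G" using G[of 0] a by auto
  then have G0: "0 \<le> G" by linarith
  \<comment> \<open>The bump lives on a cube slightly larger than the one containing all cells of
    all layers, so it has a positive minimum \<open>c0\<close> on the latter.\<close>
  define \<theta> :: "'a \<Rightarrow> real" where "\<theta> = box_bump (- ((G + 3) *\<^sub>R One)) ((G + 3) *\<^sub>R One)"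
  have b: "test_function \<theta>" "\<And>x. 0 \<le> \<theta> x" "\<And>x. \<theta> x \<le> 1"
    unfolding \<theta>_def by (auto simp: test_function_box_bump box_bump_nonneg box_bump_le_1)
  obtain \<rho> where \<rho>: "\<And>x. \<rho> \<le> norm x \<Longrightarrow> \<theta> x = 0" using test_function_support[OF b(1)] by blast
  let ?K = "cbox (- ((G + 2) *\<^sub>R One)) ((G + 2) *\<^sub>R One) :: 'a set"
  have "0 \<in> ?K" using G0 by (simp add: mem_box)
  then have "?K \<noteq> {}" by blast
  then obtain x0 where x0: "x0 \<in> ?K" "\<And>x. x \<in> ?K \<Longrightarrow> \<theta> x0 \<le> \<theta> x"
    using continuous_attains_inf[OF compact_cbox _ C_k_imp_continuous_on[OF test_function_C_k[OF b(1)]]] by blast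
  define c0 where "c0 = \<theta> x0"
  have "x0 \<in> box (- ((G + 3) *\<^sub>R One)) ((G + 3) *\<^sub>R One)"
    using x0(1) by (fastforce simp: mem_box)
  then have c0: "0 < c0" unfolding c0_def \<theta>_def by (simp add: box_bump_pos_iff)
  define T where "T = enn2real (total_variation (ball 0 (\<rho> + 2)) v)"
  define A where "A = c0 * (1 / C) powr (1 / s) * (t / 4)"
  have A: "0 < A" unfolding A_def using c0 C t by simp
  obtain m :: nat where m: "T / A < real m" using reals_Archimedean2 by blast
  obtain m' :: nat where m': "1 / s \<le> real m'" using real_arch_simple by blast
  \<comment> \<open>The index is at least \<open>n\<close>, where the layers of this datum begin, at
    least \<open>m\<close>, which makes the bound exceed \<open>T\<close>, and at least
    \<open>1 / s\<close>, which lets \<open>growth\<close> apply to the exponent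
    \<open>1 / s\<close>.\<close>
  define N where "N = n + (m + m')"
  define \<kappa>' where "\<kappa>' = a * \<bar>\<omega> N \<bullet> j - \<beta> \<bullet> j\<bar> / 2"
  have \<kappa>0: "0 < \<kappa>'" using \<kappa>[of N] \<delta>(1)[of N] unfolding \<kappa>'_def by linarith
  have "c0 * (\<kappa>' / C) powr (1 / s) * (real (M N) * t / 4) \<le> T"
    unfolding T_def N_def
    by (rule cell_variation_bound[OF u g lip V G RGV lg j _ _ t s L C v b \<rho> _ x0(2)[folded c0_def]])
       (use \<kappa>[of N] c0 in \<open>auto simp: \<kappa>'_def N_def\<close>)
  moreover have "(\<kappa>' / C) powr (1 / s) = \<kappa>' powr (1 / s) * (1 / C) powr (1 / s)"
    using \<kappa>0 C powr_mult[of \<kappa>' "1 / C" "1 / s"] by simp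
  ultimately have 1: "A * (real (M N) * \<kappa>' powr (1 / s)) \<le> T" by (simp add: A_def mult_ac)
  have "real N + 1 \<le> real (M N) * (min \<kappa>' 1) ^ N" using growth[of N] by (simp add: \<kappa>'_def)
  also have "(min \<kappa>' 1) ^ N = (min \<kappa>' 1) powr real N" using \<kappa>0 by (simp add: powr_realpow)
  also have "\<dots> \<le> (min \<kappa>' 1) powr (1 / s)"
    using \<kappa>0 m' by (intro powr_mono') (auto simp: N_def)
  also have "\<dots> \<le> \<kappa>' powr (1 / s)" using \<kappa>0 s by (intro powr_mono2) auto
  finally have "real N + 1 \<le> real (M N) * \<kappa>' powr (1 / s)" by (simp add: mult_left_mono)
  then have "A * (real N + 1) \<le> T" using 1 A by (meson less_imp_le mult_left_mono order_trans)
  moreover have "T < A * real m" using m A by (simp add: divide_less_eq mult.commute)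
  moreover have "A * real m \<le> A * (real N + 1)" using A by (intro mult_left_mono) (auto simp: N_def)
  ultimately show False by linarith
qed

end

section \<open>Coordinates, speed bounds and parameters for the given system\<close>

lemma exists_other:
  assumes "2 \<le> CARD('i)"
  shows "\<exists>y :: 'i :: finite. y \<noteq> x"
proof (rule ccontr)
  assume "\<nexists>y. y \<noteq> x"
  then have "(UNIV :: 'i set) = {x}" by auto
  then have "CARD('i) = card {x}" by (rule arg_cong)
  with assms show False by simp
qed

theorem proposition6p1:
  fixes g :: "real \<Rightarrow> real"
    and h :: "real \<Rightarrow> real ^ 'm"
    and b :: "real ^ 'k"
    and e :: 'm
  assumes "CARD('k) \<ge> 2"
    and "CARD('m) \<ge> 2"
    and "g C1_differentiable_on UNIV"
    and "h = (\<lambda>r. axis e (g r))"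
    and "b \<noteq> 0"
    and "deriv g (norm b) \<noteq> 0"
  shows "\<exists>u0 :: nat \<Rightarrow> real ^ 'm \<Rightarrow> real ^ 'k.
           (\<forall>n. BV (\<lambda>z. u0 n z - b) \<and> Linf_norm (\<lambda>z. u0 n z - b) < \<infinity>) \<and>
           (\<lambda>n. BV_norm (\<lambda>z. u0 n z - b) + Linf_norm (\<lambda>z. u0 n z - b)) \<longlonglongrightarrow> 0 \<and>
           (\<exists>R>0. \<forall>n. \<forall>z. z \<notin> ball 0 R \<longrightarrow> u0 n z = b) \<and>
           (\<forall>n u. renormalized_entropy_solution h (u0 n) u \<longrightarrow>
              (\<forall>t\<in>{0<..<1}. \<forall>s\<in>{0<..<1}. \<not> BVs_loc s (\<lambda>z. u z t)))"
proof -
  define a where "a = norm b"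
  define \<beta> where "\<beta> = sgn b"
  have a: "0 < a" and \<beta>: "norm \<beta> = 1" and ab: "a *\<^sub>R \<beta> = b"
    using assms(5) by (auto simp: a_def \<beta>_def norm_sgn norm_scaleR_sgn)
  define e1 :: "real ^ 'm" where "e1 = axis e 1"
  obtain e' :: 'm where e': "e' \<noteq> e"
    using exists_other[OF assms(2)] by blast
  define e2 :: "real ^ 'm" where "e2 = axis e' 1"
  have e12: "e1 \<in> Basis" "e2 \<in> Basis" "e1 \<noteq> e2"
    using e' by (auto simp: e1_def e2_def axis_in_Basis_iff axis_eq_axis)
  have h: "h = (\<lambda>r. g r *\<^sub>R e1)"
    unfolding assms(4) e1_def by (auto simp: fun_eq_iff axis_def vec_eq_iff)
  obtain g' where g': "\<And>x. (g has_real_derivative g' x) (at x)" and cg': "continuous_on UNIV g'"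
    using assms(3) unfolding C1_differentiable_on_def has_real_derivative_iff_has_vector_derivative by blast
  have g: "continuous_on UNIV g"
    using DERIV_isCont[OF g'] by (simp add: continuous_on_eq_continuous_at)
  \<comment> \<open>If \<open>g\<close> were constant just to the right of \<open>a\<close>, the
    right difference quotients at \<open>a\<close> would vanish, and with them the
    derivative.\<close>
  have nonconst: "\<exists>x. 0 < x \<and> x < \<epsilon> \<and> g (a + x) \<noteq> g a" if "0 < \<epsilon>" for \<epsilon>
  proof (rule ccontr)
    assume n: "\<not> (\<exists>x. 0 < x \<and> x < \<epsilon> \<and> g (a + x) \<noteq> g a)"
    have "((\<lambda>h. (g (a + h) - g a) / h) \<longlongrightarrow> g' a) (at 0)" using g'[of a] by (simp add: DERIV_def)
    then have "((\<lambda>h. (g (a + h) - g a) / h) \<longlongrightarrow> g' a) (at_right 0)" by (rule filterlim_mono[OF _ order_refl at_le]) simp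
    moreover have "((\<lambda>h. (g (a + h) - g a) / h) \<longlongrightarrow> 0) (at_right 0)"
      by (rule tendsto_eventually, rule eventually_at_rightI[of 0 \<epsilon>]) (use n that in auto)
    ultimately have "g' a = 0" using tendsto_unique[of "at_right (0::real)"] by (metis trivial_limit_at_right_real)
    then show False using assms(6) DERIV_imp_deriv[OF g'[of a]] by (simp add: a_def)
  qed
  have lip: "\<exists>V\<ge>0. \<forall>x\<in>{c..c'}. \<forall>y\<in>{c..c'}. \<bar>x * g x - y * g y\<bar> \<le> V * \<bar>x - y\<bar>" for c c'
  proof (rule C1_imp_locally_lipschitz)
    show "((\<lambda>x. x * g x) has_real_derivative g x + x * g' x) (at x)" for x
      by (auto intro!: derivative_eq_intros g')
    show "continuous_on UNIV (\<lambda>x. g x + x * g' x)" by (intro continuous_intros g cg')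
  qed
  obtain V where V: "0 \<le> V" "\<And>x y. x \<in> {0..2 * a + 2} \<Longrightarrow> y \<in> {0..2 * a + 2} \<Longrightarrow> \<bar>x * g x - y * g y\<bar> \<le> V * \<bar>x - y\<bar>"
    using lip[of 0 "2 * a + 2"] by blast
  have "bounded (g ` {0..2 * a + 2})"
    by (intro compact_imp_bounded compact_continuous_image continuous_on_subset[OF g]) auto
  then obtain G where "\<forall>y\<in>g ` {0..2 * a + 2}. norm y \<le> G" unfolding bounded_iff by blast
  then have G: "\<bar>g x\<bar> \<le> G" if "x \<in> {0..2 * a + 2}" for x using that by (metis imageI real_norm_def)
  have G0: "0 \<le> G" using G[of 0] a by fastforce
  \<comment> \<open>Exactly the room that \<open>transported_in_strip\<close> asks for; both speeds
    are bounded on the range of the data before these are constructed.\<close>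
  define R where "R = 3 * G + V + 4"
  have R: "1 \<le> R" using G0 V(1) by (simp add: R_def)
  \<comment> \<open>The component that becomes irregular is one in which \<beta> does not vanish; a
    second coordinate, available by \<open>CARD('k) \<ge> 2\<close>, is the direction of the
    rotation.\<close>
  have "\<beta> \<noteq> 0" using \<beta> by auto
  then obtain j1 where j1: "\<beta> $ j1 \<noteq> 0" by (auto simp: vec_eq_iff)
  obtain k1 :: 'k where k1: "k1 \<noteq> j1"
    using exists_other[OF assms(1)] by blast
  define j :: "real ^ 'k" where "j = axis j1 1"
  have j: "j \<in> Basis" "\<beta> \<bullet> j \<noteq> 0" "axis k1 1 \<in> (Basis :: (real ^ 'k) set)" "j \<noteq> axis k1 1"
    using j1 k1 by (auto simp: j_def inner_axis axis_in_Basis_iff axis_eq_axis)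
  note ex = shear_parameters_exist[OF g nonconst \<beta> j(3) j(1,4,2) a R]
  obtain \<omega> :: "nat \<Rightarrow> real ^ 'k" and M K :: "nat \<Rightarrow> nat" and \<delta> d :: "nat \<Rightarrow> real" where
    P: "\<And>i. norm (\<omega> i) = 1 \<and> norm (\<omega> i - \<beta>) \<le> (1/2) ^ i \<and> 1 \<le> M i \<and> 0 < \<delta> i \<and> real (M i) * \<delta> i \<le> (1/2) ^ i \<and>
     0 < \<bar>g (a + \<delta> i) - g a\<bar> \<and> \<bar>g (a + \<delta> i) - g a\<bar> \<le> 1 \<and>
     R \<le> real (K i) * \<bar>g (a + \<delta> i) - g a\<bar> \<and> real (K i) * \<bar>g (a + \<delta> i) - g a\<bar> \<le> R + 1 \<and>
     0 < d i \<and> 2 * real (M i) * d i \<le> (1/2) ^ (i + 1) \<and> real (K i) * (2 * real (M i) * d i) \<le> 1 \<and>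
     0 < a * \<bar>\<omega> i \<bullet> j - \<beta> \<bullet> j\<bar> / 2 \<and> \<delta> i \<le> a * \<bar>\<omega> i \<bullet> j - \<beta> \<bullet> j\<bar> / 2 \<and>
     real i + 1 \<le> real (M i) * (min (a * \<bar>\<omega> i \<bullet> j - \<beta> \<bullet> j\<bar> / 2) 1) ^ i"
    using ex by metis
  define l where "l i = \<bar>g (a + \<delta> i) - g a\<bar>" for i
  interpret shear_data e1 e2 R a \<beta> \<omega> M K \<delta> l d
    by unfold_locales (use e12 R a \<beta> P[folded l_def] in blast)+
  have lip': "\<exists>V\<ge>0. \<forall>x\<in>{-c..c}. \<forall>y\<in>{-c..c}. \<bar>x * g x - y * g y\<bar> \<le> V * \<bar>x - y\<bar>" for c by (rule lip)
  have not: "\<not> BVs_loc s (\<lambda>z. u z t)"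
    if u: "renormalized_entropy_solution h (\<lambda>z. b + perturbation n z) u" and t: "0 < t" "t < 1" and s: "0 < s" for n u t s
  proof -
    have "\<not> BVs_loc_scalar s (\<lambda>z. u z t \<bullet> j)"
      by (rule not_BVs_loc_scalar[OF u[unfolded h ab[symmetric]] g lip' V G _ l_def j(1) _ _ t s]) (use P in \<open>auto simp: R_def\<close>)
    then show ?thesis unfolding BVs_loc_def j_def by (auto simp: inner_axis)
  qed
  have supp: "b + perturbation n z = b" if "z \<notin> ball 0 (DIM(real ^ 'm) * (2 * R + 2) + 1)" for n z
  proof -
    have "perturbation n z = 0"
    proof (rule ccontr)
      assume nz: "perturbation n z \<noteq> 0"
      have "norm z \<le> (\<Sum>i\<in>Basis. \<bar>z \<bullet> i\<bar>)" by (rule norm_le_l1)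
      also have "\<dots> \<le> (\<Sum>i\<in>(Basis :: (real ^ 'm) set). 2 * R + 2)" by (intro sum_mono perturbation_support[OF nz])
      finally show False using that by simp
    qed
    then show ?thesis by simp
  qed
  have pos: "0 < DIM(real ^ 'm) * (2 * R + 2) + 1" using R by (intro add_nonneg_pos) auto
  have sub: "(\<lambda>z. b + perturbation n z - b) = perturbation n" for n by simp
  show ?thesis
  proof (intro exI[of _ "\<lambda>n z. b + perturbation n z"] conjI allI ballI impI)
    show "BV (\<lambda>z. b + perturbation n z - b)" for n unfolding sub by (rule BV_perturbation)
    show "Linf_norm (\<lambda>z. b + perturbation n z - b) < \<infinity>" for n
      unfolding sub using le_less_trans[OF Linf_norm_perturbation] by simp
    show "(\<lambda>n. BV_norm (\<lambda>z. b + perturbation n z - b) + Linf_norm (\<lambda>z. b + perturbation n z - b)) \<longlonglongrightarrow> 0"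
      unfolding sub by (rule perturbation_tendsto_0)
    show "\<exists>R>0. \<forall>n z. z \<notin> ball 0 R \<longrightarrow> b + perturbation n z = b"
      using pos supp by blast
  qed (use not in auto)
qed

end
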